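(* Let $\mathbf h_N(t)$, $N=1,2,\dots$, be a sequence of Metropolis rate height processes and let $\mathbf w_N(t)=(w_1(t),\dots,w_N(t))$ be the corresponding third order finite difference processes. Suppose that: (i) $\mathbf w_N$ converges pointwise mesoscopically to $w$, i.e. $w$ is a continuous function of $(t,x)$, $t\ge 0$, $x\in\mathbb T$, such that $$\lim_{\epsilon\to0}\lim_{N\to\infty}\mathbb E\left|\overline{\mathbf w}_{N(x\pm\epsilon)}(t)-w(t,x)\right|^2=0\qquad\forall t\ge0,\ x\in\mathbb T;$$ (ii) there exists a continuous function $\hat J:\mathbb R\to\mathbb R$ such that for all $t>0$ and all $x\in\mathbb T$, $$\left|\mathbb E\,\bar J(\mathbf w_{N(x\pm\epsilon)}(t))-\hat J\left(\mathbb E\,\overline{\mathbf w}_{N(x\pm\epsilon)}(t)\right)\right|\to0\quad\text{as } N\to\infty\text{ and then }\epsilon\to0;$$ (iii) $\sup_N\sup_{i=1,\dots,N}\mathbb E|w_i(t)|<\infty$ for all $t\ge0$; (iv) $\sup_N\sup_{s\in(0,t]}\sup_{i=1,\dots,N}|\mathbb E J(w_i(s))|<\infty$ for all $t\ge0$. Then, with $w_0=w(0,\cdot)$, $w$ is a weak solution to $$\partial_t w=-\partial_{xxxx}\hat J(w),\quad t>0,\ x\in\mathbb T,\qquad w(0,x)=w_0(x),\quad x\in\mathbb T,$$ in the sense that $$\int_0^1\psi(x)\left[w(t,x)-w_0(x)\right]dx=-\int_0^t\int_0^1\psi^{(4)}(x)\hat J(w(s,x))\,dx\,ds\qquad\forall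 t>0,\ \psi\in C^4(\mathbb T).$$
   Context: $\mathbb T$ denotes the unit interval with periodic boundary conditions. Fix a constant $K>0$ (inverse temperature) and let $J(w)=2e^{-3K}\sinh(Kw)$. Metropolis rate height process: $\mathbf h_N(t)=(h_1(t),\dots,h_N(t))\in\mathbb Z^N$ is a continuous-time Markov jump process on height profiles over the periodic lattice $\{1,\dots,N\}$ (indices mod $N$), started from a random $\mathbf h_N(0)$. For $|i-j|=1$, the jump $\mathbf h\mapsto\mathbf h^{i,j}$ decreases $h_i$ by $1$, increases $h_j$ by $1$ and leaves the other heights unchanged. With $$w_i=z_{i-1}-2z_i+z_{i+1},\quad z_i=h_{i+1}-h_i,\qquad\text{i.e. } w_i=h_{i+2}-3h_{i+1}+3h_i-h_{i-1},$$ the jump $\mathbf h\mapsto\mathbf h^{i,i+1}$ occurs at rate $N^4e^{-3K+Kw_i}$ and the jump $\mathbf h\mapsto\mathbf h^{i+1,i}$ occurs at rate $N^4e^{-3K-Kw_i}$. The third order finite difference process is $\mathbf w_N(t)=(w_1(t),\dots,w_N(t))$ (all entries depend on $N$, suppressed in the notation). Window averages: for $x\in\mathbb T$, $\epsilon>0$, $i\in N(x\pm\epsilon)$ denotes those $i\in\{1,\dots,N\}$ with $|(i/N-x)\bmod 1|\le\epsilon$ (distance on the torus), and for a function $f:\mathbb R\to\mathbb R$ $$\overline{\mathbf w}_{N(x\pm\epsilon)}=\frac1{2N\epsilon}\sum_{i\in N(x\pm\epsilon)}w_i,\qquad \bar f(\mathbf w_{N(x\pm\epsilon)})=\frac1{2N\epsilon}\sum_{i\in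 N(x\pm\epsilon)}f(w_i).$$ *)

theory Defs
  imports "HOL-Probability.Probability"
begin

subsection \<open>Markov jump processes on a discrete state space\<close>

text \<open>
  \<open>q x y\<close> is the rate of the jump from \<open>x\<close> to \<open>y \<noteq> x\<close>; diagonal values \<open>q x x\<close> are ignored.
  The rates are meant to be nonnegative and summable in \<open>y\<close>.
\<close>

definition exit_rate :: "'s set \<Rightarrow> ('s \<Rightarrow> 's \<Rightarrow> real) \<Rightarrow> 's \<Rightarrow> real" where
  "exit_rate E q x = infsum (q x) (E - {x})"

definition jump_prob :: "'s set \<Rightarrow> ('s \<Rightarrow> 's \<Rightarrow> real) \<Rightarrow> 's \<Rightarrow> 's \<Rightarrow> real" where
  "jump_prob E q x y =
     (if exit_rate E q x = 0 then of_bool (y = x)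
      else if y = x then 0
      else q x y / exit_rate E q x)"

text \<open>
  Jump chain / holding time definition: given the embedded chain \<open>Y\<close>, which is a discrete-time
  Markov chain with transition probabilities \<open>jump_prob E q\<close>, the holding times
  \<open>H 0, H 1, \<dots>\<close> are independent, and \<open>H n\<close> is exponential with parameter \<open>exit_rate E q (Y n)\<close>
  (so \<open>H n = \<infinity>\<close> almost surely in an absorbing state, whence the type \<^typ>\<open>ennreal\<close>).
  The last condition says that \<open>X\<close> follows \<open>Y\<close> with these holding times and, as some \<open>n\<close>
  exists for every \<open>t\<close>, that the process does not explode.  The initial law is arbitrary.
\<close>

definition markov_jump_process ::
  "'a measure \<Rightarrow> 's set \<Rightarrow> ('s \<Rightarrow> 's \<Rightarrow> real) \<Rightarrow> (real \<Rightarrow> 'a \<Rightarrow> 's) \<Rightarrow> bool" where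
  "markov_jump_process M E q X \<longleftrightarrow>
     prob_space M \<and>
     (\<forall>t\<ge>0. X t \<in> measurable M (count_space E)) \<and>
     (\<exists>(Y :: nat \<Rightarrow> 'a \<Rightarrow> 's) (H :: nat \<Rightarrow> 'a \<Rightarrow> ennreal).
        (\<forall>n. Y n \<in> measurable M (count_space E)) \<and>
        (\<forall>n. H n \<in> borel_measurable M) \<and>
        (\<forall>(n::nat) (y :: nat \<Rightarrow> 's) (s :: nat \<Rightarrow> real).
           (\<forall>k\<le>n. y k \<in> E) \<longrightarrow> (\<forall>k<n. 0 \<le> s k) \<longrightarrow>
           measure M {\<omega> \<in> space M. (\<forall>k\<le>n. Y k \<omega> = y k) \<and> (\<forall>k<n. ennreal (s k) < H k \<omega>)} =
           measure M {\<omega> \<in> space M. Y 0 \<omega> = y 0} *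
           (\<Prod>k<n. jump_prob E q (y k) (y (Suc k)) * exp (- exit_rate E q (y k) * s k))) \<and>
        (AE \<omega> in M. \<forall>t\<ge>0. \<exists>n. (\<Sum>k<n. H k \<omega>) \<le> ennreal t \<and>
                                 ennreal t < (\<Sum>k<Suc n. H k \<omega>) \<and>
                                 X t \<omega> = Y n \<omega>))"


subsection \<open>The Metropolis rate height process\<close>

text \<open>
  \<open>\<int>\<^sup>N\<close> with indices taken mod \<open>N\<close> is represented by the \<open>N\<close>-periodic functions on \<open>\<int>\<close>.
\<close>

definition height_profiles :: "nat \<Rightarrow> (int \<Rightarrow> int) set" where
  "height_profiles N = {h. \<forall>i. h (i + int N) = h i}"

definition slope :: "(int \<Rightarrow> int) \<Rightarrow> int \<Rightarrow> int" where
  "slope h i = h (i + 1) - h i"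

definition third_diff :: "(int \<Rightarrow> int) \<Rightarrow> int \<Rightarrow> int" where
  "third_diff h i = slope h (i - 1) - 2 * slope h i + slope h (i + 1)"

lemma third_diff_heights: "third_diff h i = h (i + 2) - 3 * h (i + 1) + 3 * h i - h (i - 1)"
  by (simp add: third_diff_def slope_def add.commute)

text \<open>The profile \<open>h\<^bsup>i,j\<^esup>\<close>: one unit of height moves from site \<open>i\<close> to site \<open>j\<close>.\<close>

definition move_unit :: "nat \<Rightarrow> int \<Rightarrow> int \<Rightarrow> (int \<Rightarrow> int) \<Rightarrow> (int \<Rightarrow> int)" where
  "move_unit N i j h =
     (\<lambda>k. h k - of_bool (k mod int N = i mod int N) + of_bool (k mod int N = j mod int N))"

text \<open>
  The rates of all moves with the same target are added up.  For \<open>N \<ge> 3\<close> the \<open>2 N\<close> moves have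
  distinct targets.
\<close>

definition metropolis_rate :: "real \<Rightarrow> nat \<Rightarrow> (int \<Rightarrow> int) \<Rightarrow> (int \<Rightarrow> int) \<Rightarrow> real" where
  "metropolis_rate K N h h' =
     (\<Sum>i\<in>{1..int N}.
        real N ^ 4 * exp (- 3 * K + K * real_of_int (third_diff h i))
          * of_bool (h' = move_unit N i (i + 1) h) +
        real N ^ 4 * exp (- 3 * K - K * real_of_int (third_diff h i))
          * of_bool (h' = move_unit N (i + 1) i h))"

definition metropolis_height_process ::
  "real \<Rightarrow> nat \<Rightarrow> 'a measure \<Rightarrow> (real \<Rightarrow> 'a \<Rightarrow> int \<Rightarrow> int) \<Rightarrow> bool" where
  "metropolis_height_process K N M h \<longleftrightarrow>
     markov_jump_process M (height_profiles N) (metropolis_rate K N) h"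

definition J :: "real \<Rightarrow> real \<Rightarrow> real" where
  "J K w = 2 * exp (- 3 * K) * sinh (K * w)"


subsection \<open>Window averages and iterated limits\<close>

text \<open>Functions on the torus are 1-periodic functions on the reals.\<close>

definition torus_dist :: "real \<Rightarrow> real \<Rightarrow> real" where
  "torus_dist x y = min (frac (x - y)) (1 - frac (x - y))"

definition window :: "nat \<Rightarrow> real \<Rightarrow> real \<Rightarrow> int set" where
  "window N x \<epsilon> = {i \<in> {1..int N}. torus_dist (real_of_int i / real N) x \<le> \<epsilon>}"

definition window_avg :: "nat \<Rightarrow> real \<Rightarrow> real \<Rightarrow> (int \<Rightarrow> real) \<Rightarrow> real" where
  "window_avg N x \<epsilon> a = 1 / (2 * real N * \<epsilon>) * (\<Sum>i\<in>window N x \<epsilon>. a i)"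

text \<open>
  \<open>lim\<^bsub>\<epsilon>\<rightarrow>0\<^esub> lim\<^bsub>N\<rightarrow>\<infinity>\<^esub> f \<epsilon> N = l\<close>, where the inner limit has to exist for all small \<open>\<epsilon> > 0\<close>.
\<close>

definition iterated_limit :: "(real \<Rightarrow> nat \<Rightarrow> 'b::topological_space) \<Rightarrow> 'b \<Rightarrow> bool" where
  "iterated_limit f l \<longleftrightarrow>
     (\<exists>g. (\<forall>\<^sub>F \<epsilon> in at_right 0. f \<epsilon> \<longlonglongrightarrow> g \<epsilon>) \<and> (g \<longlongrightarrow> l) (at_right 0))"


subsection \<open>Weak solutions\<close>

definition C4_torus :: "(real \<Rightarrow> real) \<Rightarrow> bool" where
  "C4_torus \<psi> \<longleftrightarrow>
     (\<forall>x. \<psi> (x + 1) = \<psi> x) \<and>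
     (\<forall>k<4. \<forall>x. (deriv ^^ k) \<psi> differentiable (at x)) \<and>
     continuous_on UNIV ((deriv ^^ 4) \<psi>)"

definition continuous_time_torus :: "(real \<Rightarrow> real \<Rightarrow> real) \<Rightarrow> bool" where
  "continuous_time_torus w \<longleftrightarrow>
     (\<forall>t\<ge>0. \<forall>x. w t (x + 1) = w t x) \<and>
     continuous_on ({0..} \<times> UNIV) (\<lambda>(t, x). w t x)"

text \<open>Weak solutions of \<open>\<partial>\<^sub>t w = - \<partial>\<^sub>x\<^sub>x\<^sub>x\<^sub>x F(w)\<close> on the torus with initial datum \<open>w\<^sub>0\<close>.\<close>

definition weak_solution ::
  "(real \<Rightarrow> real) \<Rightarrow> (real \<Rightarrow> real) \<Rightarrow> (real \<Rightarrow> real \<Rightarrow> real) \<Rightarrow> bool" where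
  "weak_solution F w\<^sub>0 w \<longleftrightarrow>
     (\<forall>t>0. \<forall>\<psi>. C4_torus \<psi> \<longrightarrow>
        integral {0..1} (\<lambda>x. \<psi> x * (w t x - w\<^sub>0 x)) =
        - integral {0..t} (\<lambda>s. integral {0..1} (\<lambda>x. (deriv ^^ 4) \<psi> x * F (w s x))))"

end

theory Submission
  imports Defs
begin

text \<open>
  Write \<open>E\<close> for the expectation and \<open>\<delta>\<^sup>4\<close> for the central fourth difference.  Tested against \<open>\<psi>\<close>, the
  process gives the sums \<open>1/N \<Sum>\<^sub>i \<psi>(i/N) w\<^sub>i(t)\<close>.  Two opposite moves at a bond
  have opposite effects on such a sum, so only the difference of their rates, \<open>N\<^sup>4 J(w\<^sub>i)\<close>, enters
  its generator, and summation by parts puts the discrete conservation law on the test function: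
  the expectation of the sum changes by the time integral of
  \<open>- 1/N \<Sum>\<^sub>i N\<^sup>4 (\<delta>\<^sup>4\<psi>)(i/N) E J(w\<^sub>i)\<close> (\<open>metropolis_evolution\<close>).  Taylor's formula turns
  \<open>N\<^sup>4 \<delta>\<^sup>4\<psi>\<close> into the fourth derivative.  The averaging lemma \<open>mesoscopic_average\<close> replaces the
  microscopic quantities by their window averages, hence by \<open>w\<close> and, through local equilibrium and
  the continuity of \<open>Jhat\<close>, by \<open>Jhat(w)\<close>.  Dominated convergence in time concludes; the uniform
  bounds on \<open>E w\<^sub>i\<close> and \<open>E J(w\<^sub>i)\<close> dominate.

  The evolution equation of the expectations is the delicate point.  The rates grow exponentially,
  the initial law is arbitrary up to a first moment, and the bound on \<open>E J(w\<^sub>i(s))\<close> says nothing about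
  the absolute value \<open>\<bar>J(w\<^sub>i(s))\<bar>\<close>, so Dynkin's formula needs an a priori estimate.  It comes from
  a Lyapunov function: the energy \<open>\<Sum> z\<^sub>i\<^sup>2\<close> of the slopes is strongly dissipated, and its square
  root, still integrable at time \<open>0\<close>, satisfies a drift inequality \<open>L V \<le> C - c \<Sum>\<^sub>i cosh (K w\<^sub>i)\<close>
  (\<open>lyapunov_drift\<close>).  Hence the total jump rate is integrable over bounded time intervals and over
  the probability space.

  Both the a priori estimate and Dynkin's formula are derived from the description of the process by
  its jump chain and holding times.  The expected number of jumps from \<open>x\<close> to \<open>y\<close> at a given step
  before time \<open>t\<close> is \<open>q x y\<close> times the expected time that the step spends in \<open>x\<close> before \<open>t\<close>
  (\<open>jump_rate\<close>, \<open>levy_system_step\<close>).  Summing over the steps expresses the expected increments of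
  any function along the path by time integrals, with all terms nonnegative.
\<close>

section \<open>The law of the jump chain and its holding times\<close>

text \<open>
  The embedded chain \<open>Y\<close> and the holding times \<open>H\<close> of a jump process.  Only finitely many states can
  be reached by one jump, so exit rates are finite sums.
\<close>

locale jump_chain_law = prob_space M
  for M :: "'a measure" and E :: "'s set" and q :: "'s \<Rightarrow> 's \<Rightarrow> real"
    and Y :: "nat \<Rightarrow> 'a \<Rightarrow> 's" and H :: "nat \<Rightarrow> 'a \<Rightarrow> ennreal" +
  assumes countable_E: "countable E"
    and rate_nonneg: "\<And>x y. x \<in> E \<Longrightarrow> y \<in> E \<Longrightarrow> 0 \<le> q x y"
    and rate_finite: "\<And>x. x \<in> E \<Longrightarrow> finite {y \<in> E - {x}. q x y \<noteq> 0}"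
    and Y_measurable [measurable]: "\<And>n. Y n \<in> measurable M (count_space E)"
    and H_measurable [measurable]: "\<And>n. H n \<in> borel_measurable M"
    and chain_law: "\<And>n y s. \<lbrakk>\<forall>k\<le>n. y k \<in> E; \<forall>k<n. 0 \<le> s k\<rbrakk> \<Longrightarrow>
           measure M {\<omega> \<in> space M. (\<forall>k\<le>n. Y k \<omega> = y k) \<and> (\<forall>k<n. ennreal (s k) < H k \<omega>)} =
           measure M {\<omega> \<in> space M. Y 0 \<omega> = y 0} *
           (\<Prod>k<n. jump_prob E q (y k) (y (Suc k)) * exp (- exit_rate E q (y k) * s k))"
begin

lemma exit_rate_sum:
  assumes "x \<in> E"
  shows "exit_rate E q x = (\<Sum>y | y \<in> E - {x} \<and> q x y \<noteq> 0. q x y)"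
proof -
  have "exit_rate E q x = infsum (q x) {y \<in> E - {x}. q x y \<noteq> 0}"
    unfolding exit_rate_def by (rule infsum_cong_neutral) auto
  also have "\<dots> = (\<Sum>y | y \<in> E - {x} \<and> q x y \<noteq> 0. q x y)"
    using rate_finite[OF assms] by (simp add: infsum_finite)
  finally show ?thesis .
qed

lemma exit_rate_nonneg: "\<And>x y. x \<in> E \<Longrightarrow> 0 \<le> exit_rate E q x"
  by (subst exit_rate_sum) (auto intro!: sum_nonneg rate_nonneg)

lemma jump_prob_nonneg: "x \<in> E \<Longrightarrow> y \<in> E \<Longrightarrow> 0 \<le> jump_prob E q x y"
  by (auto simp: jump_prob_def rate_nonneg exit_rate_nonneg)

lemma rate_eq_exit_rate_jump_prob:
  assumes "x \<in> E" "y \<in> E" "x \<noteq> y"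
  shows "q x y = exit_rate E q x * jump_prob E q x y"
proof (cases "exit_rate E q x = 0")
  case True
  have "q x y = 0"
  proof (rule ccontr)
    assume "q x y \<noteq> 0"
    then have "q x y \<le> exit_rate E q x"
      unfolding exit_rate_sum[OF assms(1)] using assms rate_finite[OF assms(1)]
      by (intro member_le_sum) (auto intro!: rate_nonneg)
    with \<open>q x y \<noteq> 0\<close> True rate_nonneg[OF assms(1,2)] show False by simp
  qed
  then show ?thesis using True by simp
next
  case False
  then show ?thesis using assms by (simp add: jump_prob_def)
qed

lemma jump_prob_sums_to_one:
  assumes x: "x \<in> E"
  shows "(\<integral>\<^sup>+y. ennreal (jump_prob E q x y) \<partial>count_space E) = 1"
proof (cases "exit_rate E q x = 0")
  case True
  have "(\<integral>\<^sup>+y. ennreal (jump_prob E q x y) \<partial>count_space E) = (\<Sum>y\<in>{x}. ennreal (jump_prob E q x y))"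
    using x True by (intro nn_integral_count_space') (auto simp: jump_prob_def)
  then show ?thesis using True by (simp add: jump_prob_def)
next
  case False
  let ?S = "{y \<in> E - {x}. q x y \<noteq> 0}"
  have "(\<integral>\<^sup>+y. ennreal (jump_prob E q x y) \<partial>count_space E) = (\<Sum>y\<in>?S. ennreal (jump_prob E q x y))"
    using x False rate_finite[OF x] by (intro nn_integral_count_space') (auto simp: jump_prob_def)
  also have "\<dots> = ennreal (\<Sum>y\<in>?S. jump_prob E q x y)"
    using x by (intro sum_ennreal) (auto intro!: jump_prob_nonneg)
  also have "(\<Sum>y\<in>?S. jump_prob E q x y) = (\<Sum>y\<in>?S. q x y) / exit_rate E q x"
    unfolding sum_divide_distrib using False by (intro sum.cong) (auto simp: jump_prob_def)
  also have "\<dots> = 1" using exit_rate_sum[OF x] False by simp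
  finally show ?thesis by simp
qed

text \<open>
  The numbers of prescribed states and of constrained holding times are independent parameters:
  \<open>m = n\<close> is the past of the \<open>n\<close>-th holding time, \<open>m = Suc n\<close> is the past of the \<open>n\<close>-th jump.
\<close>

definition cylinder :: "nat \<Rightarrow> nat \<Rightarrow> (nat \<Rightarrow> 's) \<Rightarrow> (nat \<Rightarrow> real) \<Rightarrow> 'a set" where
  "cylinder n m y s =
     {\<omega> \<in> space M. (\<forall>k\<le>n. Y k \<omega> = y k) \<and> (\<forall>k<m. ennreal (s k) < H k \<omega>)}"

lemma Y_in_E: "\<omega> \<in> space M \<Longrightarrow> Y n \<omega> \<in> E"
  using measurable_space[OF Y_measurable] by simp

lemma Y_eq_event [measurable]: "{\<omega> \<in> space M. Y n \<omega> = y} \<in> events"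
proof (cases "y \<in> E")
  case True
  have "Y n -` {y} \<inter> space M \<in> events" using True by (intro measurable_sets[OF Y_measurable]) auto
  then show ?thesis by (simp add: vimage_def Int_def conj_commute)
next
  case False
  then have "{\<omega> \<in> space M. Y n \<omega> = y} = {}" using Y_in_E by auto
  then show ?thesis by simp
qed

lemma Y_eq_pred [measurable]: "Measurable.pred M (\<lambda>\<omega>. Y n \<omega> = y)"
  by (simp add: pred_def Y_eq_event)

lemma cylinder_event [measurable]: "cylinder n m y s \<in> events"
  unfolding cylinder_def by measurable

lemma emeasure_split_state:
  assumes A: "A \<in> events"
  shows "emeasure M A = (\<integral>\<^sup>+x. emeasure M (A \<inter> {\<omega> \<in> space M. Y n \<omega> = x}) \<partial>count_space E)"
proof -
  have "A = (\<Union>x\<in>E. A \<inter> {\<omega> \<in> space M. Y n \<omega> = x})"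
    using sets.sets_into_space[OF A] Y_in_E by auto
  then have "emeasure M A = emeasure M (\<Union>x\<in>E. A \<inter> {\<omega> \<in> space M. Y n \<omega> = x})" by simp
  also have "\<dots> = (\<integral>\<^sup>+x. emeasure M (A \<inter> {\<omega> \<in> space M. Y n \<omega> = x}) \<partial>count_space E)"
    using A countable_E by (intro emeasure_UN_countable) (auto simp: disjoint_family_on_def)
  finally show ?thesis .
qed

text \<open>
  Prescribing also the next state, the law of the chain applies; summation over that state removes its
  transition probability and leaves the exponential factor.
\<close>

lemma cylinder_next_time:
  assumes y: "\<forall>k\<le>n. y k \<in> E" and s: "\<forall>k\<le>n. 0 \<le> s k"
  shows "measure M (cylinder n (Suc n) y s)
       = exp (- exit_rate E q (y n) * s n) * measure M (cylinder n n y s)" (is "_ = ?e * ?m")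
proof -
  have "emeasure M (cylinder n (Suc n) y s)
      = (\<integral>\<^sup>+x. emeasure M (cylinder n (Suc n) y s \<inter> {\<omega> \<in> space M. Y (Suc n) \<omega> = x}) \<partial>count_space E)"
    by (rule emeasure_split_state) measurable
  also have "\<dots> = (\<integral>\<^sup>+x. ennreal (?m * ?e) * ennreal (jump_prob E q (y n) x) \<partial>count_space E)"
  proof (rule nn_integral_cong)
    fix x assume "x \<in> space (count_space E)"
    then have x: "x \<in> E" by simp
    let ?y = "y(Suc n := x)"
    have eq: "cylinder n (Suc n) y s \<inter> {\<omega> \<in> space M. Y (Suc n) \<omega> = x}
        = {\<omega> \<in> space M. (\<forall>k\<le>Suc n. Y k \<omega> = ?y k) \<and> (\<forall>k<Suc n. ennreal (s k) < H k \<omega>)}"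
      by (auto simp: cylinder_def le_Suc_eq)
    have "measure M (cylinder n (Suc n) y s \<inter> {\<omega> \<in> space M. Y (Suc n) \<omega> = x}) =
        measure M {\<omega> \<in> space M. Y 0 \<omega> = ?y 0} *
           (\<Prod>k<Suc n. jump_prob E q (?y k) (?y (Suc k)) * exp (- exit_rate E q (?y k) * s k))"
      unfolding eq using y s x by (intro chain_law) (auto simp: le_Suc_eq)
    also have "\<dots> = (measure M {\<omega> \<in> space M. Y 0 \<omega> = y 0} *
           (\<Prod>k<n. jump_prob E q (y k) (y (Suc k)) * exp (- exit_rate E q (y k) * s k)))
           * (jump_prob E q (y n) x * ?e)"
      by simp
    also have "\<dots> = ?m * (jump_prob E q (y n) x * ?e)"
      unfolding cylinder_def using y s by (subst chain_law) auto
    finally show "emeasure M (cylinder n (Suc n) y s \<inter> {\<omega> \<in> space M. Y (Suc n) \<omega> = x})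
      = ennreal (?m * ?e) * ennreal (jump_prob E q (y n) x)"
      using y x by (simp add: emeasure_eq_measure ennreal_mult'[symmetric] jump_prob_nonneg ac_simps)
  qed
  also have "\<dots> = ennreal (?m * ?e)"
    using y by (simp add: nn_integral_cmult jump_prob_sums_to_one)
  finally show ?thesis
    by (simp add: emeasure_eq_measure mult.commute)
qed

lemma cylinder_next_state:
  assumes y: "\<forall>k\<le>Suc n. y k \<in> E" and s: "\<forall>k\<le>n. 0 \<le> s k"
  shows "measure M (cylinder (Suc n) (Suc n) y s)
       = jump_prob E q (y n) (y (Suc n)) * measure M (cylinder n (Suc n) y s)"
proof -
  have "measure M (cylinder (Suc n) (Suc n) y s) = measure M {\<omega> \<in> space M. Y 0 \<omega> = y 0} *
     (\<Prod>k<Suc n. jump_prob E q (y k) (y (Suc k)) * exp (- exit_rate E q (y k) * s k))"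
    unfolding cylinder_def using y s by (intro chain_law) auto
  also have "\<dots> = (measure M {\<omega> \<in> space M. Y 0 \<omega> = y 0} *
     (\<Prod>k<n. jump_prob E q (y k) (y (Suc k)) * exp (- exit_rate E q (y k) * s k)))
     * jump_prob E q (y n) (y (Suc n)) * exp (- exit_rate E q (y n) * s n)"
    by simp
  also have "\<dots> = measure M (cylinder n n y s)
     * jump_prob E q (y n) (y (Suc n)) * exp (- exit_rate E q (y n) * s n)"
    unfolding cylinder_def using y s by (subst chain_law) auto
  finally show ?thesis
    using cylinder_next_time[of n y s] y s by simp
qed

lemma countable_paths: "countable (PiE {..n::nat} (\<lambda>_. E))"
  by (intro countable_PiE) (auto intro: countable_E)

text \<open>
  By the preceding lemma with \<open>s = 0\<close>, requiring \<open>H n > 0\<close> costs no probability on any of the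
  countably many paths of length \<open>n\<close>.
\<close>

lemma AE_holding_times_pos: "AE \<omega> in M. \<forall>n. 0 < H n \<omega>"
proof -
  let ?C = "\<lambda>n m y. cylinder n m y (\<lambda>_. 0)"
  have null: "AE \<omega> in M. \<forall>y\<in>PiE {..n} (\<lambda>_. E). \<omega> \<notin> ?C n n y - ?C n (Suc n) y" for n
    unfolding AE_ball_countable[OF countable_paths]
  proof
    fix y assume "y \<in> PiE {..n} (\<lambda>_. E)"
    then have "measure M (?C n (Suc n) y) = measure M (?C n n y)"
      by (subst cylinder_next_time) (auto dest: PiE_mem)
    moreover have "?C n (Suc n) y \<subseteq> ?C n n y" by (auto simp: cylinder_def)
    ultimately have "measure M (?C n n y - ?C n (Suc n) y) = 0"
      by (simp add: finite_measure_Diff)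
    then have "?C n n y - ?C n (Suc n) y \<in> null_sets M"
      by (auto intro!: null_setsI simp: emeasure_eq_measure)
    then show "AE \<omega> in M. \<omega> \<notin> ?C n n y - ?C n (Suc n) y" by (rule AE_not_in)
  qed
  have "AE \<omega> in M. \<forall>k<n. 0 < H k \<omega>" for n
  proof (induction n)
    case (Suc n)
    from Suc null[of n] AE_space show ?case
    proof eventually_elim
      case (elim \<omega>)
      let ?y = "\<lambda>k\<in>{..n}. Y k \<omega>"
      have "?y \<in> PiE {..n} (\<lambda>_. E)" "\<omega> \<in> ?C n n ?y"
        using elim Y_in_E by (auto simp: cylinder_def)
      with elim have "\<omega> \<in> ?C n (Suc n) ?y" by blast
      then show ?case by (simp add: cylinder_def)
    qed
  qed simp
  then have "AE \<omega> in M. \<forall>n. \<forall>k<n. 0 < H k \<omega>" by (simp add: AE_all_countable)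
  then show ?thesis by eventually_elim blast
qed

end

text \<open>
  Holding times that are positive everywhere, and not only almost surely, make the cylinders with
  \<open>s = 0\<close> cover the sample space, so that the cylinders generate the \<open>\<sigma>\<close>-algebra of the past exactly
  and not merely up to null sets.
\<close>

locale jump_chain = jump_chain_law M E q Y H
  for M :: "'a measure" and E :: "'s set" and q :: "'s \<Rightarrow> 's \<Rightarrow> real"
    and Y :: "nat \<Rightarrow> 'a \<Rightarrow> 's" and H :: "nat \<Rightarrow> 'a \<Rightarrow> ennreal" +
  assumes H_pos: "\<omega> \<in> space M \<Longrightarrow> 0 < H n \<omega>"
begin

definition cylinders :: "nat \<Rightarrow> nat \<Rightarrow> 'a set set" where
  "cylinders n m = insert {} {cylinder n m y s |y s. (\<forall>k\<le>n. y k \<in> E) \<and> (\<forall>k<m. 0 \<le> s k)}"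

lemma cylinder_in_cylinders:
  "(\<forall>k\<le>n. y k \<in> E) \<Longrightarrow> (\<forall>k<m. 0 \<le> s k) \<Longrightarrow> cylinder n m y s \<in> cylinders n m"
  unfolding cylinders_def by blast

lemma cylinders_events: "cylinders n m \<subseteq> events"
  unfolding cylinders_def by (auto intro: cylinder_event)

lemma Int_stable_cylinders: "Int_stable (cylinders n m)"
proof (rule Int_stableI)
  fix A B assume "A \<in> cylinders n m" "B \<in> cylinders n m"
  then consider "A = {} \<or> B = {}"
    | y s y' s' where "A = cylinder n m y s" "\<forall>k\<le>n. y k \<in> E" "\<forall>k<m. 0 \<le> s k"
      "B = cylinder n m y' s'" "\<forall>k\<le>n. y' k \<in> E" "\<forall>k<m. 0 \<le> s' k"
    unfolding cylinders_def by blast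
  then show "A \<inter> B \<in> cylinders n m"
  proof cases
    case 1
    then show ?thesis by (auto simp: cylinders_def)
  next
    case 2
    show ?thesis
    proof (cases "\<forall>k\<le>n. y k = y' k")
      case True
      have "ennreal (max a b) < r \<longleftrightarrow> ennreal a < r \<and> ennreal b < r" for a b r
        by (cases "a \<le> b") (auto simp: max_def intro: le_less_trans[OF ennreal_leI[of a b]] le_less_trans[OF ennreal_leI[of b a]])
      then have "A \<inter> B = cylinder n m y (\<lambda>k. max (s k) (s' k))"
        using True unfolding 2 cylinder_def by auto
      then show ?thesis using 2 by (auto intro!: cylinder_in_cylinders simp: le_max_iff_disj)
    next
      case False
      then have "A \<inter> B = {}" unfolding 2 cylinder_def by auto
      then show ?thesis by (simp add: cylinders_def)
    qed
  qed
qed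

text \<open>
  The \<open>\<sigma>\<close>-algebra generated by the states up to index \<open>n\<close> and the first \<open>m\<close> holding times.
\<close>

definition history :: "nat \<Rightarrow> nat \<Rightarrow> 'a measure" where
  "history n m = sigma (space M) (cylinders n m)"

lemma space_history [simp]: "space (history n m) = space M"
  unfolding history_def by (rule space_measure_of) (use cylinders_events sets.sets_into_space in blast)

lemma sets_history: "sets (history n m) = sigma_sets (space M) (cylinders n m)"
  unfolding history_def by (rule sets_measure_of) (use cylinders_events sets.sets_into_space in blast)

text \<open>
  Such an event is the union of the cylinders of its paths, which are countably many.
\<close>

lemma path_event_in_history:
  "{\<omega> \<in> space M. P (\<lambda>k\<in>{..n}. Y k \<omega>) \<and> (\<forall>k<m. ennreal (s k) < H k \<omega>)} \<in> sets (history n m)"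
  if s: "\<forall>k<m. 0 \<le> s k"
proof -
  have "{\<omega> \<in> space M. P (\<lambda>k\<in>{..n}. Y k \<omega>) \<and> (\<forall>k<m. ennreal (s k) < H k \<omega>)}
      = (\<Union>y\<in>{y \<in> PiE {..n} (\<lambda>_. E). P y}. cylinder n m y s)" (is "?L = ?R")
  proof (intro equalityI subsetI)
    fix \<omega> assume w: "\<omega> \<in> ?L"
    have "\<omega> \<in> cylinder n m (\<lambda>k\<in>{..n}. Y k \<omega>) s" using w unfolding cylinder_def by auto
    moreover have "(\<lambda>k\<in>{..n}. Y k \<omega>) \<in> PiE {..n} (\<lambda>_. E)" using w Y_in_E by auto
    ultimately show "\<omega> \<in> ?R" using w by blast
  next
    fix \<omega> assume "\<omega> \<in> ?R"
    then obtain y where y: "y \<in> PiE {..n} (\<lambda>_. E)" "P y" "\<omega> \<in> cylinder n m y s" by blast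
    have "(\<lambda>k\<in>{..n}. Y k \<omega>) = y" using y(1,3) unfolding cylinder_def
      by (auto simp: PiE_def extensional_def restrict_def fun_eq_iff)
    then show "\<omega> \<in> ?L" using y unfolding cylinder_def by auto
  qed
  moreover have "?R \<in> sets (history n m)"
  proof (rule sets.countable_UN')
    show "countable {y \<in> PiE {..n} (\<lambda>_. E). P y}"
      by (rule countable_subset[OF _ countable_paths[of n]]) auto
    have "cylinder n m y s \<in> sets (history n m)" if "y \<in> {y \<in> PiE {..n} (\<lambda>_. E). P y}" for y
      unfolding sets_history using that s
      by (intro sigma_sets.Basic cylinder_in_cylinders) (auto dest: PiE_mem)
    then show "(\<lambda>y. cylinder n m y s) ` {y \<in> PiE {..n} (\<lambda>_. E). P y} \<subseteq> sets (history n m)"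
      by blast
  qed
  ultimately show ?thesis by simp
qed

lemma H_history_measurable: 
  assumes "k < m" shows "H k \<in> borel_measurable (history n m)"
proof (rule borel_measurableI_greater)
  fix a :: ennreal
  show "{\<omega> \<in> space (history n m). a < H k \<omega>} \<in> sets (history n m)"
  proof (cases a)
    case (real r)
    let ?s = "(\<lambda>_. 0)(k := r)"
    have eq: "{\<omega> \<in> space (history n m). a < H k \<omega>}
      = {\<omega> \<in> space M. True \<and> (\<forall>j<m. ennreal (?s j) < H j \<omega>)}"
      using assms H_pos real by auto
    show ?thesis
      unfolding eq by (rule path_event_in_history[where P="\<lambda>_. True"]) (use real in auto)
  qed auto
qed

lemma sets_history_le: "sets (history n m) \<subseteq> events"
  unfolding sets_history using cylinders_events by (rule sets.sigma_sets_subset)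

text \<open>
  Dynkin's \<open>\<pi>\<close>-\<open>\<lambda>\<close> argument.  The sample space itself is in general not a cylinder, but it is the
  disjoint union of the cylinders of all paths, which yields the proportionality for it.
\<close>

lemma history_proportional:
  assumes A: "A \<in> events" and A': "A' \<in> events"
    and cyl: "\<And>y s. (\<forall>k\<le>n. y k \<in> E) \<Longrightarrow> (\<forall>k<m. 0 \<le> s k) \<Longrightarrow>
      measure M (cylinder n m y s \<inter> A') = c * measure M (cylinder n m y s \<inter> A)"
    and c: "0 \<le> c" and B: "B \<in> sets (history n m)"
  shows "measure M (B \<inter> A') = c * measure M (B \<inter> A)"
proof -
  let ?\<Omega> = "space M"
  have ev: "X \<in> sigma_sets ?\<Omega> (cylinders n m) \<Longrightarrow> X \<in> events" for X
    using sets_history_le sets_history by blast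
  have Un: "emeasure M (\<Union> (range X) \<inter> D) = (\<Sum>i. emeasure M (X i \<inter> D))"
    if "range X \<subseteq> sigma_sets ?\<Omega> (cylinders n m)" "disjoint_family X" "D \<in> events" for X :: "nat \<Rightarrow> 'a set" and D
  proof -
    have "(\<Sum>i. emeasure M (X i \<inter> D)) = emeasure M (\<Union>i. X i \<inter> D)"
    proof (rule suminf_emeasure)
      show "range (\<lambda>i. X i \<inter> D) \<subseteq> events" using that ev by (auto intro!: sets.Int)
      show "disjoint_family (\<lambda>i. X i \<inter> D)" using that(2) unfolding disjoint_family_on_def by blast
    qed
    then show ?thesis by (simp add: Int_UN_distrib2)
  qed
  have space: "measure M (?\<Omega> \<inter> A') = c * measure M (?\<Omega> \<inter> A)"
  proof -
    let ?C = "\<lambda>y. cylinder n m y (\<lambda>_. 0)" and ?I = "PiE {..n} (\<lambda>_. E)"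
    have decomp: "emeasure M D = (\<integral>\<^sup>+y. emeasure M (?C y \<inter> D) \<partial>count_space ?I)" if "D \<in> events" for D
    proof -
      have "D = (\<Union>y\<in>?I. ?C y \<inter> D)"
      proof (intro equalityI subsetI)
        fix \<omega> assume w: "\<omega> \<in> D"
        then have "\<omega> \<in> space M" using that sets.sets_into_space by blast
        then have "(\<lambda>k\<in>{..n}. Y k \<omega>) \<in> ?I" "\<omega> \<in> ?C (\<lambda>k\<in>{..n}. Y k \<omega>)"
          using Y_in_E H_pos by (auto simp: cylinder_def)
        then show "\<omega> \<in> (\<Union>y\<in>?I. ?C y \<inter> D)" using w by blast
      qed auto
      then have "emeasure M D = emeasure M (\<Union>y\<in>?I. ?C y \<inter> D)" by simp
      also have "\<dots> = (\<integral>\<^sup>+y. emeasure M (?C y \<inter> D) \<partial>count_space ?I)"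
      proof (rule emeasure_UN_countable)
        show "disjoint_family_on (\<lambda>y. ?C y \<inter> D) ?I"
          unfolding disjoint_family_on_def
        proof (intro ballI impI, rule ccontr)
          fix y y' assume yy: "y \<in> ?I" "y' \<in> ?I" "y \<noteq> y'" "?C y \<inter> D \<inter> (?C y' \<inter> D) \<noteq> {}"
          then have "\<forall>k\<le>n. y k = y' k" unfolding cylinder_def by auto
          then have "y = y'" using yy(1,2) by (intro PiE_ext) auto
          with yy(3) show False by simp
        qed
      qed (use that in \<open>auto intro: countable_paths\<close>)
      finally show ?thesis .
    qed
    have "emeasure M A' = (\<integral>\<^sup>+y. ennreal c * emeasure M (?C y \<inter> A) \<partial>count_space ?I)"
      unfolding decomp[OF A']
    proof (rule nn_integral_cong)
      fix y assume "y \<in> space (count_space ?I)"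
      then show "emeasure M (?C y \<inter> A') = ennreal c * emeasure M (?C y \<inter> A)"
        using cyl[of y "\<lambda>_. 0"] c
        by (auto simp: emeasure_eq_measure ennreal_mult[symmetric] Pi_iff PiE_def)
    qed
    also have "\<dots> = ennreal c * emeasure M A" by (simp add: nn_integral_cmult decomp[OF A])
    finally show ?thesis using c A A' sets.sets_into_space
      by (simp add: emeasure_eq_measure ennreal_mult[symmetric] Int_absorb1)
  qed
  from B have B: "B \<in> sigma_sets ?\<Omega> (cylinders n m)" by (simp add: sets_history)
  have "cylinders n m \<subseteq> Pow ?\<Omega>" using cylinders_events sets.sets_into_space by blast
  from Int_stable_cylinders this B show ?thesis
  proof (induction rule: sigma_sets_induct_disjoint)
    case (basic X)
    then show ?case using cyl unfolding cylinders_def by auto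
  next
    case empty
    then show ?case by simp
  next
    case (compl X)
    have X: "X \<in> events" using compl ev by blast
    have "measure M ((?\<Omega> - X) \<inter> D) = measure M (?\<Omega> \<inter> D) - measure M (X \<inter> D)" if "D \<in> events" for D
    proof -
      have "(?\<Omega> - X) \<inter> D = (?\<Omega> \<inter> D) - (X \<inter> D)" by auto
      moreover have "X \<inter> D \<subseteq> ?\<Omega> \<inter> D" using X sets.sets_into_space by blast
      ultimately show ?thesis using X that by (simp add: finite_measure_Diff)
    qed
    then show ?case using A A' compl.IH space by (simp only: right_diff_distrib)
  next
    case (union X)
    have "emeasure M (\<Union> (range X) \<inter> A') = (\<Sum>i. emeasure M (X i \<inter> A'))"
      using union A' by (intro Un) auto
    also have "\<dots> = (\<Sum>i. ennreal c * emeasure M (X i \<inter> A))"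
      using union c by (simp add: emeasure_eq_measure ennreal_mult[symmetric])
    also have "\<dots> = ennreal c * emeasure M (\<Union> (range X) \<inter> A)"
      using union A by (subst Un) auto
    finally show ?case using c by (simp add: emeasure_eq_measure ennreal_mult[symmetric])
  qed
qed

text \<open>
  Conditionally on the past and on the current state, the holding time is exponential.  The statement
  by products spares conditional probabilities given null events.
\<close>

lemma holding_time_exponential:
  assumes x: "x \<in> E" and s: "0 \<le> s" and B: "B \<in> sets (history n n)"
  shows "measure M (B \<inter> {\<omega> \<in> space M. Y n \<omega> = x \<and> ennreal s < H n \<omega>})
       = exp (- exit_rate E q x * s) * measure M (B \<inter> {\<omega> \<in> space M. Y n \<omega> = x})"
proof (rule history_proportional[OF _ _ _ _ B])
  fix y and r :: "nat \<Rightarrow> real" assume y: "\<forall>k\<le>n. y k \<in> E" and r: "\<forall>k<n. 0 \<le> r k"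
  show "measure M (cylinder n n y r \<inter> {\<omega> \<in> space M. Y n \<omega> = x \<and> ennreal s < H n \<omega>})
    = exp (- exit_rate E q x * s) * measure M (cylinder n n y r \<inter> {\<omega> \<in> space M. Y n \<omega> = x})"
  proof (cases "y n = x")
    case True
    have "cylinder n n y r \<inter> {\<omega> \<in> space M. Y n \<omega> = x \<and> ennreal s < H n \<omega>}
        = cylinder n (Suc n) y (r(n := s))"
      using True by (auto simp: cylinder_def less_Suc_eq)
    moreover have "cylinder n n y r \<inter> {\<omega> \<in> space M. Y n \<omega> = x} = cylinder n n y (r(n := s))"
      using True by (auto simp: cylinder_def)
    ultimately show ?thesis
      using cylinder_next_time[of n y "r(n := s)"] True y r s by simp
  next
    case False
    then have "cylinder n n y r \<inter> {\<omega> \<in> space M. Y n \<omega> = x} = {}"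
      "cylinder n n y r \<inter> {\<omega> \<in> space M. Y n \<omega> = x \<and> ennreal s < H n \<omega>} = {}"
      by (auto simp: cylinder_def)
    then show ?thesis by simp
  qed
qed auto

text \<open>
  The history includes the \<open>n\<close>-th holding time, so the jump is also independent of the time at which
  it occurs.
\<close>

lemma next_state_markov:
  assumes x: "x \<in> E" and x': "x' \<in> E" and B: "B \<in> sets (history n (Suc n))"
  shows "measure M (B \<inter> {\<omega> \<in> space M. Y n \<omega> = x \<and> Y (Suc n) \<omega> = x'})
       = jump_prob E q x x' * measure M (B \<inter> {\<omega> \<in> space M. Y n \<omega> = x})"
proof (rule history_proportional[OF _ _ _ _ B])
  fix y and r :: "nat \<Rightarrow> real" assume y: "\<forall>k\<le>n. y k \<in> E" and r: "\<forall>k<Suc n. 0 \<le> r k"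
  show "measure M (cylinder n (Suc n) y r \<inter> {\<omega> \<in> space M. Y n \<omega> = x \<and> Y (Suc n) \<omega> = x'})
    = jump_prob E q x x' * measure M (cylinder n (Suc n) y r \<inter> {\<omega> \<in> space M. Y n \<omega> = x})"
  proof (cases "y n = x")
    case True
    have "cylinder n (Suc n) y r \<inter> {\<omega> \<in> space M. Y n \<omega> = x \<and> Y (Suc n) \<omega> = x'}
        = cylinder (Suc n) (Suc n) (y(Suc n := x')) r"
      using True by (auto simp: cylinder_def le_Suc_eq)
    moreover have "cylinder n (Suc n) y r \<inter> {\<omega> \<in> space M. Y n \<omega> = x}
        = cylinder n (Suc n) (y(Suc n := x')) r"
      using True by (auto simp: cylinder_def)
    ultimately show ?thesis
      using cylinder_next_state[of n "y(Suc n := x')" r] True y r x' by auto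
  next
    case False
    then have "cylinder n (Suc n) y r \<inter> {\<omega> \<in> space M. Y n \<omega> = x} = {}"
      "cylinder n (Suc n) y r \<inter> {\<omega> \<in> space M. Y n \<omega> = x \<and> Y (Suc n) \<omega> = x'} = {}"
      by (auto simp: cylinder_def)
    then show ?thesis by simp
  qed
qed (auto intro: jump_prob_nonneg x x')

end

section \<open>Exponential clocks\<close>

text \<open>
  The tail assumption says that on \<open>A\<close> the clock \<open>H\<close> is exponential and independent of its starting
  time \<open>T\<close>; the random level \<open>u - T\<close> has to be substituted for \<open>s\<close>.  On the event that \<open>u - T\<close> lies
  between \<open>j/k\<close> and \<open>(j+1)/k\<close> the tail formula for these two levels encloses both sides up to the
  factors \<open>exp (\<plusminus> l/k)\<close>.  Sum over \<open>j\<close> and let \<open>k\<close> tend to infinity.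
\<close>

lemma (in finite_measure) exponential_survival:
  fixes T H :: "'a \<Rightarrow> ennreal" and l u :: real
  assumes T [measurable]: "T \<in> borel_measurable M" and H [measurable]: "H \<in> borel_measurable M"
    and A [measurable]: "A \<in> sets M" and l: "0 \<le> l" and u: "0 \<le> u"
    and tail: "\<And>B s. B \<in> sets borel \<Longrightarrow> 0 \<le> s \<Longrightarrow>
      measure M (A \<inter> {\<omega> \<in> space M. T \<omega> \<in> B \<and> ennreal s < H \<omega>})
      = exp (- l * s) * measure M (A \<inter> {\<omega> \<in> space M. T \<omega> \<in> B})"
  shows "emeasure M (A \<inter> {\<omega> \<in> space M. T \<omega> \<le> ennreal u \<and> ennreal u < T \<omega> + H \<omega>})
    = (\<integral>\<^sup>+\<omega>. ennreal (exp (- l * (u - enn2real (T \<omega>)))) * indicator (A \<inter> {\<omega> \<in> space M. T \<omega> \<le> ennreal u}) \<omega> \<partial>M)"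
    (is "emeasure M ?S = ?I")
proof -
  define \<sigma> where "\<sigma> \<omega> = u - enn2real (T \<omega>)" for \<omega>
  have [measurable]: "\<sigma> \<in> borel_measurable M" unfolding \<sigma>_def by measurable
  have Tu: "0 \<le> \<sigma> \<omega> \<and> T \<omega> = ennreal (u - \<sigma> \<omega>)" if "T \<omega> \<le> ennreal u" for \<omega>
  proof -
    have "T \<omega> < top" using that by (rule le_less_trans) simp
    moreover have "enn2real (T \<omega>) \<le> u" using enn2real_mono[OF that] u by simp
    ultimately show ?thesis by (simp add: \<sigma>_def)
  qed
  have surv: "ennreal u < T \<omega> + H \<omega> \<longleftrightarrow> ennreal (\<sigma> \<omega>) < H \<omega>" if "T \<omega> \<le> ennreal u" for \<omega>
  proof (cases "H \<omega>")
    case (real r)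
    have nonneg: "0 \<le> u - \<sigma> \<omega>" by (simp add: \<sigma>_def)
    have "T \<omega> + H \<omega> = ennreal (u - \<sigma> \<omega> + r)"
      using Tu[OF that] real nonneg by (simp add: ennreal_plus)
    then show ?thesis using real u Tu[OF that] nonneg
      by (simp add: ennreal_less_iff del: ennreal_plus)
  qed auto
  let ?e = "\<lambda>\<omega>. ennreal (exp (- l * \<sigma> \<omega>))"
  have bounds: "ennreal (exp (- l / real k)) * ?I \<le> emeasure M ?S \<and>
      emeasure M ?S \<le> ennreal (exp (l / real k)) * ?I" if k: "0 < k" for k :: nat
  proof -
    define B where "B j = {\<tau>. \<tau> \<le> ennreal u \<and> \<lfloor>real k * (u - enn2real \<tau>)\<rfloor> = int j}" for j :: nat
    have [measurable]: "B j \<in> sets borel" for j unfolding B_def by measurable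
    define Ej where "Ej j = A \<inter> {\<omega> \<in> space M. T \<omega> \<in> B j}" for j
    have [measurable]: "Ej j \<in> sets M" for j unfolding Ej_def by measurable
    define Sj where "Sj j = Ej j \<inter> {\<omega> \<in> space M. ennreal (\<sigma> \<omega>) < H \<omega>}" for j
    have [measurable]: "Sj j \<in> sets M" for j unfolding Sj_def by measurable
    have cover: "A \<inter> {\<omega> \<in> space M. T \<omega> \<le> ennreal u} = (\<Union>j. Ej j)"
    proof (intro equalityI subsetI)
      fix \<omega> assume w: "\<omega> \<in> A \<inter> {\<omega> \<in> space M. T \<omega> \<le> ennreal u}"
      then have "0 \<le> \<sigma> \<omega>" using Tu by simp
      then have "0 \<le> \<lfloor>real k * \<sigma> \<omega>\<rfloor>" by simp
      then have "\<lfloor>real k * \<sigma> \<omega>\<rfloor> = int (nat \<lfloor>real k * \<sigma> \<omega>\<rfloor>)" by simp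
      then have "\<omega> \<in> Ej (nat \<lfloor>real k * \<sigma> \<omega>\<rfloor>)" using w unfolding Ej_def B_def \<sigma>_def by simp
      then show "\<omega> \<in> (\<Union>j. Ej j)" by blast
    qed (auto simp: Ej_def B_def)
    have disj: "disjoint_family Ej" unfolding disjoint_family_on_def Ej_def B_def by auto
    have S_eq: "?S = (\<Union>j. Sj j)"
    proof -
      have "?S = (A \<inter> {\<omega> \<in> space M. T \<omega> \<le> ennreal u}) \<inter> {\<omega> \<in> space M. ennreal (\<sigma> \<omega>) < H \<omega>}"
        using surv by blast
      also have "\<dots> = (\<Union>j. Sj j)" unfolding cover Sj_def by auto
      finally show ?thesis .
    qed
    have disjS: "disjoint_family Sj" using disj unfolding disjoint_family_on_def Sj_def by auto
    have emS: "emeasure M ?S = (\<Sum>j. emeasure M (Sj j))"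
      unfolding S_eq using disjS by (intro suminf_emeasure[symmetric]) auto
    have emI: "?I = (\<Sum>j. \<integral>\<^sup>+\<omega>. ?e \<omega> * indicator (Ej j) \<omega> \<partial>M)"
      unfolding cover \<sigma>_def[symmetric]
      by (rule nn_integral_disjoint_family[OF _ _ disj]) measurable
    have sl: "real j / k \<le> \<sigma> \<omega>" "\<sigma> \<omega> \<le> real (Suc j) / k" if "\<omega> \<in> Ej j" for \<omega> j
    proof -
      have f: "\<lfloor>real k * \<sigma> \<omega>\<rfloor> = int j" using that by (simp add: Ej_def B_def \<sigma>_def)
      show "real j / k \<le> \<sigma> \<omega>" using f k by (simp add: floor_eq_iff field_simps)
      show "\<sigma> \<omega> \<le> real (Suc j) / k" using f k by (simp add: floor_eq_iff field_simps)
    qed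
    have tail': "emeasure M (Ej j \<inter> {\<omega> \<in> space M. ennreal s < H \<omega>}) = ennreal (exp (- l * s)) * emeasure M (Ej j)"
      if "0 \<le> s" for s j
    proof -
      have "Ej j \<inter> {\<omega> \<in> space M. ennreal s < H \<omega>} = A \<inter> {\<omega> \<in> space M. T \<omega> \<in> B j \<and> ennreal s < H \<omega>}"
        by (auto simp: Ej_def)
      then show ?thesis using tail[of "B j" s] that
        by (simp add: emeasure_eq_measure ennreal_mult[symmetric] Ej_def)
    qed
    have lo: "ennreal (exp (- l / k)) * (\<integral>\<^sup>+\<omega>. ?e \<omega> * indicator (Ej j) \<omega> \<partial>M) \<le> emeasure M (Sj j)" for j
    proof -
      have "ennreal (exp (- l / k)) * (\<integral>\<^sup>+\<omega>. ?e \<omega> * indicator (Ej j) \<omega> \<partial>M)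
          = (\<integral>\<^sup>+\<omega>. ennreal (exp (- l / k)) * (?e \<omega> * indicator (Ej j) \<omega>) \<partial>M)"
        by (rule nn_integral_cmult[symmetric]) measurable
      also have "\<dots> \<le> (\<integral>\<^sup>+\<omega>. ennreal (exp (- l * (real (Suc j) / k))) * indicator (Ej j) \<omega> \<partial>M)"
      proof (intro nn_integral_mono)
        fix \<omega>
        show "ennreal (exp (- l / k)) * (?e \<omega> * indicator (Ej j) \<omega>)
          \<le> ennreal (exp (- l * (real (Suc j) / k))) * indicator (Ej j) \<omega>"
        proof (cases "\<omega> \<in> Ej j")
          case True
          have "l * (real (Suc j) / k) \<le> l * (1 / k + \<sigma> \<omega>)"
            using sl(1)[OF True] l k by (intro mult_left_mono) (auto simp: field_simps)
          then have "- l / k + - l * \<sigma> \<omega> \<le> - l * (real (Suc j) / k)"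
            by (simp only: distrib_left mult_minus_left minus_divide_left[symmetric] times_divide_eq_right mult_1_right)
          then have "exp (- l / k) * exp (- l * \<sigma> \<omega>) \<le> exp (- l * (real (Suc j) / k))"
            by (simp add: exp_add[symmetric])
          then show ?thesis using True by (simp add: ennreal_mult[symmetric])
        qed simp
      qed
      also have "\<dots> = emeasure M (Ej j \<inter> {\<omega> \<in> space M. ennreal (real (Suc j) / k) < H \<omega>})"
        by (subst tail') (auto simp: nn_integral_cmult)
      also have "\<dots> \<le> emeasure M (Sj j)"
      proof (rule emeasure_mono)
        show "Ej j \<inter> {\<omega> \<in> space M. ennreal (real (Suc j) / k) < H \<omega>} \<subseteq> Sj j"
          using sl(2) unfolding Sj_def by (auto intro: le_less_trans[OF ennreal_leI])
      qed measurable
      finally show ?thesis .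
    qed
    have hi: "emeasure M (Sj j) \<le> ennreal (exp (l / k)) * (\<integral>\<^sup>+\<omega>. ?e \<omega> * indicator (Ej j) \<omega> \<partial>M)" for j
    proof -
      have "emeasure M (Sj j) \<le> emeasure M (Ej j \<inter> {\<omega> \<in> space M. ennreal (real j / k) < H \<omega>})"
      proof (rule emeasure_mono)
        show "Sj j \<subseteq> Ej j \<inter> {\<omega> \<in> space M. ennreal (real j / k) < H \<omega>}"
          using sl(1) unfolding Sj_def by (auto intro: le_less_trans[OF ennreal_leI])
      qed measurable
      also have "\<dots> = (\<integral>\<^sup>+\<omega>. ennreal (exp (- l * (real j / k))) * indicator (Ej j) \<omega> \<partial>M)"
        by (subst tail') (auto simp: nn_integral_cmult)
      also have "\<dots> \<le> (\<integral>\<^sup>+\<omega>. ennreal (exp (l / k)) * (?e \<omega> * indicator (Ej j) \<omega>) \<partial>M)"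
      proof (intro nn_integral_mono)
        fix \<omega>
        show "ennreal (exp (- l * (real j / k))) * indicator (Ej j) \<omega>
           \<le> ennreal (exp (l / k)) * (?e \<omega> * indicator (Ej j) \<omega>)"
        proof (cases "\<omega> \<in> Ej j")
          case True
          have "l * \<sigma> \<omega> \<le> l * (real (Suc j) / k)" using sl(2)[OF True] l by (rule mult_left_mono)
          then have "- l * (real j / k) \<le> l / k + - l * \<sigma> \<omega>" by (simp add: field_simps add_divide_distrib)
          then have "exp (- l * (real j / k)) \<le> exp (l / k) * exp (- l * \<sigma> \<omega>)"
            by (simp add: exp_add[symmetric])
          then show ?thesis using True by (simp add: ennreal_mult[symmetric])
        qed simp
      qed
      also have "\<dots> = ennreal (exp (l / k)) * (\<integral>\<^sup>+\<omega>. ?e \<omega> * indicator (Ej j) \<omega> \<partial>M)"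
        by (rule nn_integral_cmult) measurable
      finally show ?thesis .
    qed
    show ?thesis
      unfolding emS emI ennreal_suminf_cmult[symmetric]
      by (intro conjI suminf_le lo hi) auto
  qed
  have fin: "?I < top"
  proof -
    have "?I \<le> (\<integral>\<^sup>+\<omega>. 1 \<partial>M)"
    proof (intro nn_integral_mono)
      fix \<omega> show "ennreal (exp (- l * (u - enn2real (T \<omega>)))) * indicator (A \<inter> {\<omega> \<in> space M. T \<omega> \<le> ennreal u}) \<omega> \<le> 1"
        using Tu[of \<omega>] l by (auto simp: indicator_def \<sigma>_def mult_nonneg_nonneg mult_le_0_iff)
    qed
    also have "\<dots> < top" by (simp add: less_top[symmetric])
    finally show ?thesis .
  qed
  then obtain I where I: "?I = ennreal I" "0 \<le> I" by (cases ?I) auto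
  let ?P = "measure M ?S"
  have re: "exp (- l / real k) * I \<le> ?P \<and> ?P \<le> exp (l / real k) * I" if "0 < k" for k
    using bounds[OF that] I by (simp add: emeasure_eq_measure ennreal_mult[symmetric])
  have "(\<lambda>k. exp (- l / real k) * I) \<longlonglongrightarrow> exp 0 * I"
    by (intro tendsto_intros lim_const_over_n)
  then have "exp 0 * I \<le> ?P" by (rule LIMSEQ_le_const2) (use re in \<open>auto intro!: exI[of _ 1]\<close>)
  moreover have "(\<lambda>k. exp (l / real k) * I) \<longlonglongrightarrow> exp 0 * I"
    by (intro tendsto_intros lim_const_over_n)
  then have "?P \<le> exp 0 * I" by (rule LIMSEQ_le_const) (use re in \<open>auto intro!: exI[of _ 1]\<close>)
  ultimately show ?thesis using I by (simp add: emeasure_eq_measure)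
qed

text \<open>
  A clock of rate \<open>l\<close> rings before \<open>t\<close> with probability \<open>l\<close> times the expected time during which it
  runs before \<open>t\<close>: integrate the survival probability over \<open>u\<close>.
\<close>

lemma (in finite_measure) exponential_clock:
  fixes T H :: "'a \<Rightarrow> ennreal" and l t :: real
  assumes T [measurable]: "T \<in> borel_measurable M" and H [measurable]: "H \<in> borel_measurable M"
    and A [measurable]: "A \<in> sets M" and l: "0 \<le> l" and t: "0 \<le> t"
    and tail: "\<And>B s. B \<in> sets borel \<Longrightarrow> 0 \<le> s \<Longrightarrow>
      measure M (A \<inter> {\<omega> \<in> space M. T \<omega> \<in> B \<and> ennreal s < H \<omega>})
      = exp (- l * s) * measure M (A \<inter> {\<omega> \<in> space M. T \<omega> \<in> B})"
  shows "emeasure M (A \<inter> {\<omega> \<in> space M. T \<omega> + H \<omega> \<le> ennreal t})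
    = ennreal l * (\<integral>\<^sup>+\<omega>. indicator A \<omega> * (\<integral>\<^sup>+u. indicator {0..t} u *
        indicator {u. T \<omega> \<le> ennreal u \<and> ennreal u < T \<omega> + H \<omega>} u \<partial>lborel) \<partial>M)"
proof -
  let ?e = "\<lambda>u \<omega>. ennreal (exp (- l * (u - enn2real (T \<omega>))))"
  let ?D = "\<lambda>u. A \<inter> {\<omega> \<in> space M. T \<omega> \<le> ennreal u}"
  interpret L: pair_sigma_finite M "lborel :: real measure" ..
  have "(\<integral>\<^sup>+\<omega>. indicator A \<omega> * (\<integral>\<^sup>+u. indicator {0..t} u *
        indicator {u. T \<omega> \<le> ennreal u \<and> ennreal u < T \<omega> + H \<omega>} u \<partial>lborel) \<partial>M)
      = (\<integral>\<^sup>+\<omega>. \<integral>\<^sup>+u. indicator A \<omega> * (indicator {0..t} u *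
        indicator {u. T \<omega> \<le> ennreal u \<and> ennreal u < T \<omega> + H \<omega>} u) \<partial>lborel \<partial>M)"
    by (simp add: nn_integral_cmult)
  also have "\<dots> = (\<integral>\<^sup>+u. \<integral>\<^sup>+\<omega>. indicator A \<omega> * (indicator {0..t} u *
        indicator {u. T \<omega> \<le> ennreal u \<and> ennreal u < T \<omega> + H \<omega>} u) \<partial>M \<partial>lborel)"
    by (rule L.Fubini'[symmetric]) measurable
  also have "\<dots> = (\<integral>\<^sup>+u. indicator {0..t} u * (\<integral>\<^sup>+\<omega>. ?e u \<omega> * indicator (?D u) \<omega> \<partial>M) \<partial>lborel)"
  proof (rule nn_integral_cong)
    fix u :: real
    show "(\<integral>\<^sup>+\<omega>. indicator A \<omega> * (indicator {0..t} u *
        indicator {u. T \<omega> \<le> ennreal u \<and> ennreal u < T \<omega> + H \<omega>} u) \<partial>M)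
      = indicator {0..t} u * (\<integral>\<^sup>+\<omega>. ?e u \<omega> * indicator (?D u) \<omega> \<partial>M)"
    proof (cases "u \<in> {0..t}")
      case True
      have "(\<integral>\<^sup>+\<omega>. indicator A \<omega> * (indicator {0..t} u *
          indicator {u. T \<omega> \<le> ennreal u \<and> ennreal u < T \<omega> + H \<omega>} u) \<partial>M)
        = (\<integral>\<^sup>+\<omega>. indicator (A \<inter> {\<omega> \<in> space M. T \<omega> \<le> ennreal u \<and> ennreal u < T \<omega> + H \<omega>}) \<omega> \<partial>M)"
        using True by (intro nn_integral_cong) (auto simp: indicator_def)
      also have "\<dots> = (\<integral>\<^sup>+\<omega>. ?e u \<omega> * indicator (?D u) \<omega> \<partial>M)"
        using exponential_survival[OF T H A l _ tail, of u] True by simp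
      finally show ?thesis using True by simp
    qed simp
  qed
  also have "\<dots> = (\<integral>\<^sup>+u. \<integral>\<^sup>+\<omega>. indicator {0..t} u * (?e u \<omega> * indicator (?D u) \<omega>) \<partial>M \<partial>lborel)"
    by (simp add: nn_integral_cmult)
  also have "\<dots> = (\<integral>\<^sup>+\<omega>. \<integral>\<^sup>+u. indicator {0..t} u * (?e u \<omega> * indicator (?D u) \<omega>) \<partial>lborel \<partial>M)"
    by (rule L.Fubini') measurable
  finally have rhs: "ennreal l * (\<integral>\<^sup>+\<omega>. indicator A \<omega> * (\<integral>\<^sup>+u. indicator {0..t} u *
        indicator {u. T \<omega> \<le> ennreal u \<and> ennreal u < T \<omega> + H \<omega>} u \<partial>lborel) \<partial>M)
      = (\<integral>\<^sup>+\<omega>. ennreal l * (\<integral>\<^sup>+u. indicator {0..t} u * (?e u \<omega> * indicator (?D u) \<omega>) \<partial>lborel) \<partial>M)"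
    by (simp add: nn_integral_cmult)
  have inner: "ennreal l * (\<integral>\<^sup>+u. indicator {0..t} u * (?e u \<omega> * indicator (?D u) \<omega>) \<partial>lborel)
      + ?e t \<omega> * indicator (?D t) \<omega> = indicator (?D t) \<omega>" if w: "\<omega> \<in> space M" for \<omega>
  proof (cases "\<omega> \<in> ?D t")
    case True
    let ?\<tau> = "enn2real (T \<omega>)"
    have Tt: "T \<omega> \<le> ennreal t" using True by simp
    have "T \<omega> < top" using Tt by (rule le_less_trans) simp
    then have T\<tau>: "T \<omega> = ennreal ?\<tau>" by simp
    have \<tau>: "0 \<le> ?\<tau>" "?\<tau> \<le> t" using enn2real_mono[OF Tt] t by auto
    have "ennreal l * (\<integral>\<^sup>+u. indicator {0..t} u * (?e u \<omega> * indicator (?D u) \<omega>) \<partial>lborel)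
        = (\<integral>\<^sup>+u. ennreal l * (indicator {0..t} u * (?e u \<omega> * indicator (?D u) \<omega>)) \<partial>lborel)"
      by (rule nn_integral_cmult[symmetric]) measurable
    also have "\<dots> = (\<integral>\<^sup>+u. ennreal (l * exp (- l * (u - ?\<tau>))) * indicator {?\<tau>..t} u \<partial>lborel)"
    proof (rule nn_integral_cong)
      fix u :: real
      have "T \<omega> \<le> ennreal u \<longleftrightarrow> ?\<tau> \<le> u" if "0 \<le> u" using that T\<tau> ennreal_le_iff by metis
      then show "ennreal l * (indicator {0..t} u * (?e u \<omega> * indicator (?D u) \<omega>))
        = ennreal (l * exp (- l * (u - ?\<tau>))) * indicator {?\<tau>..t} u"
        using True \<tau> l by (auto simp: indicator_def ennreal_mult dest: order_trans[OF enn2real_nonneg])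
    qed
    also have "\<dots> = ennreal ((- exp (- l * (t - ?\<tau>))) - (- exp (- l * (?\<tau> - ?\<tau>))))"
      using l \<tau> by (intro nn_integral_FTC_Icc) (auto intro!: derivative_eq_intros)
    finally show ?thesis using True l \<tau>
      by (simp add: ennreal_plus[symmetric] mult_nonneg_nonneg del: ennreal_plus)
  next
    case False
    then have "indicator {0..t} u * (?e u \<omega> * indicator (?D u) \<omega>) = 0" for u
      using w by (auto simp: indicator_def intro: order_trans[OF _ ennreal_leI])
    then have "(\<integral>\<^sup>+u. indicator {0..t} u * (?e u \<omega> * indicator (?D u) \<omega>) \<partial>lborel) = 0"
      by (simp only: nn_integral_0_iff_AE nn_integral_const) simp
    then show ?thesis using False by simp
  qed
  have "(\<integral>\<^sup>+\<omega>. ennreal l * (\<integral>\<^sup>+u. indicator {0..t} u * (?e u \<omega> * indicator (?D u) \<omega>) \<partial>lborel) \<partial>M)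
      + (\<integral>\<^sup>+\<omega>. ?e t \<omega> * indicator (?D t) \<omega> \<partial>M)
      = (\<integral>\<^sup>+\<omega>. ennreal l * (\<integral>\<^sup>+u. indicator {0..t} u * (?e u \<omega> * indicator (?D u) \<omega>) \<partial>lborel)
         + ?e t \<omega> * indicator (?D t) \<omega> \<partial>M)"
    by (rule nn_integral_add[symmetric]) measurable
  also have "\<dots> = (\<integral>\<^sup>+\<omega>. indicator (?D t) \<omega> \<partial>M)"
    by (rule nn_integral_cong) (rule inner)
  also have "\<dots> = emeasure M (?D t)" by simp
  also have "emeasure M (?D t) = emeasure M ((A \<inter> {\<omega> \<in> space M. T \<omega> + H \<omega> \<le> ennreal t}) \<union>
      (A \<inter> {\<omega> \<in> space M. T \<omega> \<le> ennreal t \<and> ennreal t < T \<omega> + H \<omega>}))"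
    by (rule arg_cong[where f="emeasure M"])
      (auto simp: not_le intro: order_trans[OF le_iff_add[THEN iffD2]])
  also have "\<dots> = emeasure M (A \<inter> {\<omega> \<in> space M. T \<omega> + H \<omega> \<le> ennreal t})
      + emeasure M (A \<inter> {\<omega> \<in> space M. T \<omega> \<le> ennreal t \<and> ennreal t < T \<omega> + H \<omega>})"
    by (intro plus_emeasure[symmetric]) auto
  also have "emeasure M (A \<inter> {\<omega> \<in> space M. T \<omega> \<le> ennreal t \<and> ennreal t < T \<omega> + H \<omega>})
      = (\<integral>\<^sup>+\<omega>. ?e t \<omega> * indicator (?D t) \<omega> \<partial>M)"
    by (rule exponential_survival[OF T H A l t tail])
  finally have "(\<integral>\<^sup>+\<omega>. ?e t \<omega> * indicator (?D t) \<omega> \<partial>M) +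
      (\<integral>\<^sup>+\<omega>. ennreal l * (\<integral>\<^sup>+u. indicator {0..t} u * (?e u \<omega> * indicator (?D u) \<omega>) \<partial>lborel) \<partial>M)
      = (\<integral>\<^sup>+\<omega>. ?e t \<omega> * indicator (?D t) \<omega> \<partial>M) + emeasure M (A \<inter> {\<omega> \<in> space M. T \<omega> + H \<omega> \<le> ennreal t})"
    by (simp add: add.commute)
  moreover have "(\<integral>\<^sup>+\<omega>. ?e t \<omega> * indicator (?D t) \<omega> \<partial>M) \<noteq> top"
    using exponential_survival[OF T H A l t tail] emeasure_finite by (metis infinity_ennreal_def)
  ultimately show ?thesis
    unfolding rhs by (simp add: ennreal_add_left_cancel)
qed

section \<open>The Levy system\<close>

context jump_chain
begin

definition jump_time :: "nat \<Rightarrow> 'a \<Rightarrow> ennreal" where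
  "jump_time n \<omega> = (\<Sum>k<n. H k \<omega>)"

definition at_step :: "nat \<Rightarrow> real \<Rightarrow> 'a \<Rightarrow> bool" where
  "at_step n u \<omega> \<longleftrightarrow> jump_time n \<omega> \<le> ennreal u \<and> ennreal u < jump_time (Suc n) \<omega>"

definition dwell :: "real \<Rightarrow> nat \<Rightarrow> 'a \<Rightarrow> ennreal" where
  "dwell t n \<omega> = (\<integral>\<^sup>+u. indicator {0..t} u * indicator {u. at_step n u \<omega>} u \<partial>lborel)"

lemma jump_time_measurable [measurable]: "jump_time n \<in> borel_measurable M"
  unfolding jump_time_def by measurable

lemma at_step_measurable [measurable]:
  "Measurable.pred (lborel \<Otimes>\<^sub>M M) (\<lambda>p. at_step n (fst p) (snd p))"
  "Measurable.pred (M \<Otimes>\<^sub>M lborel) (\<lambda>p. at_step n (snd p) (fst p))"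
  "Measurable.pred M (\<lambda>\<omega>. at_step n u \<omega>)"
  unfolding at_step_def by measurable

lemma dwell_measurable [measurable]: "dwell t n \<in> borel_measurable M"
  unfolding dwell_def by measurable

lemma jump_time_history: "n \<le> m \<Longrightarrow> jump_time n \<in> borel_measurable (history k m)"
  unfolding jump_time_def
  by (rule borel_measurable_sum) (auto intro: H_history_measurable)

lemma jump_time_event:
  assumes "k \<le> m" "B \<in> sets borel"
  shows "{\<omega> \<in> space M. jump_time k \<omega> \<in> B} \<in> sets (history n m)"
proof -
  have "{\<omega> \<in> space M. jump_time k \<omega> \<in> B} = jump_time k -` B \<inter> space (history n m)" by auto
  then show ?thesis using measurable_sets[OF jump_time_history[OF assms(1)] assms(2)] by simp
qed

lemma state_pair_measurable:
  "(\<lambda>\<omega>. g (Y n \<omega>) (Y m \<omega>)) \<in> borel_measurable M" for g :: "'s \<Rightarrow> 's \<Rightarrow> 'b::topological_space"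
proof -
  have "(\<lambda>\<omega>. (Y n \<omega>, Y m \<omega>)) \<in> measurable M (count_space E \<Otimes>\<^sub>M count_space E)"
    by measurable
  then have "(\<lambda>\<omega>. (Y n \<omega>, Y m \<omega>)) \<in> measurable M (count_space (E \<times> E))"
    using pair_measure_countable[OF countable_E countable_E] by simp
  then show ?thesis
    using measurable_compose[of "\<lambda>\<omega>. (Y n \<omega>, Y m \<omega>)" M "count_space (E \<times> E)" "\<lambda>p. g (fst p) (snd p)" borel] by simp
qed

lemma state_measurable: "(\<lambda>\<omega>. f (Y n \<omega>)) \<in> borel_measurable M" for f :: "'s \<Rightarrow> 'b::topological_space"
  by (rule state_pair_measurable)

text \<open>
  The target is independent of the jump time by \<open>next_state_markov\<close>, the jump time is that of a clock
  of rate \<open>exit_rate E q x\<close>, and \<open>q x x'\<close> is the product of the exit rate and the jump probability.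
\<close>

lemma jump_rate:
  assumes x: "x \<in> E" and x': "x' \<in> E" and ne: "x \<noteq> x'" and t: "0 \<le> t"
  shows "emeasure M {\<omega> \<in> space M. Y n \<omega> = x \<and> Y (Suc n) \<omega> = x' \<and> jump_time (Suc n) \<omega> \<le> ennreal t}
    = ennreal (q x x') * (\<integral>\<^sup>+\<omega>. indicator {\<omega> \<in> space M. Y n \<omega> = x} \<omega> * dwell t n \<omega> \<partial>M)"
proof -
  let ?l = "exit_rate E q x" and ?p = "jump_prob E q x x'"
  let ?A = "{\<omega> \<in> space M. Y n \<omega> = x}"
  let ?B = "{\<omega> \<in> space M. jump_time (Suc n) \<omega> \<le> ennreal t}"
  have B: "?B \<in> sets (history n (Suc n))"
    using jump_time_event[of "Suc n" "Suc n" "{..ennreal t}" n] by simp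
  have "emeasure M {\<omega> \<in> space M. Y n \<omega> = x \<and> Y (Suc n) \<omega> = x' \<and> jump_time (Suc n) \<omega> \<le> ennreal t}
      = emeasure M (?B \<inter> {\<omega> \<in> space M. Y n \<omega> = x \<and> Y (Suc n) \<omega> = x'})"
    by (rule arg_cong[where f="emeasure M"]) auto
  also have "\<dots> = ennreal ?p * emeasure M (?B \<inter> ?A)"
    using next_state_markov[OF x x' B] jump_prob_nonneg[OF x x']
    by (simp add: emeasure_eq_measure ennreal_mult[symmetric])
  also have "?B \<inter> ?A = ?A \<inter> {\<omega> \<in> space M. jump_time n \<omega> + H n \<omega> \<le> ennreal t}"
    by (auto simp: jump_time_def)
  also have "emeasure M \<dots> = ennreal ?l * (\<integral>\<^sup>+\<omega>. indicator ?A \<omega> * (\<integral>\<^sup>+u. indicator {0..t} u *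
        indicator {u. jump_time n \<omega> \<le> ennreal u \<and> ennreal u < jump_time n \<omega> + H n \<omega>} u \<partial>lborel) \<partial>M)"
  proof (rule exponential_clock[OF _ _ _ exit_rate_nonneg[OF x] t])
    fix B :: "ennreal set" and s :: real assume B: "B \<in> sets borel" and s: "0 \<le> s"
    have "{\<omega> \<in> space M. jump_time n \<omega> \<in> B} \<in> sets (history n n)"
      using B by (rule jump_time_event[OF order_refl])
    from holding_time_exponential[OF x s this]
    have "prob ({\<omega> \<in> space M. jump_time n \<omega> \<in> B} \<inter> {\<omega> \<in> space M. Y n \<omega> = x \<and> ennreal s < H n \<omega>})
      = exp (- ?l * s) * prob ({\<omega> \<in> space M. jump_time n \<omega> \<in> B} \<inter> ?A)" .
    moreover have "{\<omega> \<in> space M. jump_time n \<omega> \<in> B} \<inter> {\<omega> \<in> space M. Y n \<omega> = x \<and> ennreal s < H n \<omega>}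
       = ?A \<inter> {\<omega> \<in> space M. jump_time n \<omega> \<in> B \<and> ennreal s < H n \<omega>}" by auto
    moreover have "{\<omega> \<in> space M. jump_time n \<omega> \<in> B} \<inter> ?A = ?A \<inter> {\<omega> \<in> space M. jump_time n \<omega> \<in> B}" by auto
    ultimately
    show "prob (?A \<inter> {\<omega> \<in> space M. jump_time n \<omega> \<in> B \<and> ennreal s < H n \<omega>})
      = exp (- ?l * s) * prob (?A \<inter> {\<omega> \<in> space M. jump_time n \<omega> \<in> B})"
      by simp
  qed measurable
  finally show ?thesis
    using rate_eq_exit_rate_jump_prob[OF x x' ne] exit_rate_nonneg[OF x] jump_prob_nonneg[OF x x']
    by (simp add: dwell_def at_step_def jump_time_def ennreal_mult mult.assoc[symmetric] mult.commute)
qed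

text \<open>
  The compensator of the jumps.  As \<open>g\<close> vanishes on the diagonal, the meaningless diagonal rates
  \<open>q x x\<close> do not contribute.
\<close>

lemma levy_system_step:
  fixes g :: "'s \<Rightarrow> 's \<Rightarrow> ennreal"
  assumes t: "0 \<le> t" and g: "\<And>x. g x x = 0"
  shows "(\<integral>\<^sup>+\<omega>. indicator {\<omega>. jump_time (Suc n) \<omega> \<le> ennreal t} \<omega> * g (Y n \<omega>) (Y (Suc n) \<omega>) \<partial>M)
    = (\<integral>\<^sup>+\<omega>. dwell t n \<omega> * (\<integral>\<^sup>+y. ennreal (q (Y n \<omega>) y) * g (Y n \<omega>) y \<partial>count_space E) \<partial>M)"
proof -
  note [simp] = countable_E
  have single: "(\<integral>\<^sup>+x. indicator {x. Y m \<omega> = x} x * f x \<partial>count_space E) = f (Y m \<omega>)"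
    if "\<omega> \<in> space M" for f :: "'s \<Rightarrow> ennreal" and m \<omega>
  proof -
    have "(\<integral>\<^sup>+x. indicator {x. Y m \<omega> = x} x * f x \<partial>count_space E)
        = (\<Sum>x\<in>{Y m \<omega>}. indicator {x. Y m \<omega> = x} x * f x)"
      using Y_in_E[OF that] by (intro nn_integral_count_space') auto
    then show ?thesis by simp
  qed
  let ?J = "\<lambda>x y. {\<omega> \<in> space M. Y n \<omega> = x \<and> Y (Suc n) \<omega> = y \<and> jump_time (Suc n) \<omega> \<le> ennreal t}"
  let ?i = "indicator {\<omega> \<in> space M. jump_time (Suc n) \<omega> \<le> ennreal t} :: 'a \<Rightarrow> ennreal"
  have [measurable]: "(\<lambda>\<omega>. g x (Y (Suc n) \<omega>)) \<in> borel_measurable M" for x by (rule state_measurable)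
  have "(\<integral>\<^sup>+\<omega>. indicator {\<omega>. jump_time (Suc n) \<omega> \<le> ennreal t} \<omega> * g (Y n \<omega>) (Y (Suc n) \<omega>) \<partial>M)
      = (\<integral>\<^sup>+\<omega>. \<integral>\<^sup>+x. indicator {\<omega> \<in> space M. Y n \<omega> = x} \<omega> * (?i \<omega> * g x (Y (Suc n) \<omega>)) \<partial>count_space E \<partial>M)"
  proof (rule nn_integral_cong)
    fix \<omega> assume w: "\<omega> \<in> space M"
    have "(\<integral>\<^sup>+x. indicator {\<omega> \<in> space M. Y n \<omega> = x} \<omega> * (?i \<omega> * g x (Y (Suc n) \<omega>)) \<partial>count_space E)
       = (\<integral>\<^sup>+x. indicator {x. Y n \<omega> = x} x * (?i \<omega> * g x (Y (Suc n) \<omega>)) \<partial>count_space E)"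
      using w by (intro nn_integral_cong) (auto simp: indicator_def)
    also have "\<dots> = ?i \<omega> * g (Y n \<omega>) (Y (Suc n) \<omega>)" by (rule single[OF w])
    also have "\<dots> = indicator {\<omega>. jump_time (Suc n) \<omega> \<le> ennreal t} \<omega> * g (Y n \<omega>) (Y (Suc n) \<omega>)"
      using w by (simp add: indicator_def)
    finally show "indicator {\<omega>. jump_time (Suc n) \<omega> \<le> ennreal t} \<omega> * g (Y n \<omega>) (Y (Suc n) \<omega>)
      = (\<integral>\<^sup>+x. indicator {\<omega> \<in> space M. Y n \<omega> = x} \<omega> * (?i \<omega> * g x (Y (Suc n) \<omega>)) \<partial>count_space E)"
      by (rule sym)
  qed
  also have "\<dots> = (\<integral>\<^sup>+x. \<integral>\<^sup>+\<omega>. indicator {\<omega> \<in> space M. Y n \<omega> = x} \<omega> * (?i \<omega> * g x (Y (Suc n) \<omega>)) \<partial>M \<partial>count_space E)"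
    by (intro nn_integral_count_space_nn_integral) auto
  also have "\<dots> = (\<integral>\<^sup>+x. \<integral>\<^sup>+\<omega>. \<integral>\<^sup>+y. g x y * indicator (?J x y) \<omega> \<partial>count_space E \<partial>M \<partial>count_space E)"
  proof (intro nn_integral_cong)
    fix x \<omega> assume w: "\<omega> \<in> space M"
    have "(\<integral>\<^sup>+y. g x y * indicator (?J x y) \<omega> \<partial>count_space E)
       = (\<integral>\<^sup>+y. indicator {y. Y (Suc n) \<omega> = y} y * (indicator {\<omega> \<in> space M. Y n \<omega> = x} \<omega> * (?i \<omega> * g x y)) \<partial>count_space E)"
      using w by (intro nn_integral_cong) (auto simp: indicator_def)
    also have "\<dots> = indicator {\<omega> \<in> space M. Y n \<omega> = x} \<omega> * (?i \<omega> * g x (Y (Suc n) \<omega>))"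
      by (rule single[OF w])
    finally show "indicator {\<omega> \<in> space M. Y n \<omega> = x} \<omega> * (?i \<omega> * g x (Y (Suc n) \<omega>))
       = (\<integral>\<^sup>+y. g x y * indicator (?J x y) \<omega> \<partial>count_space E)"
      by (rule sym)
  qed
  also have "\<dots> = (\<integral>\<^sup>+x. \<integral>\<^sup>+y. \<integral>\<^sup>+\<omega>. g x y * indicator (?J x y) \<omega> \<partial>M \<partial>count_space E \<partial>count_space E)"
    by (intro nn_integral_cong nn_integral_count_space_nn_integral) auto
  also have "\<dots> = (\<integral>\<^sup>+x. \<integral>\<^sup>+y. \<integral>\<^sup>+\<omega>. indicator {\<omega> \<in> space M. Y n \<omega> = x} \<omega> *
        (dwell t n \<omega> * (ennreal (q x y) * g x y)) \<partial>M \<partial>count_space E \<partial>count_space E)"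
  proof (rule nn_integral_cong, rule nn_integral_cong)
    fix x y assume "x \<in> space (count_space E)" "y \<in> space (count_space E)"
    then have xy: "x \<in> E" "y \<in> E" by auto
    have "(\<integral>\<^sup>+\<omega>. g x y * indicator (?J x y) \<omega> \<partial>M) = g x y * emeasure M (?J x y)"
      by (rule nn_integral_cmult_indicator) measurable
    also have "\<dots> = g x y * (ennreal (q x y) * (\<integral>\<^sup>+\<omega>. indicator {\<omega> \<in> space M. Y n \<omega> = x} \<omega> * dwell t n \<omega> \<partial>M))"
      using jump_rate[OF xy _ t, of n] g by (cases "x = y") auto
    also have "\<dots> = (\<integral>\<^sup>+\<omega>. (ennreal (q x y) * g x y) * (indicator {\<omega> \<in> space M. Y n \<omega> = x} \<omega> * dwell t n \<omega>) \<partial>M)"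
      by (subst nn_integral_cmult) (auto simp: ac_simps)
    finally show "(\<integral>\<^sup>+\<omega>. g x y * indicator (?J x y) \<omega> \<partial>M) = (\<integral>\<^sup>+\<omega>. indicator {\<omega> \<in> space M. Y n \<omega> = x} \<omega> *
        (dwell t n \<omega> * (ennreal (q x y) * g x y)) \<partial>M)" by (simp add: ac_simps)
  qed
  also have "\<dots> = (\<integral>\<^sup>+x. \<integral>\<^sup>+\<omega>. \<integral>\<^sup>+y. indicator {\<omega> \<in> space M. Y n \<omega> = x} \<omega> *
        (dwell t n \<omega> * (ennreal (q x y) * g x y)) \<partial>count_space E \<partial>M \<partial>count_space E)"
    by (intro nn_integral_cong nn_integral_count_space_nn_integral[symmetric]) auto
  also have "\<dots> = (\<integral>\<^sup>+x. \<integral>\<^sup>+\<omega>. indicator {\<omega> \<in> space M. Y n \<omega> = x} \<omega> *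
        (dwell t n \<omega> * (\<integral>\<^sup>+y. ennreal (q x y) * g x y \<partial>count_space E)) \<partial>M \<partial>count_space E)"
    by (simp add: nn_integral_cmult)
  also have "\<dots> = (\<integral>\<^sup>+\<omega>. \<integral>\<^sup>+x. indicator {\<omega> \<in> space M. Y n \<omega> = x} \<omega> *
        (dwell t n \<omega> * (\<integral>\<^sup>+y. ennreal (q x y) * g x y \<partial>count_space E)) \<partial>count_space E \<partial>M)"
    by (intro nn_integral_count_space_nn_integral[symmetric]) auto
  also have "\<dots> = (\<integral>\<^sup>+\<omega>. dwell t n \<omega> * (\<integral>\<^sup>+y. ennreal (q (Y n \<omega>) y) * g (Y n \<omega>) y \<partial>count_space E) \<partial>M)"
  proof (rule nn_integral_cong)
    fix \<omega> assume w: "\<omega> \<in> space M"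
    have "(\<integral>\<^sup>+x. indicator {\<omega> \<in> space M. Y n \<omega> = x} \<omega> *
        (dwell t n \<omega> * (\<integral>\<^sup>+y. ennreal (q x y) * g x y \<partial>count_space E)) \<partial>count_space E)
       = (\<integral>\<^sup>+x. indicator {x. Y n \<omega> = x} x *
        (dwell t n \<omega> * (\<integral>\<^sup>+y. ennreal (q x y) * g x y \<partial>count_space E)) \<partial>count_space E)"
      using w by (intro nn_integral_cong) (auto simp: indicator_def)
    also have "\<dots> = dwell t n \<omega> * (\<integral>\<^sup>+y. ennreal (q (Y n \<omega>) y) * g (Y n \<omega>) y \<partial>count_space E)"
      by (rule single[OF w])
    finally show "(\<integral>\<^sup>+x. indicator {\<omega> \<in> space M. Y n \<omega> = x} \<omega> *
        (dwell t n \<omega> * (\<integral>\<^sup>+y. ennreal (q x y) * g x y \<partial>count_space E)) \<partial>count_space E)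
        = dwell t n \<omega> * (\<integral>\<^sup>+y. ennreal (q (Y n \<omega>) y) * g (Y n \<omega>) y \<partial>count_space E)" .
  qed
  finally show ?thesis .
qed

end

locale jump_process = jump_chain M E q Y H
  for M :: "'a measure" and E :: "'s set" and q :: "'s \<Rightarrow> 's \<Rightarrow> real"
    and Y :: "nat \<Rightarrow> 'a \<Rightarrow> 's" and H :: "nat \<Rightarrow> 'a \<Rightarrow> ennreal"
    and X :: "real \<Rightarrow> 'a \<Rightarrow> 's" +
  assumes X_measurable: "\<And>t. 0 \<le> t \<Longrightarrow> X t \<in> measurable M (count_space E)"
    and X_path: "AE \<omega> in M. \<forall>t\<ge>0. \<exists>n. at_step n t \<omega> \<and> X t \<omega> = Y n \<omega>"
begin

lemma jump_time_mono: "n \<le> m \<Longrightarrow> jump_time n \<omega> \<le> jump_time m \<omega>"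
  unfolding jump_time_def by (rule sum_mono2) auto

lemma at_step_unique: "at_step n u \<omega> \<Longrightarrow> at_step m u \<omega> \<Longrightarrow> n = m"
proof (induction n m rule: linorder_wlog)
  case (le n m)
  show ?case
  proof (rule ccontr)
    assume "n \<noteq> m"
    then have "jump_time (Suc n) \<omega> \<le> jump_time m \<omega>" using le by (intro jump_time_mono) simp
    then show False using le unfolding at_step_def by (meson leD order_trans)
  qed
qed simp

lemma state_sum:
  fixes f :: "'s \<Rightarrow> ennreal"
  assumes "at_step n u \<omega>"
  shows "(\<Sum>m. indicator {u. at_step m u \<omega>} u * f (Y m \<omega>)) = f (Y n \<omega>)"
proof -
  have "(\<Sum>m. indicator {u. at_step m u \<omega>} u * f (Y m \<omega>)) = (\<Sum>m\<in>{n}. indicator {u. at_step m u \<omega>} u * f (Y m \<omega>))"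
    by (rule suminf_finite) (use at_step_unique[OF assms] in \<open>auto simp: indicator_def\<close>)
  then show ?thesis using assms by simp
qed

lemma X_state_sum:
  fixes f :: "'s \<Rightarrow> ennreal"
  assumes "0 \<le> u"
  shows "(\<integral>\<^sup>+\<omega>. f (X u \<omega>) \<partial>M) = (\<integral>\<^sup>+\<omega>. (\<Sum>m. indicator {u. at_step m u \<omega>} u * f (Y m \<omega>)) \<partial>M)"
  using X_path by (intro nn_integral_cong_AE) (use assms state_sum in fastforce)

definition occupation :: "real \<Rightarrow> ('s \<Rightarrow> ennreal) \<Rightarrow> ennreal" where
  "occupation t f = (\<integral>\<^sup>+u. indicator {0..t} u * (\<integral>\<^sup>+\<omega>. f (X u \<omega>) \<partial>M) \<partial>lborel)"

lemma state_sum_measurable [measurable]: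
  "(\<lambda>p. \<Sum>m. indicator {u. at_step m u (snd p)} (fst p) * f (Y m (snd p))) \<in> borel_measurable (lborel \<Otimes>\<^sub>M M)"
  for f :: "'s \<Rightarrow> ennreal"
proof -
  have [measurable]: "(\<lambda>p. f (Y m (snd p))) \<in> borel_measurable (lborel \<Otimes>\<^sub>M M)" for m
    by (rule measurable_compose[OF measurable_snd state_measurable])
  have "(\<lambda>p. \<Sum>m. (if at_step m (fst p) (snd p) then 1 else 0) * f (Y m (snd p))) \<in> borel_measurable (lborel \<Otimes>\<^sub>M M)"
    by measurable
  then show ?thesis by (simp add: indicator_def of_bool_def)
qed

lemma time_marginal_measurable:
  "(\<lambda>u. indicator {0..t} u * (\<integral>\<^sup>+\<omega>. f (X u \<omega>) \<partial>M)) \<in> borel_measurable lborel"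
proof -
  have "(\<lambda>u. \<integral>\<^sup>+\<omega>. (\<Sum>m. indicator {u. at_step m u \<omega>} u * f (Y m \<omega>)) \<partial>M) \<in> borel_measurable lborel"
    using state_sum_measurable[of f] by (intro borel_measurable_nn_integral) (simp add: case_prod_beta')
  then have "(\<lambda>u. indicator {0..t} u * (\<integral>\<^sup>+\<omega>. (\<Sum>m. indicator {u. at_step m u \<omega>} u * f (Y m \<omega>)) \<partial>M))
      \<in> borel_measurable lborel" by measurable
  moreover have "indicator {0..t} u * (\<integral>\<^sup>+\<omega>. (\<Sum>m. indicator {u. at_step m u \<omega>} u * f (Y m \<omega>)) \<partial>M)
      = indicator {0..t} u * (\<integral>\<^sup>+\<omega>. f (X u \<omega>) \<partial>M)" for u
    by (cases "u \<in> {0..t}") (simp_all add: X_state_sum)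
  ultimately show ?thesis by simp
qed

text \<open>
  Joint measurability of \<open>X\<close> in time and \<open>\<omega>\<close>, which Fubini's theorem needs, is not part of the
  description of the process.  At each time \<open>f (X u)\<close> almost surely equals the sum over all steps,
  and that sum is jointly measurable.
\<close>

lemma occupation_eq_dwell: "occupation t f = (\<Sum>n. \<integral>\<^sup>+\<omega>. dwell t n \<omega> * f (Y n \<omega>) \<partial>M)"
proof -
  interpret L: pair_sigma_finite "lborel :: real measure" M ..
  note state_measurable[of f, measurable]
  have [measurable]: "(\<lambda>p. f (Y m (snd p))) \<in> borel_measurable (lborel \<Otimes>\<^sub>M M)" for m
    by (rule measurable_compose[OF measurable_snd state_measurable])
  have ind: "(\<lambda>p. indicator {u. at_step m u (snd p)} (fst p) :: ennreal) \<in> borel_measurable (lborel \<Otimes>\<^sub>M M)" for m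
  proof -
    have "(\<lambda>p. if at_step m (fst p) (snd p) then 1 else 0 :: ennreal) \<in> borel_measurable (lborel \<Otimes>\<^sub>M M)"
      by measurable
    then show ?thesis by (simp add: indicator_def of_bool_def)
  qed
  have meas: "(\<lambda>(u, \<omega>). indicator {0..t} u * (indicator {u. at_step m u \<omega>} u * f (Y m \<omega>)))
      \<in> borel_measurable (lborel \<Otimes>\<^sub>M M)" for m
    unfolding case_prod_beta' using ind[of m] by measurable
  have "occupation t f = (\<integral>\<^sup>+u. indicator {0..t} u * (\<integral>\<^sup>+\<omega>. (\<Sum>m. indicator {u. at_step m u \<omega>} u * f (Y m \<omega>)) \<partial>M) \<partial>lborel)"
    unfolding occupation_def
  proof (rule nn_integral_cong)
    fix u show "indicator {0..t} u * (\<integral>\<^sup>+\<omega>. f (X u \<omega>) \<partial>M)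
      = indicator {0..t} u * (\<integral>\<^sup>+\<omega>. (\<Sum>m. indicator {u. at_step m u \<omega>} u * f (Y m \<omega>)) \<partial>M)"
      by (cases "u \<in> {0..t}") (simp_all add: X_state_sum)
  qed
  also have "\<dots> = (\<integral>\<^sup>+u. \<integral>\<^sup>+\<omega>. (\<Sum>m. indicator {0..t} u * (indicator {u. at_step m u \<omega>} u * f (Y m \<omega>))) \<partial>M \<partial>lborel)"
    by (rule nn_integral_cong, subst nn_integral_cmult[symmetric])
      (use measurable_Pair2[OF state_sum_measurable[of f]] in \<open>auto simp: ennreal_suminf_cmult\<close>)
  also have "\<dots> = (\<integral>\<^sup>+\<omega>. \<integral>\<^sup>+u. (\<Sum>m. indicator {0..t} u * (indicator {u. at_step m u \<omega>} u * f (Y m \<omega>))) \<partial>lborel \<partial>M)"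
    by (rule L.Fubini'[symmetric]) (use meas in \<open>simp add: case_prod_beta'\<close>)
  also have "\<dots> = (\<integral>\<^sup>+\<omega>. (\<Sum>m. \<integral>\<^sup>+u. indicator {0..t} u * (indicator {u. at_step m u \<omega>} u * f (Y m \<omega>)) \<partial>lborel) \<partial>M)"
    by (intro nn_integral_cong nn_integral_suminf) (unfold at_step_def, measurable)
  also have "\<dots> = (\<integral>\<^sup>+\<omega>. (\<Sum>m. dwell t m \<omega> * f (Y m \<omega>)) \<partial>M)"
    unfolding dwell_def at_step_def by (simp add: nn_integral_multc mult.assoc[symmetric])
  also have "\<dots> = (\<Sum>n. \<integral>\<^sup>+\<omega>. dwell t n \<omega> * f (Y n \<omega>) \<partial>M)"
    by (rule nn_integral_suminf) measurable
  finally show ?thesis .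
qed

end

section \<open>Lyapunov functions and Dynkin's formula\<close>

lemma enn2real_integral:
  assumes [measurable]: "F \<in> borel_measurable M" and fin: "(\<integral>\<^sup>+x. F x \<partial>M) < \<infinity>"
  shows "integrable M (\<lambda>x. enn2real (F x))" "(\<integral>x. enn2real (F x) \<partial>M) = enn2real (\<integral>\<^sup>+x. F x \<partial>M)"
proof -
  have "AE x in M. F x \<noteq> \<infinity>" by (rule nn_integral_PInf_AE) (use fin in auto)
  then have nn: "(\<integral>\<^sup>+x. ennreal (enn2real (F x)) \<partial>M) = (\<integral>\<^sup>+x. F x \<partial>M)"
    by (intro nn_integral_cong_AE) (auto simp: less_top)
  show "integrable M (\<lambda>x. enn2real (F x))"
    by (rule integrableI_nonneg) (use nn fin in auto)
  show "(\<integral>x. enn2real (F x) \<partial>M) = enn2real (\<integral>\<^sup>+x. F x \<partial>M)"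
    by (subst integral_eq_nn_integral) (auto simp: nn)
qed

context jump_process
begin

text \<open>
  The generator is \<open>rise f - fall f\<close>.  The two parts are kept apart because they are nonnegative, so
  that identities hold in \<^typ>\<open>ennreal\<close> before anything is known to be integrable.
\<close>

definition rise :: "('s \<Rightarrow> real) \<Rightarrow> 's \<Rightarrow> ennreal" where
  "rise f x = (\<integral>\<^sup>+y. ennreal (q x y) * ennreal (max 0 (f y - f x)) \<partial>count_space E)"

abbreviation fall :: "('s \<Rightarrow> real) \<Rightarrow> 's \<Rightarrow> ennreal" where
  "fall f \<equiv> rise (\<lambda>x. - f x)"

definition jumped :: "real \<Rightarrow> nat \<Rightarrow> 'a \<Rightarrow> ennreal" where
  "jumped t n \<omega> = indicator {\<omega>. jump_time n \<omega> \<le> ennreal t} \<omega>"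

lemma jumped_measurable [measurable]: "jumped t n \<in> borel_measurable M"
proof -
  have "(\<lambda>\<omega>. if jump_time n \<omega> \<le> ennreal t then 1 else 0 :: ennreal) \<in> borel_measurable M" by measurable
  moreover have "jumped t n = (\<lambda>\<omega>. if jump_time n \<omega> \<le> ennreal t then 1 else 0)"
    by (auto simp: jumped_def indicator_def)
  ultimately show ?thesis by simp
qed

lemma jumped_Suc_le: "jumped t (Suc n) \<omega> \<le> jumped t n \<omega>"
  using jump_time_mono[of n "Suc n" \<omega>] by (auto simp: jumped_def indicator_def intro: order_trans)

lemma rise_step:
  "0 \<le> t \<Longrightarrow> (\<integral>\<^sup>+\<omega>. jumped t (Suc n) \<omega> * ennreal (max 0 (f (Y (Suc n) \<omega>) - f (Y n \<omega>))) \<partial>M)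
    = (\<integral>\<^sup>+\<omega>. dwell t n \<omega> * rise f (Y n \<omega>) \<partial>M)"
  unfolding jumped_def rise_def
  by (rule levy_system_step[where g="\<lambda>x y. ennreal (max 0 (f y - f x))"]) auto

lemma expected_total_rise:
  "0 \<le> t \<Longrightarrow> (\<Sum>n. \<integral>\<^sup>+\<omega>. jumped t (Suc n) \<omega> * ennreal (max 0 (f (Y (Suc n) \<omega>) - f (Y n \<omega>))) \<partial>M)
    = occupation t (rise f)"
  by (simp only: rise_step occupation_eq_dwell)

lemma X_start: "AE \<omega> in M. X 0 \<omega> = Y 0 \<omega>"
  using X_path AE_space
proof eventually_elim
  case (elim \<omega>)
  then obtain n where n: "at_step n 0 \<omega>" "X 0 \<omega> = Y n \<omega>" by (metis order_refl)
  have "at_step 0 0 \<omega>" using H_pos[of \<omega> 0] elim by (simp add: at_step_def jump_time_def)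
  from at_step_unique[OF n(1) this] n show ?case by simp
qed

text \<open>
  The Foster-Lyapunov estimate.  Let \<open>a n\<close> be the expectation of \<open>V\<close> at the \<open>n\<close>-th jump on the event
  that this jump occurs before \<open>t\<close>.  The Levy system expresses the change of \<open>a\<close> by the rise \<open>U n\<close> and
  the fall \<open>D n\<close> of \<open>V\<close> during the \<open>n\<close>-th step, and the drift condition turns this into
  \<open>a (Suc n) + F n \<le> a n + C * d n\<close>.  The expected dwell times \<open>d n\<close> add up to at most \<open>t\<close>.
\<close>

lemma lyapunov_occupation:
  fixes V :: "'s \<Rightarrow> real" and \<phi> :: "'s \<Rightarrow> ennreal" and C t :: real
  assumes t: "0 \<le> t" and C: "0 \<le> C" and V: "\<And>x. x \<in> E \<Longrightarrow> 0 \<le> V x"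
    and drift: "\<And>x. x \<in> E \<Longrightarrow> rise V x + \<phi> x \<le> fall V x + ennreal C"
    and init: "(\<integral>\<^sup>+\<omega>. ennreal (V (X 0 \<omega>)) \<partial>M) < \<infinity>"
  shows "occupation t \<phi> < \<infinity>"
proof -
  note [measurable] = state_measurable[of "\<lambda>y. ennreal (V y)"] state_measurable[of "rise V"] state_measurable[of "fall V"]
    state_measurable[of \<phi>]
  have [measurable]: "(\<lambda>\<omega>. ennreal (max 0 (V (Y (Suc n) \<omega>) - V (Y n \<omega>)))) \<in> borel_measurable M"
    "(\<lambda>\<omega>. ennreal (max 0 (- V (Y (Suc n) \<omega>) - (- V (Y n \<omega>))))) \<in> borel_measurable M" for n
    using state_pair_measurable[of "\<lambda>y x. ennreal (max 0 (V y - V x))" "Suc n" n]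
      state_pair_measurable[of "\<lambda>y x. ennreal (max 0 (- V y - (- V x)))" "Suc n" n] by simp_all
  define a where "a n = (\<integral>\<^sup>+\<omega>. jumped t n \<omega> * ennreal (V (Y n \<omega>)) \<partial>M)" for n
  define U where "U n = (\<integral>\<^sup>+\<omega>. dwell t n \<omega> * rise V (Y n \<omega>) \<partial>M)" for n
  define D where "D n = (\<integral>\<^sup>+\<omega>. dwell t n \<omega> * fall V (Y n \<omega>) \<partial>M)" for n
  define F where "F n = (\<integral>\<^sup>+\<omega>. dwell t n \<omega> * \<phi> (Y n \<omega>) \<partial>M)" for n
  define d where "d n = (\<integral>\<^sup>+\<omega>. dwell t n \<omega> \<partial>M)" for n
  have a0: "a 0 < \<infinity>"
  proof -
    have "a 0 \<le> (\<integral>\<^sup>+\<omega>. ennreal (V (Y 0 \<omega>)) \<partial>M)"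
      unfolding a_def by (intro nn_integral_mono) (auto simp: jumped_def indicator_def)
    also have "\<dots> = (\<integral>\<^sup>+\<omega>. ennreal (V (X 0 \<omega>)) \<partial>M)"
      by (rule nn_integral_cong_AE) (use X_start in auto)
    finally show ?thesis using init by simp
  qed
  have UF: "U n + F n \<le> D n + ennreal C * d n" for n
  proof -
    have "U n + F n = (\<integral>\<^sup>+\<omega>. dwell t n \<omega> * (rise V (Y n \<omega>) + \<phi> (Y n \<omega>)) \<partial>M)"
      unfolding U_def F_def by (subst nn_integral_add[symmetric]) (auto simp: distrib_left)
    also have "\<dots> \<le> (\<integral>\<^sup>+\<omega>. dwell t n \<omega> * (fall V (Y n \<omega>) + ennreal C) \<partial>M)"
      by (intro nn_integral_mono mult_left_mono drift Y_in_E) auto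
    also have "\<dots> = D n + ennreal C * d n"
      unfolding D_def d_def by (subst nn_integral_cmult[symmetric], simp, subst nn_integral_add[symmetric])
       (auto simp: distrib_left mult.commute)
    finally show ?thesis .
  qed
  have bal: "a (Suc n) + D n \<le> a n + U n \<and> D n \<le> a n" for n
  proof
    let ?j = "jumped t (Suc n)"
    let ?up = "\<lambda>\<omega>. ennreal (max 0 (V (Y (Suc n) \<omega>) - V (Y n \<omega>)))"
    let ?dn = "\<lambda>\<omega>. ennreal (max 0 (- V (Y (Suc n) \<omega>) - (- V (Y n \<omega>))))"
    have Un: "U n = (\<integral>\<^sup>+\<omega>. ?j \<omega> * ?up \<omega> \<partial>M)" unfolding U_def by (rule rise_step[OF t, symmetric])
    have Dn: "D n = (\<integral>\<^sup>+\<omega>. ?j \<omega> * ?dn \<omega> \<partial>M)" unfolding D_def by (rule rise_step[OF t, symmetric])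
    have "a (Suc n) + D n = (\<integral>\<^sup>+\<omega>. ?j \<omega> * ennreal (V (Y (Suc n) \<omega>)) + ?j \<omega> * ?dn \<omega> \<partial>M)"
      unfolding a_def Dn by (rule nn_integral_add[symmetric]) measurable
    also have "\<dots> = (\<integral>\<^sup>+\<omega>. ?j \<omega> * ennreal (V (Y n \<omega>)) + ?j \<omega> * ?up \<omega> \<partial>M)"
    proof (rule nn_integral_cong)
      fix \<omega> assume w: "\<omega> \<in> space M"
      have "ennreal (V (Y (Suc n) \<omega>)) + ?dn \<omega> = ennreal (V (Y n \<omega>)) + ?up \<omega>"
        using V[OF Y_in_E[OF w, of n]] V[OF Y_in_E[OF w, of "Suc n"]]
        by (simp add: ennreal_plus[symmetric] max_def del: ennreal_plus)
      then show "?j \<omega> * ennreal (V (Y (Suc n) \<omega>)) + ?j \<omega> * ?dn \<omega> = ?j \<omega> * ennreal (V (Y n \<omega>)) + ?j \<omega> * ?up \<omega>"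
        by (metis distrib_left)
    qed
    also have "\<dots> = (\<integral>\<^sup>+\<omega>. ?j \<omega> * ennreal (V (Y n \<omega>)) \<partial>M) + U n"
      unfolding Un by (rule nn_integral_add) measurable
    also have "(\<integral>\<^sup>+\<omega>. ?j \<omega> * ennreal (V (Y n \<omega>)) \<partial>M) \<le> a n"
      unfolding a_def by (intro nn_integral_mono mult_right_mono jumped_Suc_le) auto
    finally show "a (Suc n) + D n \<le> a n + U n" by (simp add: add_right_mono)
    show "D n \<le> a n" unfolding Dn a_def
    proof (intro nn_integral_mono mult_mono jumped_Suc_le)
      fix \<omega> assume w: "\<omega> \<in> space M"
      show "?dn \<omega> \<le> ennreal (V (Y n \<omega>))"
        using V[OF Y_in_E[OF w, of n]] V[OF Y_in_E[OF w, of "Suc n"]] by (intro ennreal_leI) auto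
    qed auto
  qed
  have d_sum: "(\<Sum>n<m. d n) \<le> ennreal t" for m
  proof -
    have "(\<Sum>n<m. d n) \<le> (\<Sum>n. d n)" by (rule sum_le_suminf) auto
    also have "\<dots> = occupation t (\<lambda>_. 1)" by (simp add: occupation_eq_dwell d_def)
    also have "\<dots> = ennreal t" using t by (simp add: occupation_def emeasure_space_1)
    finally show ?thesis .
  qed
  have step: "a (Suc n) + F n \<le> a n + ennreal C * d n" if "a n < \<infinity>" for n
  proof -
    have "D n + (a (Suc n) + F n) = (a (Suc n) + D n) + F n" by (simp add: ac_simps)
    also have "\<dots> \<le> (a n + U n) + F n" using bal by (intro add_right_mono) blast
    also have "\<dots> \<le> a n + (D n + ennreal C * d n)" using UF by (simp add: add.assoc add_left_mono)
    also have "\<dots> = D n + (a n + ennreal C * d n)" by (simp add: ac_simps)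
    finally show ?thesis
      using that bal[of n] ennreal_add_left_cancel_le
      by (metis infinity_ennreal_def leD)
  qed
  have acc: "a m + (\<Sum>n<m. F n) \<le> a 0 + ennreal C * (\<Sum>n<m. d n) \<and> a m < \<infinity>" for m
  proof (induction m)
    case 0
    then show ?case using a0 by simp
  next
    case (Suc m)
    have "a (Suc m) + (\<Sum>n<Suc m. F n) = (a (Suc m) + F m) + (\<Sum>n<m. F n)" by (simp add: ac_simps)
    also have "\<dots> \<le> (a m + ennreal C * d m) + (\<Sum>n<m. F n)"
      using Suc step by (intro add_right_mono) blast
    also have "\<dots> = (a m + (\<Sum>n<m. F n)) + ennreal C * d m" by (simp add: ac_simps)
    also have "\<dots> \<le> (a 0 + ennreal C * (\<Sum>n<m. d n)) + ennreal C * d m"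
      using Suc by (intro add_right_mono) blast
    also have "\<dots> = a 0 + ennreal C * (\<Sum>n<Suc m. d n)" by (simp add: distrib_left ac_simps)
    finally have *: "a (Suc m) + (\<Sum>n<Suc m. F n) \<le> a 0 + ennreal C * (\<Sum>n<Suc m. d n)" .
    have "a (Suc m) \<le> a (Suc m) + (\<Sum>n<Suc m. F n)" by simp
    also have "\<dots> \<le> a 0 + ennreal C * ennreal t"
      using * d_sum[of "Suc m"] by (meson add_left_mono mult_left_mono order_trans zero_le)
    also have "\<dots> < \<infinity>" using a0 by (simp add: ennreal_mult_less_top)
    finally show ?case using * by blast
  qed
  have "occupation t \<phi> = (\<Sum>n. F n)" by (simp add: occupation_eq_dwell F_def)
  also have "\<dots> \<le> a 0 + ennreal C * ennreal t"
  proof (rule suminf_le_const)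
    fix m
    have "(\<Sum>n<m. F n) \<le> a m + (\<Sum>n<m. F n)" by simp
    also have "\<dots> \<le> a 0 + ennreal C * ennreal t"
      using acc[of m] d_sum[of m] by (meson add_left_mono mult_left_mono order_trans zero_le)
    finally show "(\<Sum>n<m. F n) \<le> a 0 + ennreal C * ennreal t" .
  qed simp
  also have "\<dots> < \<infinity>" using a0 by (simp add: ennreal_mult_less_top)
  finally show ?thesis .
qed

lemma total_rise_path:
  assumes n: "at_step n t \<omega>"
  shows "(\<Sum>k. jumped t (Suc k) \<omega> * ennreal (max 0 (f (Y (Suc k) \<omega>) - f (Y k \<omega>))))
    = ennreal (\<Sum>k<n. max 0 (f (Y (Suc k) \<omega>) - f (Y k \<omega>)))"
proof -
  have j: "jumped t (Suc k) \<omega> = (if k < n then 1 else 0)" for k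
  proof (cases "k < n")
    case True
    then have "jump_time (Suc k) \<omega> \<le> jump_time n \<omega>" by (intro jump_time_mono) simp
    also have "\<dots> \<le> ennreal t" using n by (simp add: at_step_def)
    finally show ?thesis using True by (simp add: jumped_def)
  next
    case False
    have "ennreal t < jump_time (Suc n) \<omega>" using n by (simp add: at_step_def)
    also have "\<dots> \<le> jump_time (Suc k) \<omega>" using False by (intro jump_time_mono) simp
    finally show ?thesis using False by (simp add: jumped_def not_le)
  qed
  have "(\<Sum>k. jumped t (Suc k) \<omega> * ennreal (max 0 (f (Y (Suc k) \<omega>) - f (Y k \<omega>))))
      = (\<Sum>k\<in>{..<n}. jumped t (Suc k) \<omega> * ennreal (max 0 (f (Y (Suc k) \<omega>) - f (Y k \<omega>))))"
    by (rule suminf_finite) (auto simp: j)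
  also have "\<dots> = (\<Sum>k\<in>{..<n}. ennreal (max 0 (f (Y (Suc k) \<omega>) - f (Y k \<omega>))))"
    by (intro sum.cong) (auto simp: j)
  also have "\<dots> = ennreal (\<Sum>k<n. max 0 (f (Y (Suc k) \<omega>) - f (Y k \<omega>)))"
    by (rule sum_ennreal) auto
  finally show ?thesis .
qed

lemma total_rise_integrable:
  assumes t: "0 \<le> t" and fin: "occupation t (rise f) < \<infinity>"
  defines "R \<equiv> \<lambda>\<omega>. (\<Sum>k. jumped t (Suc k) \<omega> * ennreal (max 0 (f (Y (Suc k) \<omega>) - f (Y k \<omega>))))"
  shows "integrable M (\<lambda>\<omega>. enn2real (R \<omega>))"
    "(\<integral>\<omega>. enn2real (R \<omega>) \<partial>M) = enn2real (occupation t (rise f))"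
proof -
  have [measurable]: "(\<lambda>\<omega>. ennreal (max 0 (f (Y (Suc n) \<omega>) - f (Y n \<omega>)))) \<in> borel_measurable M" for n
    using state_pair_measurable[of "\<lambda>y x. ennreal (max 0 (f y - f x))" "Suc n" n] by simp
  have [measurable]: "R \<in> borel_measurable M" unfolding R_def by measurable
  have nn: "(\<integral>\<^sup>+\<omega>. R \<omega> \<partial>M) = occupation t (rise f)"
    unfolding R_def expected_total_rise[OF t, symmetric] by (rule nn_integral_suminf) measurable
  show "integrable M (\<lambda>\<omega>. enn2real (R \<omega>))"
    "(\<integral>\<omega>. enn2real (R \<omega>) \<partial>M) = enn2real (occupation t (rise f))"
    using enn2real_integral[of R M] nn fin by simp_all
qed

text \<open>
  The increment of \<open>f\<close> along a path is a finite sum over the jumps before \<open>t\<close>, that is, the total rise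
  minus the total fall; the two have the expectations \<open>occupation t (rise f)\<close> and
  \<open>occupation t (fall f)\<close>.
\<close>

lemma dynkin:
  assumes t: "0 \<le> t" and f0: "integrable M (\<lambda>\<omega>. f (X 0 \<omega>))" and ft: "integrable M (\<lambda>\<omega>. f (X t \<omega>))"
    and up: "occupation t (rise f) < \<infinity>" and dn: "occupation t (fall f) < \<infinity>"
  shows "(\<integral>\<omega>. f (X t \<omega>) \<partial>M) - (\<integral>\<omega>. f (X 0 \<omega>) \<partial>M)
    = enn2real (occupation t (rise f)) - enn2real (occupation t (fall f))"
proof -
  let ?R = "\<lambda>f \<omega>. enn2real (\<Sum>k. jumped t (Suc k) \<omega> * ennreal (max 0 (f (Y (Suc k) \<omega>) - f (Y k \<omega>))))"
  have path: "AE \<omega> in M. f (X t \<omega>) - f (X 0 \<omega>) = ?R f \<omega> - ?R (\<lambda>x. - f x) \<omega>"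
    using X_path X_start
  proof eventually_elim
    case (elim \<omega>)
    then obtain n where n: "at_step n t \<omega>" "X t \<omega> = Y n \<omega>" using t by blast
    have R: "?R g \<omega> = (\<Sum>k<n. max 0 (g (Y (Suc k) \<omega>) - g (Y k \<omega>)))" for g
      unfolding total_rise_path[OF n(1)] by (intro enn2real_ennreal sum_nonneg) simp
    have "?R f \<omega> - ?R (\<lambda>x. - f x) \<omega> = (\<Sum>k<n. max 0 (f (Y (Suc k) \<omega>) - f (Y k \<omega>)))
       - (\<Sum>k<n. max 0 (- f (Y (Suc k) \<omega>) - - f (Y k \<omega>)))"
      using R[of f] R[of "\<lambda>x. - f x"] by (simp only:)
    also have "\<dots> = (\<Sum>k<n. f (Y (Suc k) \<omega>) - f (Y k \<omega>))"
      unfolding sum_subtractf[symmetric] by (intro sum.cong) auto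
    also have "\<dots> = f (Y n \<omega>) - f (Y 0 \<omega>)" by (rule sum_lessThan_telescope)
    finally show ?case using n elim by simp
  qed
  have "(\<integral>\<omega>. f (X t \<omega>) \<partial>M) - (\<integral>\<omega>. f (X 0 \<omega>) \<partial>M) = (\<integral>\<omega>. f (X t \<omega>) - f (X 0 \<omega>) \<partial>M)"
    using f0 ft by simp
  also have "\<dots> = (\<integral>\<omega>. ?R f \<omega> - ?R (\<lambda>x. - f x) \<omega> \<partial>M)"
  proof (rule integral_cong_AE)
    show "(\<lambda>\<omega>. f (X t \<omega>) - f (X 0 \<omega>)) \<in> borel_measurable M" using f0 ft by auto
    show "(\<lambda>\<omega>. ?R f \<omega> - ?R (\<lambda>x. - f x) \<omega>) \<in> borel_measurable M"
      using total_rise_integrable(1)[OF t up] total_rise_integrable(1)[OF t dn] by (intro borel_measurable_diff) auto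
  qed (rule path)
  also have "\<dots> = (\<integral>\<omega>. ?R f \<omega> \<partial>M) - (\<integral>\<omega>. ?R (\<lambda>x. - f x) \<omega> \<partial>M)"
    using total_rise_integrable(1)[OF t up] total_rise_integrable(1)[OF t dn] by (rule Bochner_Integration.integral_diff)
  also have "\<dots> = enn2real (occupation t (rise f)) - enn2real (occupation t (fall f))"
    unfolding total_rise_integrable(2)[OF t up] total_rise_integrable(2)[OF t dn] ..
  finally show ?thesis .
qed

lemma X_in_E: "0 \<le> u \<Longrightarrow> \<omega> \<in> space M \<Longrightarrow> X u \<omega> \<in> E"
  using measurable_space[OF X_measurable] by simp

lemma X_borel_measurable: "0 \<le> u \<Longrightarrow> (\<lambda>\<omega>. f (X u \<omega>)) \<in> borel_measurable M"
  for f :: "'s \<Rightarrow> 'c::topological_space"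
  by (rule measurable_compose[OF X_measurable]) simp_all

lemma occupation_mono:
  assumes "\<And>x. x \<in> E \<Longrightarrow> f x \<le> g x"
  shows "occupation t f \<le> occupation t g"
  unfolding occupation_def
proof (rule nn_integral_mono)
  fix u :: real
  show "indicator {0..t} u * (\<integral>\<^sup>+\<omega>. f (X u \<omega>) \<partial>M) \<le> indicator {0..t} u * (\<integral>\<^sup>+\<omega>. g (X u \<omega>) \<partial>M)"
    by (cases "u \<in> {0..t}") (auto intro!: nn_integral_mono assms X_in_E)
qed

lemma occupation_cmult: "occupation t (\<lambda>x. c * f x) = c * occupation t f"
proof -
  have "occupation t (\<lambda>x. c * f x) = (\<integral>\<^sup>+u. c * (indicator {0..t} u * (\<integral>\<^sup>+\<omega>. f (X u \<omega>) \<partial>M)) \<partial>lborel)"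
    unfolding occupation_def
  proof (rule nn_integral_cong)
    fix u :: real
    show "indicator {0..t} u * (\<integral>\<^sup>+\<omega>. c * f (X u \<omega>) \<partial>M) = c * (indicator {0..t} u * (\<integral>\<^sup>+\<omega>. f (X u \<omega>) \<partial>M))"
      by (cases "u \<in> {0..t}") (simp_all add: nn_integral_cmult X_borel_measurable)
  qed
  also have "\<dots> = c * occupation t f"
    unfolding occupation_def by (rule nn_integral_cmult) (rule time_marginal_measurable)
  finally show ?thesis .
qed

lemma occupation_has_integral:
  fixes r :: "'s \<Rightarrow> real"
  assumes t: "0 \<le> t" and r: "\<And>x. 0 \<le> r x"
    and int: "\<And>u. 0 < u \<Longrightarrow> u \<le> t \<Longrightarrow> integrable M (\<lambda>\<omega>. r (X u \<omega>))"
    and fin: "occupation t (\<lambda>x. ennreal (r x)) < \<infinity>"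
  shows "((\<lambda>u. \<integral>\<omega>. r (X u \<omega>) \<partial>M) has_integral enn2real (occupation t (\<lambda>x. ennreal (r x)))) {0..t}"
proof -
  let ?F = "\<lambda>u. indicator {0..t} u * (\<integral>\<^sup>+\<omega>. ennreal (r (X u \<omega>)) \<partial>M)"
  have "(\<integral>\<^sup>+u. ?F u \<partial>lborel) < \<infinity>" using fin by (simp add: occupation_def)
  note F = enn2real_integral[OF time_marginal_measurable this]
  have "((\<lambda>u. enn2real (?F u)) has_integral enn2real (occupation t (\<lambda>x. ennreal (r x)))) UNIV"
    using has_integral_integral_lborel[OF F(1)] F(2) by (simp add: occupation_def)
  then have "((\<lambda>u. if u \<in> {0..t} then enn2real (?F u) else 0)
      has_integral enn2real (occupation t (\<lambda>x. ennreal (r x)))) UNIV"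
    by (rule has_integral_eq[rotated]) (simp add: indicator_def)
  then have "((\<lambda>u. enn2real (?F u)) has_integral enn2real (occupation t (\<lambda>x. ennreal (r x)))) {0..t}"
    by (simp only: has_integral_restrict_UNIV)
  then show ?thesis
  proof (rule has_integral_spike_finite[of "{0}", rotated 2])
    fix u assume "u \<in> {0..t} - {0}"
    then have u: "0 < u" "u \<le> t" by auto
    then show "(\<integral>\<omega>. r (X u \<omega>) \<partial>M) = enn2real (?F u)"
      using nn_integral_eq_integral[OF int[OF u]] r by simp
  qed simp
qed

lemma dynkin_has_integral:
  fixes r d :: "'s \<Rightarrow> real"
  assumes t: "0 \<le> t" and f0: "integrable M (\<lambda>\<omega>. f (X 0 \<omega>))" and ft: "integrable M (\<lambda>\<omega>. f (X t \<omega>))"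
    and r: "\<And>x. 0 \<le> r x" "\<And>x. x \<in> E \<Longrightarrow> rise f x = ennreal (r x)"
    and d: "\<And>x. 0 \<le> d x" "\<And>x. x \<in> E \<Longrightarrow> fall f x = ennreal (d x)"
    and int_r: "\<And>u. 0 < u \<Longrightarrow> u \<le> t \<Longrightarrow> integrable M (\<lambda>\<omega>. r (X u \<omega>))"
    and int_d: "\<And>u. 0 < u \<Longrightarrow> u \<le> t \<Longrightarrow> integrable M (\<lambda>\<omega>. d (X u \<omega>))"
    and fin: "occupation t (\<lambda>x. ennreal (r x)) < \<infinity>" "occupation t (\<lambda>x. ennreal (d x)) < \<infinity>"
  shows "((\<lambda>u. (\<integral>\<omega>. r (X u \<omega>) - d (X u \<omega>) \<partial>M)) has_integral
    ((\<integral>\<omega>. f (X t \<omega>) \<partial>M) - (\<integral>\<omega>. f (X 0 \<omega>) \<partial>M))) {0..t}"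
proof -
  have up: "occupation t (rise f) = occupation t (\<lambda>x. ennreal (r x))" by (intro antisym occupation_mono) (simp_all add: r)
  have dn: "occupation t (fall f) = occupation t (\<lambda>x. ennreal (d x))" by (intro antisym occupation_mono) (simp_all add: d)
  have "((\<lambda>u. (\<integral>\<omega>. r (X u \<omega>) \<partial>M) - (\<integral>\<omega>. d (X u \<omega>) \<partial>M)) has_integral
    (enn2real (occupation t (\<lambda>x. ennreal (r x))) - enn2real (occupation t (\<lambda>x. ennreal (d x))))) {0..t}"
    by (intro has_integral_diff occupation_has_integral t r d int_r int_d fin)
  also have "enn2real (occupation t (\<lambda>x. ennreal (r x))) - enn2real (occupation t (\<lambda>x. ennreal (d x)))
     = (\<integral>\<omega>. f (X t \<omega>) \<partial>M) - (\<integral>\<omega>. f (X 0 \<omega>) \<partial>M)"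
    using dynkin[OF t f0 ft] fin unfolding up dn by simp
  finally show ?thesis
    by (rule has_integral_spike_finite[of "{0}", rotated 2]) (use int_r int_d in auto)
qed

end

text \<open>
  A vanishing holding time, which has probability zero, is replaced by \<open>\<infinity>\<close> to make all of them positive.
\<close>

lemma markov_jump_process_imp_jump_process:
  fixes M :: "'a measure" and E :: "'s set" and X :: "real \<Rightarrow> 'a \<Rightarrow> 's"
  assumes X: "markov_jump_process M E q X" and E: "countable E"
    and q: "\<And>x y. x \<in> E \<Longrightarrow> y \<in> E \<Longrightarrow> 0 \<le> q x y" "\<And>x. x \<in> E \<Longrightarrow> finite {y \<in> E - {x}. q x y \<noteq> 0}"
  shows "\<exists>Y H. jump_process M E q Y H X"
proof -
  from X obtain Y :: "nat \<Rightarrow> 'a \<Rightarrow> 's" and H :: "nat \<Rightarrow> 'a \<Rightarrow> ennreal" where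
    M: "prob_space M" and Xm: "\<And>t. t \<ge> 0 \<Longrightarrow> X t \<in> measurable M (count_space E)"
    and Y: "\<And>n. Y n \<in> measurable M (count_space E)" and H: "\<And>n. H n \<in> borel_measurable M"
    and law: "\<And>(n::nat) (y :: nat \<Rightarrow> 's) (s :: nat \<Rightarrow> real).
           (\<forall>k\<le>n. y k \<in> E) \<Longrightarrow> (\<forall>k<n. 0 \<le> s k) \<Longrightarrow>
           measure M {\<omega> \<in> space M. (\<forall>k\<le>n. Y k \<omega> = y k) \<and> (\<forall>k<n. ennreal (s k) < H k \<omega>)} =
           measure M {\<omega> \<in> space M. Y 0 \<omega> = y 0} *
           (\<Prod>k<n. jump_prob E q (y k) (y (Suc k)) * exp (- exit_rate E q (y k) * s k))"
    and path: "AE \<omega> in M. \<forall>t\<ge>0. \<exists>n. (\<Sum>k<n. H k \<omega>) \<le> ennreal t \<and>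
                                 ennreal t < (\<Sum>k<Suc n. H k \<omega>) \<and> X t \<omega> = Y n \<omega>"
    unfolding markov_jump_process_def by blast
  interpret M: prob_space M by fact
  interpret L: jump_chain_law M E q Y H
    by unfold_locales (use E q Y H law in auto)
  define H' where "H' n \<omega> = (if H n \<omega> = 0 then \<infinity> else H n \<omega>)" for n \<omega>
  have H' [measurable]: "H' n \<in> borel_measurable M" for n unfolding H'_def using H[of n] by measurable
  have eq: "AE \<omega> in M. \<forall>n. H' n \<omega> = H n \<omega>"
    using L.AE_holding_times_pos by eventually_elim (metis H'_def less_irrefl)
  note [measurable] = H Y L.Y_eq_pred
  interpret C: jump_chain M E q Y H'
  proof unfold_locales
    fix n and y :: "nat \<Rightarrow> 's" and s :: "nat \<Rightarrow> real"
    assume ys: "\<forall>k\<le>n. y k \<in> E" "\<forall>k<n. 0 \<le> s k"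
    have "measure M {\<omega> \<in> space M. (\<forall>k\<le>n. Y k \<omega> = y k) \<and> (\<forall>k<n. ennreal (s k) < H' k \<omega>)}
        = measure M {\<omega> \<in> space M. (\<forall>k\<le>n. Y k \<omega> = y k) \<and> (\<forall>k<n. ennreal (s k) < H k \<omega>)}"
    proof (rule M.finite_measure_eq_AE)
      show "AE \<omega> in M. (\<omega> \<in> {\<omega> \<in> space M. (\<forall>k\<le>n. Y k \<omega> = y k) \<and> (\<forall>k<n. ennreal (s k) < H' k \<omega>)})
        = (\<omega> \<in> {\<omega> \<in> space M. (\<forall>k\<le>n. Y k \<omega> = y k) \<and> (\<forall>k<n. ennreal (s k) < H k \<omega>)})"
        using eq by eventually_elim simp
    qed measurable
    then show "measure M {\<omega> \<in> space M. (\<forall>k\<le>n. Y k \<omega> = y k) \<and> (\<forall>k<n. ennreal (s k) < H' k \<omega>)} =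
           measure M {\<omega> \<in> space M. Y 0 \<omega> = y 0} *
           (\<Prod>k<n. jump_prob E q (y k) (y (Suc k)) * exp (- exit_rate E q (y k) * s k))"
      using law[OF ys] by simp
  qed (use E q Y in \<open>auto simp: H'_def zero_less_iff_neq_zero\<close>)
  have "jump_process M E q Y H' X"
  proof unfold_locales
    show "AE \<omega> in M. \<forall>t\<ge>0. \<exists>n. C.at_step n t \<omega> \<and> X t \<omega> = Y n \<omega>"
      using path eq
    proof eventually_elim
      case (elim \<omega>)
      then show ?case by (auto simp: C.at_step_def C.jump_time_def)
    qed
  qed (use Xm in auto)
  then show ?thesis by blast
qed

section \<open>Periodic sequences\<close>

definition periodic :: "nat \<Rightarrow> (int \<Rightarrow> 'b) \<Rightarrow> bool" where
  "periodic N c \<longleftrightarrow> (\<forall>i. c (i + int N) = c i)"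

lemma height_profiles_periodic: "h \<in> height_profiles N \<longleftrightarrow> periodic N h"
  by (simp add: height_profiles_def periodic_def)

lemma periodic_shift: "periodic N c \<Longrightarrow> periodic N (\<lambda>i. c (i + a))"
  unfolding periodic_def by (metis add.assoc add.commute)

lemma periodic_multiple:
  assumes "periodic N c" shows "c (i + int N * m) = c i"
proof (induction m rule: int_induct[of _ 0])
  case (step1 m)
  have "c (i + int N * m + int N) = c (i + int N * m)" using assms by (simp add: periodic_def)
  then show ?case using step1 by (simp add: algebra_simps)
next
  case (step2 m)
  have "c (i + int N * (m - 1) + int N) = c (i + int N * (m - 1))" using assms by (simp add: periodic_def)
  then show ?case using step2 by (simp add: algebra_simps)
qed simp

lemma periodic_cong:
  assumes "periodic N c" "i mod int N = j mod int N" shows "c i = c j"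
proof -
  have "i = i mod int N + int N * (i div int N)" "j = j mod int N + int N * (j div int N)" by simp_all
  then have "c i = c (i mod int N)" "c j = c (j mod int N)"
    using periodic_multiple[OF assms(1)] by metis+
  then show ?thesis using assms(2) by simp
qed

lemma periodic_delta:
  fixes c :: "int \<Rightarrow> 'b :: semiring_1"
  assumes c: "periodic N c" and N: "1 \<le> N"
  shows "(\<Sum>k\<in>{1..int N}. c k * of_bool (k mod int N = a mod int N)) = c a"
proof -
  let ?k = "(a - 1) mod int N + 1"
  have "0 \<le> (a - 1) mod int N" "(a - 1) mod int N < int N" using N by simp_all
  then have k: "?k \<in> {1..int N}" by auto
  have kmod: "?k mod int N = a mod int N" by (simp add: mod_add_left_eq)
  have uniq: "k = ?k" if "k \<in> {1..int N}" "k mod int N = a mod int N" for k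
  proof -
    have "(k - 1) mod int N = (a - 1) mod int N" using mod_diff_cong[OF that(2) refl] .
    moreover have "(k - 1) mod int N = k - 1" using that(1) by (intro mod_pos_pos_trivial) auto
    ultimately show ?thesis by linarith
  qed
  have "(\<Sum>k\<in>{1..int N}. c k * of_bool (k mod int N = a mod int N)) = (\<Sum>k\<in>{1..int N}. if k = ?k then c k else 0)"
  proof (rule sum.cong[OF refl])
    fix k assume "k \<in> {1..int N}"
    then have "k mod int N = a mod int N \<longleftrightarrow> k = ?k" using uniq kmod by blast
    then show "c k * of_bool (k mod int N = a mod int N) = (if k = ?k then c k else 0)" by simp
  qed
  also have "\<dots> = c ?k" using k by (simp add: sum.delta)
  also have "\<dots> = c a" by (rule periodic_cong[OF c kmod])
  finally show ?thesis .
qed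

lemma sum_periodic_shift1:
  fixes c :: "int \<Rightarrow> 'b :: ab_group_add"
  assumes c: "periodic N c"
  shows "(\<Sum>k\<in>{1..int N}. c (k + 1)) = (\<Sum>k\<in>{1..int N}. c k)"
proof (cases "N = 0")
  case False
  have "(\<Sum>k\<in>{1..int N}. c (k + 1)) = (\<Sum>k\<in>{2..int N + 1}. c k)"
    by (rule sum.reindex_bij_witness[of _ "\<lambda>k. k - 1" "\<lambda>k. k + 1"]) auto
  also have "{2..int N + 1} = insert (int N + 1) ({1..int N} - {1})" using False by auto
  also have "(\<Sum>k\<in>\<dots>. c k) = c (int N + 1) + (\<Sum>k\<in>{1..int N} - {1}. c k)"
    by (rule sum.insert) auto
  also have "c (int N + 1) = c 1" using c by (simp add: periodic_def add.commute)
  also have "c 1 + (\<Sum>k\<in>{1..int N} - {1}. c k) = (\<Sum>k\<in>{1..int N}. c k)"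
    using False by (intro sum.remove[symmetric]) auto
  finally show ?thesis .
qed simp

lemma sum_periodic_shift:
  fixes c :: "int \<Rightarrow> 'b :: ab_group_add"
  assumes c: "periodic N c"
  shows "(\<Sum>k\<in>{1..int N}. c (k + a)) = (\<Sum>k\<in>{1..int N}. c k)"
proof (induction a rule: int_induct[of _ 0])
  case (step1 a)
  have "(\<Sum>k\<in>{1..int N}. c ((k + 1) + a)) = (\<Sum>k\<in>{1..int N}. c (k + a))"
    by (rule sum_periodic_shift1[OF periodic_shift[OF c]])
  then show ?case using step1 by (simp add: algebra_simps)
next
  case (step2 a)
  have "(\<Sum>k\<in>{1..int N}. c ((k + 1) + (a - 1))) = (\<Sum>k\<in>{1..int N}. c (k + (a - 1)))"
    by (rule sum_periodic_shift1[OF periodic_shift[OF c]])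
  then show ?case using step2 by (simp add: algebra_simps)
qed simp

lemma abs_diff_le_sum_increments:
  fixes u :: "int \<Rightarrow> real"
  assumes "j \<le> k"
  shows "\<bar>u k - u j\<bar> \<le> (\<Sum>i\<in>{j..<k}. \<bar>u (i + 1) - u i\<bar>)"
  using assms
proof (induction k rule: int_ge_induct)
  case (step k)
  have "{j..<k + 1} = insert k {j..<k}" using step by auto
  then show ?case using step by simp
qed simp

text \<open>
  Average the differences \<open>u k - u j\<close> over \<open>j\<close>.
\<close>

lemma zero_mean_le_variation:
  fixes u :: "int \<Rightarrow> real"
  assumes mean: "(\<Sum>j\<in>{1..int N}. u j) = 0" and N: "1 \<le> N" and k: "k \<in> {1..int N}"
  shows "\<bar>u k\<bar> \<le> (\<Sum>j\<in>{1..int N}. \<bar>u (j + 1) - u j\<bar>)" (is "_ \<le> ?T")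
proof -
  have two: "\<bar>u k - u j\<bar> \<le> ?T" if "j \<in> {1..int N}" "k \<in> {1..int N}" "j \<le> k" for j k
    using that by (intro order_trans[OF abs_diff_le_sum_increments] sum_mono2) auto
  then have any: "\<bar>u k - u j\<bar> \<le> ?T" if "j \<in> {1..int N}" for j
    using two[OF that k] two[OF k that] by (cases "j \<le> k") (simp_all add: abs_minus_commute)
  have "real N * \<bar>u k\<bar> = \<bar>\<Sum>j\<in>{1..int N}. u k - u j\<bar>"
    using mean by (simp add: sum_subtractf abs_mult)
  also have "\<dots> \<le> (\<Sum>j\<in>{1..int N}. \<bar>u k - u j\<bar>)" by (rule sum_abs)
  also have "\<dots> \<le> real (card {1..int N}) * ?T" by (rule sum_bounded_above) (rule any)
  finally show ?thesis using N by (simp add: mult_le_cancel_left)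
qed

lemma periodic_add: "periodic N c \<Longrightarrow> c (i + int N + a) = c (i + a)"
  using periodic_shift[of N c a] by (simp add: periodic_def)

section \<open>The generator of the height process\<close>

lemma third_diff_periodic:
  assumes "h \<in> height_profiles N" shows "periodic N (third_diff h)"
  unfolding periodic_def
proof
  fix i
  note p = periodic_add[OF assms[unfolded height_profiles_periodic]]
  show "third_diff h (i + int N) = third_diff h i"
    unfolding third_diff_heights using p[of i 2] p[of i 1] p[of i 0] p[of i "-1"] by simp
qed

lemma slope_periodic:
  assumes "h \<in> height_profiles N" shows "periodic N (slope h)"
  unfolding periodic_def
proof
  fix i
  note p = periodic_add[OF assms[unfolded height_profiles_periodic]]
  show "slope h (i + int N) = slope h i"
    unfolding slope_def using p[of i 1] p[of i 0] by simp
qed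

lemma move_unit_profile: "h \<in> height_profiles N \<Longrightarrow> move_unit N a b h \<in> height_profiles N"
  by (simp add: height_profiles_def move_unit_def)

lemma countable_height_profiles:
  assumes N: "1 \<le> N" shows "countable (height_profiles N)"
proof -
  have "inj_on (\<lambda>h. map h [0..int N - 1]) (height_profiles N)"
  proof (rule inj_onI)
    fix h h' assume h: "h \<in> height_profiles N" "h' \<in> height_profiles N"
      and eq: "map h [0..int N - 1] = map h' [0..int N - 1]"
    show "h = h'"
    proof
      fix i
      have "i mod int N \<in> set [0..int N - 1]" using N by simp
      then have "h (i mod int N) = h' (i mod int N)" using eq by (metis map_eq_conv)
      moreover have "g i = g (i mod int N)" if "g \<in> height_profiles N" for g
        using that periodic_cong[of N g i "i mod int N"] by (simp add: height_profiles_periodic)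
      ultimately show "h i = h' i" using h by metis
    qed
  qed
  then show ?thesis by (rule countable_image_inj_on[rotated]) (rule countable_subset[OF subset_UNIV], simp)
qed

definition rate_right :: "real \<Rightarrow> nat \<Rightarrow> (int \<Rightarrow> int) \<Rightarrow> int \<Rightarrow> real" where
  "rate_right K N h i = real N ^ 4 * exp (- 3 * K + K * real_of_int (third_diff h i))"

definition rate_left :: "real \<Rightarrow> nat \<Rightarrow> (int \<Rightarrow> int) \<Rightarrow> int \<Rightarrow> real" where
  "rate_left K N h i = real N ^ 4 * exp (- 3 * K - K * real_of_int (third_diff h i))"

abbreviation "move_right N i \<equiv> move_unit N i (i + 1)"
abbreviation "move_left N i \<equiv> move_unit N (i + 1) i"

lemma metropolis_rate_eq:
  "metropolis_rate K N h h' = (\<Sum>i\<in>{1..int N}. rate_right K N h i * of_bool (h' = move_right N i h)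
      + rate_left K N h i * of_bool (h' = move_left N i h))"
  by (simp add: metropolis_rate_def rate_right_def rate_left_def)

lemma rates_nonneg [simp]: "0 \<le> rate_right K N h i" "0 \<le> rate_left K N h i"
  by (simp_all add: rate_right_def rate_left_def)

lemma metropolis_rate_nonneg: "0 \<le> metropolis_rate K N h h'"
  unfolding metropolis_rate_eq by (intro sum_nonneg add_nonneg_nonneg mult_nonneg_nonneg) simp_all

lemma metropolis_rate_support:
  assumes "metropolis_rate K N h h' \<noteq> 0"
  shows "h' \<in> (\<Union>i\<in>{1..int N}. {move_right N i h, move_left N i h})"
proof (rule ccontr)
  assume "h' \<notin> (\<Union>i\<in>{1..int N}. {move_right N i h, move_left N i h})"
  then have "metropolis_rate K N h h' = 0" unfolding metropolis_rate_eq by (intro sum.neutral) auto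
  with assms show False by simp
qed

text \<open>
  Moves with the same target cause no trouble: their rates add up on the left and their terms add up on
  the right.
\<close>

lemma metropolis_rate_nn_integral:
  assumes h: "h \<in> height_profiles N" and g: "\<And>x. 0 \<le> g x"
  shows "(\<integral>\<^sup>+h'. ennreal (metropolis_rate K N h h') * ennreal (g h') \<partial>count_space (height_profiles N))
    = ennreal (\<Sum>i\<in>{1..int N}. rate_right K N h i * g (move_right N i h) + rate_left K N h i * g (move_left N i h))"
proof -
  let ?S = "\<Union>i\<in>{1..int N}. {move_right N i h, move_left N i h}"
  have "(\<integral>\<^sup>+h'. ennreal (metropolis_rate K N h h') * ennreal (g h') \<partial>count_space (height_profiles N))
      = (\<Sum>h'\<in>?S. ennreal (metropolis_rate K N h h') * ennreal (g h'))"
  proof (rule nn_integral_count_space')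
    show "?S \<subseteq> height_profiles N" using move_unit_profile[OF h] by auto
    fix x assume "x \<notin> ?S"
    then have "metropolis_rate K N h x = 0" using metropolis_rate_support by blast
    then show "ennreal (metropolis_rate K N h x) * ennreal (g x) = 0" by simp
  qed simp
  also have "\<dots> = ennreal (\<Sum>h'\<in>?S. metropolis_rate K N h h' * g h')"
    using g by (subst sum_ennreal[symmetric]) (auto simp: ennreal_mult metropolis_rate_nonneg)
  also have "(\<Sum>h'\<in>?S. metropolis_rate K N h h' * g h')
      = (\<Sum>i\<in>{1..int N}. \<Sum>h'\<in>?S. rate_right K N h i * (of_bool (h' = move_right N i h) * g h')
          + rate_left K N h i * (of_bool (h' = move_left N i h) * g h'))"
    unfolding metropolis_rate_eq sum_distrib_right
    by (subst sum.swap) (simp add: algebra_simps)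
  also have "\<dots> = (\<Sum>i\<in>{1..int N}. rate_right K N h i * g (move_right N i h) + rate_left K N h i * g (move_left N i h))"
  proof (rule sum.cong[OF refl])
    fix i assume i: "i \<in> {1..int N}"
    have d: "(\<Sum>h'\<in>?S. of_bool (h' = x) * g h') = g x" if "x \<in> ?S" for x
    proof -
      have "(\<Sum>h'\<in>?S. of_bool (h' = x) * g h') = (\<Sum>h'\<in>?S. if h' = x then g h' else 0)"
        by (rule sum.cong) auto
      also have "\<dots> = g x" using that by (subst sum.delta) auto
      finally show ?thesis .
    qed
    have "move_right N i h \<in> ?S" "move_left N i h \<in> ?S" using i by blast+
    then show "(\<Sum>h'\<in>?S. rate_right K N h i * (of_bool (h' = move_right N i h) * g h')
          + rate_left K N h i * (of_bool (h' = move_left N i h) * g h'))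
       = rate_right K N h i * g (move_right N i h) + rate_left K N h i * g (move_left N i h)"
      by (simp only: sum.distrib sum_distrib_left[symmetric] d)
  qed
  finally show ?thesis .
qed

text \<open>
  The value of \<open>rise f\<close> for the Metropolis rates, as a real number.
\<close>

definition upward :: "real \<Rightarrow> nat \<Rightarrow> ((int \<Rightarrow> int) \<Rightarrow> real) \<Rightarrow> (int \<Rightarrow> int) \<Rightarrow> real" where
  "upward K N f h = (\<Sum>i\<in>{1..int N}. rate_right K N h i * max 0 (f (move_right N i h) - f h)
     + rate_left K N h i * max 0 (f (move_left N i h) - f h))"

definition generator :: "real \<Rightarrow> nat \<Rightarrow> ((int \<Rightarrow> int) \<Rightarrow> real) \<Rightarrow> (int \<Rightarrow> int) \<Rightarrow> real" where
  "generator K N f h = (\<Sum>i\<in>{1..int N}. rate_right K N h i * (f (move_right N i h) - f h)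
     + rate_left K N h i * (f (move_left N i h) - f h))"

lemma upward_nonneg: "0 \<le> upward K N f h"
  unfolding upward_def by (intro sum_nonneg add_nonneg_nonneg mult_nonneg_nonneg) simp_all

lemma upward_diff: "upward K N f h - upward K N (\<lambda>h. - f h) h = generator K N f h"
  unfolding upward_def generator_def sum_subtractf[symmetric]
proof (rule sum.cong[OF refl])
  fix i
  have m: "max 0 (a - b) - max 0 (- a - - b) = a - b" for a b :: real by auto
  have lin: "a * x + b * y - (a * x' + b * y') = a * (x - x') + b * (y - y')" for a b x x' y y' :: real
    by (simp add: algebra_simps)
  show "rate_right K N h i * max 0 (f (move_right N i h) - f h) + rate_left K N h i * max 0 (f (move_left N i h) - f h) -
      (rate_right K N h i * max 0 (- f (move_right N i h) - - f h) + rate_left K N h i * max 0 (- f (move_left N i h) - - f h))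
      = rate_right K N h i * (f (move_right N i h) - f h) + rate_left K N h i * (f (move_left N i h) - f h)"
    by (simp only: lin m)
qed

definition activity :: "real \<Rightarrow> nat \<Rightarrow> (int \<Rightarrow> int) \<Rightarrow> real" where
  "activity K N h = (\<Sum>i\<in>{1..int N}. cosh (K * real_of_int (third_diff h i)))"

lemma activity_nonneg: "0 \<le> activity K N h"
  unfolding activity_def by (intro sum_nonneg) simp

lemma rate_sum: "rate_right K N h i + rate_left K N h i
    = 2 * real N ^ 4 * exp (- 3 * K) * cosh (K * real_of_int (third_diff h i))"
  by (simp add: rate_right_def rate_left_def cosh_def exp_add exp_diff exp_minus field_simps)

lemma rate_difference: "rate_right K N h i - rate_left K N h i
    = real N ^ 4 * J K (real_of_int (third_diff h i))"
  by (simp add: rate_right_def rate_left_def J_def sinh_def exp_add exp_diff exp_minus field_simps)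

lemma upward_le_activity:
  assumes B: "\<And>i. i \<in> {1..int N} \<Longrightarrow> \<bar>f (move_right N i h) - f h\<bar> \<le> B" "\<And>i. i \<in> {1..int N} \<Longrightarrow> \<bar>f (move_left N i h) - f h\<bar> \<le> B"
  shows "upward K N f h \<le> B * (2 * real N ^ 4 * exp (- 3 * K)) * activity K N h"
proof -
  have "upward K N f h \<le> (\<Sum>i\<in>{1..int N}. rate_right K N h i * B + rate_left K N h i * B)"
    unfolding upward_def
  proof (intro sum_mono add_mono mult_left_mono)
    fix i assume "i \<in> {1..int N}"
    from B(1)[OF this] B(2)[OF this]
    show "max 0 (f (move_right N i h) - f h) \<le> B" "max 0 (f (move_left N i h) - f h) \<le> B" by auto
  qed simp_all
  also have "\<dots> = (\<Sum>i\<in>{1..int N}. B * (rate_right K N h i + rate_left K N h i))"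
    by (simp add: algebra_simps)
  also have "\<dots> = B * (2 * real N ^ 4 * exp (- 3 * K)) * activity K N h"
    unfolding rate_sum activity_def sum_distrib_left by (simp add: mult.assoc)
  finally show ?thesis .
qed

lemma sum_move_unit:
  fixes c :: "int \<Rightarrow> real"
  assumes c: "periodic N c" and N: "1 \<le> N"
  shows "(\<Sum>k\<in>{1..int N}. c k * real_of_int (move_unit N a b h k - h k)) = c b - c a"
proof -
  have "(\<Sum>k\<in>{1..int N}. c k * real_of_int (move_unit N a b h k - h k))
    = (\<Sum>k\<in>{1..int N}. c k * of_bool (k mod int N = b mod int N))
     - (\<Sum>k\<in>{1..int N}. c k * of_bool (k mod int N = a mod int N))"
    unfolding sum_subtractf[symmetric] move_unit_def by (intro sum.cong) (auto simp: algebra_simps)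
  then show ?thesis by (simp only: periodic_delta[OF c N])
qed

definition test_sum :: "nat \<Rightarrow> (int \<Rightarrow> real) \<Rightarrow> (int \<Rightarrow> int) \<Rightarrow> real" where
  "test_sum N p h = (\<Sum>i\<in>{1..int N}. p i * real_of_int (third_diff h i))"

definition third_diff_adjoint :: "(int \<Rightarrow> real) \<Rightarrow> int \<Rightarrow> real" where
  "third_diff_adjoint p k = p (k - 2) - 3 * p (k - 1) + 3 * p k - p (k + 1)"

definition fourth_diff :: "(int \<Rightarrow> real) \<Rightarrow> int \<Rightarrow> real" where
  "fourth_diff p i = p (i + 2) - 4 * p (i + 1) + 6 * p i - 4 * p (i - 1) + p (i - 2)"

lemma third_diff_adjoint_diff: "third_diff_adjoint p (i + 1) - third_diff_adjoint p i = - fourth_diff p i"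
  by (simp add: third_diff_adjoint_def fourth_diff_def algebra_simps)

lemma third_diff_adjoint_periodic:
  assumes "periodic N p" shows "periodic N (third_diff_adjoint p)"
  unfolding periodic_def
proof
  fix i
  note p = periodic_add[OF assms]
  show "third_diff_adjoint p (i + int N) = third_diff_adjoint p i"
    unfolding third_diff_adjoint_def using p[of i "-2"] p[of i "-1"] p[of i 0] p[of i 1] by simp
qed

lemma test_sum_by_parts:
  assumes p: "periodic N p" and h: "h \<in> height_profiles N"
  shows "test_sum N p h = (\<Sum>k\<in>{1..int N}. third_diff_adjoint p k * real_of_int (h k))"
proof -
  have h': "periodic N h" using h by (simp add: height_profiles_periodic)
  have sh: "(\<Sum>i\<in>{1..int N}. p i * real_of_int (h (i + a))) = (\<Sum>k\<in>{1..int N}. p (k - a) * real_of_int (h k))" for a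
  proof -
    have "periodic N (\<lambda>k. p (k - a) * real_of_int (h k))"
      using periodic_shift[OF p, of "- a"] h' unfolding periodic_def by simp
    from sum_periodic_shift[OF this, of a] show ?thesis by simp
  qed
  have "test_sum N p h = (\<Sum>i\<in>{1..int N}. p i * real_of_int (h (i + 2))) - 3 * (\<Sum>i\<in>{1..int N}. p i * real_of_int (h (i + 1)))
     + 3 * (\<Sum>i\<in>{1..int N}. p i * real_of_int (h (i + 0))) - (\<Sum>i\<in>{1..int N}. p i * real_of_int (h (i + -1)))"
    unfolding test_sum_def third_diff_heights sum_distrib_left sum.distrib[symmetric] sum_subtractf[symmetric]
    by (intro sum.cong) (auto simp: algebra_simps)
  also have "\<dots> = (\<Sum>k\<in>{1..int N}. third_diff_adjoint p k * real_of_int (h k))"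
    unfolding sh third_diff_adjoint_def sum_distrib_left sum.distrib[symmetric] sum_subtractf[symmetric]
    by (intro sum.cong) (auto simp: algebra_simps)
  finally show ?thesis .
qed

lemma test_sum_move_unit:
  assumes p: "periodic N p" and h: "h \<in> height_profiles N" and N: "1 \<le> N"
  shows "test_sum N p (move_unit N a b h) - test_sum N p h = third_diff_adjoint p b - third_diff_adjoint p a"
  unfolding test_sum_by_parts[OF p h] test_sum_by_parts[OF p move_unit_profile[OF h]]
    sum_subtractf[symmetric] right_diff_distrib[symmetric] of_int_diff[symmetric]
  by (rule sum_move_unit[OF third_diff_adjoint_periodic[OF p] N])

lemma test_sum_right_left:
  assumes p: "periodic N p" and h: "h \<in> height_profiles N" and N: "1 \<le> N"
  shows "test_sum N p (move_right N i h) - test_sum N p h = - fourth_diff p i"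
    "test_sum N p (move_left N i h) - test_sum N p h = fourth_diff p i"
  using third_diff_adjoint_diff[of p i] by (simp_all add: test_sum_move_unit[OF assms])

text \<open>
  Opposite moves change the test sum by opposite amounts, which leaves the difference of their rates.
\<close>

lemma generator_test_sum:
  assumes p: "periodic N p" and h: "h \<in> height_profiles N" and N: "1 \<le> N"
  shows "generator K N (test_sum N p) h
    = - (\<Sum>i\<in>{1..int N}. real N ^ 4 * fourth_diff p i * J K (real_of_int (third_diff h i)))"
proof -
  have "generator K N (test_sum N p) h = (\<Sum>i\<in>{1..int N}. - ((rate_right K N h i - rate_left K N h i) * fourth_diff p i))"
    unfolding generator_def test_sum_right_left[OF assms] by (simp add: algebra_simps)
  then show ?thesis unfolding rate_difference sum_negf by (simp add: mult_ac)
qed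

section \<open>A Lyapunov function for the height process\<close>

lemma sqrt_diff_le:
  assumes "0 < a" "0 \<le> b" shows "sqrt b - sqrt a \<le> (b - a) / (2 * sqrt a)"
proof -
  have "0 \<le> (sqrt b - sqrt a)\<^sup>2" by simp
  also have "(sqrt b - sqrt a)\<^sup>2 = b - 2 * sqrt a * sqrt b + a" using assms by (simp add: power2_diff)
  finally have "0 \<le> b - 2 * sqrt a * sqrt b + a" .
  moreover have "(sqrt b - sqrt a) * (2 * sqrt a) = 2 * sqrt a * sqrt b - 2 * (sqrt a * sqrt a)"
    by (simp add: algebra_simps)
  ultimately have "(sqrt b - sqrt a) * (2 * sqrt a) \<le> b - a" using assms by simp
  then show ?thesis using assms by (simp add: pos_le_divide_eq)
qed

definition energy :: "nat \<Rightarrow> (int \<Rightarrow> int) \<Rightarrow> real" where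
  "energy N h = (\<Sum>k\<in>{1..int N}. (real_of_int (slope h k))\<^sup>2)"

text \<open>
  The energy would have stronger dissipation, but only the first moments of the third differences are
  finite at time \<open>0\<close>, and the square root grows linearly in them.
\<close>

definition lyapunov :: "nat \<Rightarrow> (int \<Rightarrow> int) \<Rightarrow> real" where
  "lyapunov N h = sqrt (1 + energy N h)"

lemma energy_nonneg: "0 \<le> energy N h"
  unfolding energy_def by (intro sum_nonneg) simp

lemma lyapunov_ge_1: "1 \<le> lyapunov N h"
  unfolding lyapunov_def using energy_nonneg[of N h] by simp

text \<open>
  For the two moves at bond \<open>i\<close> the linear term is \<open>- 2 w\<^sub>i\<close> and \<open>2 w\<^sub>i\<close>, so the move with the larger rate
  decreases the energy if \<open>\<bar>w\<^sub>i\<bar>\<close> is large.  The quadratic term is \<open>6\<close> unless neighbouring sites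
  coincide modulo \<open>N\<close>; \<open>4 N\<close> bounds it in all cases.
\<close>

lemma energy_move_unit:
  assumes h: "h \<in> height_profiles N" and N: "1 \<le> N"
  defines "z \<equiv> \<lambda>k. real_of_int (slope h k)"
  shows "energy N (move_unit N a b h) \<le> energy N h + 2 * ((z (b - 1) - z b) - (z (a - 1) - z a)) + 4 * real N"
proof -
  define e where "e k = real_of_int (move_unit N a b h k - h k)" for k
  have pz: "periodic N z" using slope_periodic[OF h] by (simp add: periodic_def z_def)
  have pe: "periodic N e" using h move_unit_profile[OF h, of a b]
    by (simp add: periodic_def e_def height_profiles_def)
  have e1: "\<bar>e k\<bar> \<le> 1" for k by (auto simp: e_def move_unit_def)
  have sl: "real_of_int (slope (move_unit N a b h) k) = z k + (e (k + 1) - e k)" for k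
    by (simp add: slope_def z_def e_def)
  have sq: "(e (k + 1) - e k)\<^sup>2 \<le> 4" for k
  proof -
    have "\<bar>e (k + 1) - e k\<bar> \<le> 2" using e1[of k] e1[of "k + 1"] by linarith
    then have "(e (k + 1) - e k)\<^sup>2 \<le> 2\<^sup>2" using abs_le_square_iff[of "e (k + 1) - e k" 2] by simp
    then show ?thesis by simp
  qed
  have shift: "(\<Sum>k\<in>{1..int N}. z k * e (k + 1)) = (\<Sum>k\<in>{1..int N}. z (k - 1) * e k)"
  proof -
    have "periodic N (\<lambda>k. z (k - 1) * e k)"
      using periodic_shift[OF pz, of "-1"] pe by (simp add: periodic_def)
    from sum_periodic_shift1[OF this] show ?thesis by simp
  qed
  have "(\<Sum>k\<in>{1..int N}. z k * (e (k + 1) - e k)) = (\<Sum>k\<in>{1..int N}. (z (k - 1) - z k) * e k)"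
    unfolding right_diff_distrib left_diff_distrib sum_subtractf shift ..
  also have "\<dots> = (z (b - 1) - z b) - (z (a - 1) - z a)"
    unfolding e_def
  proof (rule sum_move_unit[OF _ N])
    show "periodic N (\<lambda>k. z (k - 1) - z k)"
      using periodic_shift[OF pz, of "-1"] pz by (simp add: periodic_def)
  qed
  finally have cross: "(\<Sum>k\<in>{1..int N}. z k * (e (k + 1) - e k)) = (z (b - 1) - z b) - (z (a - 1) - z a)" .
  have "energy N (move_unit N a b h)
      = (\<Sum>k\<in>{1..int N}. (z k)\<^sup>2 + 2 * (z k * (e (k + 1) - e k)) + (e (k + 1) - e k)\<^sup>2)"
    unfolding energy_def sl by (intro sum.cong) (auto simp: power2_sum)
  also have "\<dots> = energy N h + 2 * ((z (b - 1) - z b) - (z (a - 1) - z a)) + (\<Sum>k\<in>{1..int N}. (e (k + 1) - e k)\<^sup>2)"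
    unfolding sum.distrib sum_distrib_left[symmetric] cross by (simp add: energy_def z_def)
  also have "(\<Sum>k\<in>{1..int N}. (e (k + 1) - e k)\<^sup>2) \<le> of_nat (card {1..int N}) * 4"
    by (rule sum_bounded_above) (rule sq)
  finally show ?thesis by simp
qed

lemma lyapunov_right_left:
  fixes i :: int
  assumes h: "h \<in> height_profiles N" and N: "1 \<le> N"
  defines "w \<equiv> real_of_int (third_diff h i)"
  shows "lyapunov N (move_right N i h) - lyapunov N h \<le> (2 * real N - w) / lyapunov N h"
    "lyapunov N (move_left N i h) - lyapunov N h \<le> (2 * real N + w) / lyapunov N h"
proof -
  have *: "lyapunov N h' - lyapunov N h \<le> r / lyapunov N h" if "energy N h' \<le> energy N h + 2 * r" for h' r
  proof -
    have "lyapunov N h' - lyapunov N h \<le> (energy N h' - energy N h) / (2 * lyapunov N h)"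
      using sqrt_diff_le[of "1 + energy N h" "1 + energy N h'"] energy_nonneg[of N h] energy_nonneg[of N h']
      unfolding lyapunov_def by simp
    also have "\<dots> \<le> (2 * r) / (2 * lyapunov N h)"
      using that lyapunov_ge_1[of N h] by (intro divide_right_mono) auto
    finally show ?thesis by simp
  qed
  show "lyapunov N (move_right N i h) - lyapunov N h \<le> (2 * real N - w) / lyapunov N h"
    using energy_move_unit[OF h N, of i "i + 1"] by (intro *) (simp add: w_def third_diff_def)
  show "lyapunov N (move_left N i h) - lyapunov N h \<le> (2 * real N + w) / lyapunov N h"
    using energy_move_unit[OF h N, of "i + 1" i] by (intro *) (simp add: w_def third_diff_def)
qed

text \<open>
  For large \<open>\<bar>u\<bar>\<close> the term \<open>2 * u * sinh (K * u)\<close> is nearly \<open>2 * \<bar>u\<bar> * cosh (K * u)\<close>: one half of it absorbs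
  \<open>A * cosh (K * u)\<close>, the other half remains on the right.
\<close>

lemma cosh_sinh_bound:
  fixes A K u :: real
  assumes A: "0 \<le> A" and K: "0 < K"
  shows "A * cosh (K * u) - 2 * u * sinh (K * u) \<le> (A * cosh (K * A) + 2 / K) - \<bar>u\<bar> * cosh (K * u)"
proof -
  define v where "v = \<bar>u\<bar>"
  have v: "0 \<le> v" by (simp add: v_def)
  have c: "cosh (K * u) = cosh (K * v)" and s: "u * sinh (K * u) = v * sinh (K * v)"
    unfolding v_def by (cases "0 \<le> u"; simp)+
  have "K * v \<le> exp (K * v)" using exp_ge_add_one_self[of "K * v"] by linarith
  then have "v * exp (- (K * v)) \<le> 1 / K" using K by (simp add: exp_minus field_simps)
  moreover have "v * sinh (K * v) = v * cosh (K * v) - v * exp (- (K * v))"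
    by (simp add: sinh_field_def cosh_field_def field_simps)
  moreover have "(A - v) * cosh (K * v) \<le> A * cosh (K * A)"
  proof (cases "v \<le> A")
    case True
    have "cosh (K * v) \<le> cosh (K * A)" using True v K by (simp add: cosh_real_nonneg_le_iff)
    then have "(A - v) * cosh (K * v) \<le> A * cosh (K * A)"
      using True v by (intro mult_mono) auto
    then show ?thesis .
  next
    case False
    then have "(A - v) * cosh (K * v) \<le> 0" by (intro mult_nonpos_nonneg) auto
    also have "0 \<le> A * cosh (K * A)" using A by simp
    finally show ?thesis .
  qed
  ultimately have "A * cosh (K * v) - 2 * (v * sinh (K * v)) \<le> (A * cosh (K * A) + 2 / K) - v * cosh (K * v)"
    by (simp add: algebra_simps)
  then show ?thesis by (simp only: c s mult.assoc v_def[symmetric])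
qed

text \<open>
  By periodicity the slopes and their increments both have mean zero, so each is bounded by the
  variation of the next difference.
\<close>

lemma lyapunov_le_third_diff:
  assumes h: "h \<in> height_profiles N" and N: "1 \<le> N"
  shows "lyapunov N h \<le> 1 + (real N)\<^sup>2 * (\<Sum>i\<in>{1..int N}. \<bar>real_of_int (third_diff h i)\<bar>)" (is "_ \<le> 1 + _ * ?S")
proof -
  define z where "z k = real_of_int (slope h k)" for k
  define d where "d k = z (k + 1) - z k" for k
  have ph: "periodic N (\<lambda>k. real_of_int (h k))" using h by (simp add: height_profiles_def periodic_def)
  have pz: "periodic N z" using slope_periodic[OF h] by (simp add: periodic_def z_def)
  have z0: "(\<Sum>k\<in>{1..int N}. z k) = 0"
    using sum_periodic_shift1[OF ph] by (simp add: z_def slope_def sum_subtractf)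
  have d0: "(\<Sum>k\<in>{1..int N}. d k) = 0"
    using sum_periodic_shift1[OF pz] by (simp add: d_def sum_subtractf)
  have "(\<Sum>j\<in>{1..int N}. \<bar>d (j + 1) - d j\<bar>) = (\<Sum>j\<in>{1..int N}. \<bar>real_of_int (third_diff h (j + 1))\<bar>)"
    by (intro sum.cong) (auto simp: d_def z_def third_diff_def add.commute)
  also have "\<dots> = ?S"
    by (rule sum_periodic_shift1) (use third_diff_periodic[OF h] in \<open>simp add: periodic_def\<close>)
  finally have varS: "(\<Sum>j\<in>{1..int N}. \<bar>d (j + 1) - d j\<bar>) = ?S" .
  have dS: "\<bar>d k\<bar> \<le> ?S" if "k \<in> {1..int N}" for k
    using zero_mean_le_variation[OF d0 N that] varS by simp
  have zS: "\<bar>z k\<bar> \<le> real N * ?S" if "k \<in> {1..int N}" for k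
  proof -
    have "\<bar>z k\<bar> \<le> (\<Sum>j\<in>{1..int N}. \<bar>d j\<bar>)"
      using zero_mean_le_variation[OF z0 N that] by (simp add: d_def)
    also have "\<dots> \<le> of_nat (card {1..int N}) * ?S" by (rule sum_bounded_above) (rule dS)
    finally show ?thesis by simp
  qed
  have "lyapunov N h \<le> sqrt 1 + sqrt (energy N h)"
    unfolding lyapunov_def using energy_nonneg by (intro sqrt_add_le_add_sqrt) auto
  also have "sqrt (energy N h) \<le> (\<Sum>k\<in>{1..int N}. \<bar>z k\<bar>)"
    using L2_set_le_sum_abs[of z "{1..int N}"] by (simp add: L2_set_def energy_def z_def)
  also have "\<dots> \<le> of_nat (card {1..int N}) * (real N * ?S)" by (rule sum_bounded_above) (rule zS)
  finally show ?thesis by (simp add: power2_eq_square mult.assoc)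
qed

text \<open>
  The generator of the energy is at most a constant minus a multiple of \<open>\<Sum>\<^sub>i \<bar>w\<^sub>i\<bar> cosh (K w\<^sub>i)\<close>.
  Concavity of the square root divides this by \<open>lyapunov N h\<close>, which is of order \<open>\<Sum>\<^sub>i \<bar>w\<^sub>i\<bar>\<close> at most;
  what is left over is of the order of the activity.
\<close>

lemma lyapunov_drift:
  assumes K: "0 < K" and N: "1 \<le> N"
  obtains c C where "0 < c" "0 \<le> C"
    "\<And>h. h \<in> height_profiles N \<Longrightarrow> generator K N (lyapunov N) h + c * activity K N h \<le> C"
proof
  define B where "B = 4 * real N * cosh (K * (4 * real N)) + 2 / K"
  define P where "P = real N ^ 4 * exp (- 3 * K)"
  define D where "D = 2 * real N * (1 + (real N)\<^sup>2)"
  define e where "e = 1 / D"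
  have B: "0 \<le> B" unfolding B_def using K by simp
  have P: "0 < P" unfolding P_def using N by simp
  have D: "0 < D" unfolding D_def using N by (simp add: add_pos_nonneg)
  have e: "0 < e" and eD: "e * D = 1" unfolding e_def using D by simp_all
  show "0 < P * e" using P e by simp
  show "0 \<le> P * (N * B + e * (N * cosh K))" using P B e by simp
  fix h assume h: "h \<in> height_profiles N"
  define w where "w i = real_of_int (third_diff h i)" for i
  define S where "S = (\<Sum>i\<in>{1..int N}. \<bar>w i\<bar>)"
  define Q where "Q = (\<Sum>i\<in>{1..int N}. \<bar>w i\<bar> * cosh (K * w i))"
  let ?V = "lyapunov N h" and ?\<phi> = "activity K N h"
  have V: "1 \<le> ?V" by (rule lyapunov_ge_1)
  have Q0: "0 \<le> Q" unfolding Q_def by (intro sum_nonneg) simp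
  have "generator K N (lyapunov N) h
     \<le> (\<Sum>i\<in>{1..int N}. rate_right K N h i * ((2 * real N - w i) / ?V) + rate_left K N h i * ((2 * real N + w i) / ?V))"
    unfolding generator_def w_def
    by (intro sum_mono add_mono mult_left_mono lyapunov_right_left[OF h N]) simp_all
  also have "\<dots> = (\<Sum>i\<in>{1..int N}. P / ?V * (4 * real N * cosh (K * w i) - 2 * w i * sinh (K * w i)))"
  proof (rule sum.cong[OF refl])
    fix i
    have "rate_right K N h i * ((2 * real N - w i) / ?V) + rate_left K N h i * ((2 * real N + w i) / ?V)
       = (2 * real N * (rate_right K N h i + rate_left K N h i) - w i * (rate_right K N h i - rate_left K N h i)) / ?V"
      using V by (simp add: field_simps)
    also have "\<dots> = P / ?V * (4 * real N * cosh (K * w i) - 2 * w i * sinh (K * w i))"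
      unfolding rate_sum rate_difference J_def P_def w_def by (simp add: algebra_simps diff_divide_distrib)
    finally show "rate_right K N h i * ((2 * real N - w i) / ?V) + rate_left K N h i * ((2 * real N + w i) / ?V)
       = P / ?V * (4 * real N * cosh (K * w i) - 2 * w i * sinh (K * w i))" .
  qed
  also have "\<dots> \<le> (\<Sum>i\<in>{1..int N}. P / ?V * (B - \<bar>w i\<bar> * cosh (K * w i)))"
    unfolding B_def using P V K by (intro sum_mono mult_left_mono cosh_sinh_bound) auto
  also have "\<dots> = P * ((N * B - Q) / ?V)"
    unfolding sum_distrib_left[symmetric] sum_subtractf Q_def by simp
  also have "\<dots> \<le> P * (N * B + e * (N * cosh K) - e * ?\<phi>)"
  proof (intro mult_left_mono)
    have NB: "(N * B - Q) / ?V \<le> N * B - Q / ?V"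
    proof -
      have "N * B / ?V \<le> N * B" using mult_left_mono[OF V, of "N * B"] V B by (simp add: pos_divide_le_eq)
      then show ?thesis by (simp add: diff_divide_distrib)
    qed
    show "(N * B - Q) / ?V \<le> N * B + e * (N * cosh K) - e * ?\<phi>"
    \<comment> \<open>If \<open>S < 1\<close>, the linear bound on \<open>lyapunov N h\<close> is useless, but then the activity is bounded.\<close>
    proof (cases "1 \<le> S")
      case True
      have VS: "?V \<le> (1 + (real N)\<^sup>2) * S"
        using lyapunov_le_third_diff[OF h N] True by (simp add: S_def w_def distrib_right)
      \<comment> \<open>Chebyshev's sum inequality up to a factor \<open>2\<close>: a mixed term is at most the larger diagonal one.\<close>
      have "S * ?\<phi> = (\<Sum>i\<in>{1..int N}. \<Sum>j\<in>{1..int N}. \<bar>w i\<bar> * cosh (K * w j))"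
        unfolding S_def activity_def w_def by (simp add: sum_product)
      also have "\<dots> \<le> (\<Sum>i\<in>{1..int N}. \<Sum>j\<in>{1..int N}. \<bar>w i\<bar> * cosh (K * w i) + \<bar>w j\<bar> * cosh (K * w j))"
      proof (intro sum_mono)
        fix i j
        have ch: "cosh (K * x) = cosh (K * \<bar>x\<bar>)" for x by (cases "0 \<le> x") simp_all
        show "\<bar>w i\<bar> * cosh (K * w j) \<le> \<bar>w i\<bar> * cosh (K * w i) + \<bar>w j\<bar> * cosh (K * w j)"
        proof (cases "\<bar>w i\<bar> \<le> \<bar>w j\<bar>")
          case True
          then have "\<bar>w i\<bar> * cosh (K * w j) \<le> \<bar>w j\<bar> * cosh (K * w j)" by (intro mult_right_mono) auto
          then show ?thesis by (simp add: add_increasing)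
        next
          case False
          then have "cosh (K * w j) \<le> cosh (K * w i)"
            unfolding ch[of "w i"] ch[of "w j"] using K by (simp add: cosh_real_nonneg_le_iff)
          then have "\<bar>w i\<bar> * cosh (K * w j) \<le> \<bar>w i\<bar> * cosh (K * w i)" by (intro mult_left_mono) auto
          then show ?thesis by (simp add: add_increasing2)
        qed
      qed
      also have "\<dots> = 2 * N * Q"
        by (simp add: sum.distrib Q_def sum_distrib_left[symmetric] algebra_simps)
      finally have SQ: "S * ?\<phi> \<le> 2 * N * Q" .
      have "e * ?\<phi> * ?V \<le> e * ?\<phi> * ((1 + (real N)\<^sup>2) * S)"
        using VS e activity_nonneg by (intro mult_left_mono) auto
      also have "\<dots> = e * (1 + (real N)\<^sup>2) * (S * ?\<phi>)" by simp
      also have "\<dots> \<le> e * (1 + (real N)\<^sup>2) * (2 * N * Q)" using SQ e by (intro mult_left_mono) auto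
      also have "\<dots> = (e * D) * Q" by (simp add: D_def mult_ac)
      also have "\<dots> = Q" unfolding eD by simp
      finally have "e * ?\<phi> \<le> Q / ?V" using V by (simp add: pos_le_divide_eq)
      moreover have "0 \<le> e * (N * cosh K)" using e by simp
      ultimately show ?thesis using NB by linarith
    next
      case False
      have "cosh (K * w i) \<le> cosh K" if i: "i \<in> {1..int N}" for i
      proof -
        have "\<bar>w i\<bar> \<le> S" unfolding S_def using i by (intro member_le_sum) auto
        then have "K * \<bar>w i\<bar> \<le> K * 1" using False K by (intro mult_left_mono) auto
        then have "cosh (K * \<bar>w i\<bar>) \<le> cosh (K * 1)"
          using K by (subst cosh_real_nonneg_le_iff) auto
        moreover have "cosh (K * w i) = cosh (K * \<bar>w i\<bar>)" by (cases "0 \<le> w i") simp_all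
        ultimately show ?thesis by (simp only: mult_1_right)
      qed
      then have "?\<phi> \<le> of_nat (card {1..int N}) * cosh K"
        unfolding activity_def w_def by (rule sum_bounded_above)
      then have "e * ?\<phi> \<le> e * (N * cosh K)" using e by (intro mult_left_mono) auto
      moreover have "0 \<le> Q / ?V" using Q0 V by simp
      ultimately show ?thesis using NB by linarith
    qed
  qed (use P in simp)
  finally show "generator K N (lyapunov N) h + P * e * ?\<phi> \<le> P * (N * B + e * (N * cosh K))"
    by (simp add: algebra_simps)
qed

text \<open>
  The activity dominates the rise and the fall of every test sum, and by the drift inequality its
  occupation integral is finite; so Dynkin's formula applies.
\<close>

lemma metropolis_evolution:
  assumes K: "0 < K" and N: "1 \<le> N" and proc: "metropolis_height_process K N M X"
    and W: "\<And>t i. 0 \<le> t \<Longrightarrow> i \<in> {1..int N} \<Longrightarrow> integrable M (\<lambda>\<omega>. real_of_int (third_diff (X t \<omega>) i))"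
    and Jint: "\<And>t i. 0 < t \<Longrightarrow> i \<in> {1..int N} \<Longrightarrow> integrable M (\<lambda>\<omega>. J K (real_of_int (third_diff (X t \<omega>) i)))"
    and p: "periodic N p" and t: "0 \<le> t"
  shows "((\<lambda>s. - (\<Sum>i\<in>{1..int N}. real N ^ 4 * fourth_diff p i * (\<integral>\<omega>. J K (real_of_int (third_diff (X s \<omega>) i)) \<partial>M)))
    has_integral ((\<Sum>i\<in>{1..int N}. p i * (\<integral>\<omega>. real_of_int (third_diff (X t \<omega>) i) \<partial>M))
      - (\<Sum>i\<in>{1..int N}. p i * (\<integral>\<omega>. real_of_int (third_diff (X 0 \<omega>) i) \<partial>M)))) {0..t}"
proof -
  let ?E = "height_profiles N" and ?q = "metropolis_rate K N"
  have fin: "finite {y \<in> ?E - {x}. ?q x y \<noteq> 0}" for x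
    by (rule finite_subset[of _ "\<Union>i\<in>{1..int N}. {move_right N i x, move_left N i x}"])
      (use metropolis_rate_support in blast, simp)
  have "\<exists>Y H. jump_process M ?E ?q Y H X"
    using proc countable_height_profiles[OF N] metropolis_rate_nonneg fin
    unfolding metropolis_height_process_def by (rule markov_jump_process_imp_jump_process)
  then obtain Y H where "jump_process M ?E ?q Y H X" by blast
  then interpret jump_process M ?E ?q Y H X .
  have rise: "rise f x = ennreal (upward K N f x)" if "x \<in> ?E" for f x
    unfolding rise_def upward_def by (rule metropolis_rate_nn_integral[OF that]) simp
  have act: "occupation t (\<lambda>x. ennreal (activity K N x)) < \<infinity>"
  proof -
    obtain c C where c: "0 < c" and C: "0 \<le> C"
      and drift: "\<And>h. h \<in> ?E \<Longrightarrow> generator K N (lyapunov N) h + c * activity K N h \<le> C"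
      using lyapunov_drift[OF K N] by blast
    have "occupation t (\<lambda>x. ennreal c * ennreal (activity K N x)) < \<infinity>"
    proof (rule lyapunov_occupation[OF t C])
      show "0 \<le> lyapunov N x" for x using lyapunov_ge_1[of N x] by simp
      show "rise (lyapunov N) x + ennreal c * ennreal (activity K N x) \<le> fall (lyapunov N) x + ennreal C"
        if x: "x \<in> ?E" for x
        unfolding rise[OF x] using drift[OF x] upward_diff[of K N "lyapunov N" x] c C
        by (simp add: ennreal_mult[symmetric] ennreal_plus[symmetric] upward_nonneg activity_nonneg del: ennreal_plus)
      have "(\<integral>\<^sup>+\<omega>. ennreal (lyapunov N (X 0 \<omega>)) \<partial>M)
         \<le> (\<integral>\<^sup>+\<omega>. ennreal (1 + (real N)\<^sup>2 * (\<Sum>i\<in>{1..int N}. \<bar>real_of_int (third_diff (X 0 \<omega>) i)\<bar>)) \<partial>M)"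
        by (intro nn_integral_mono ennreal_leI lyapunov_le_third_diff[OF _ N] X_in_E) auto
      also have "\<dots> < \<infinity>"
      proof -
        have "integrable M (\<lambda>\<omega>. 1 + (real N)\<^sup>2 * (\<Sum>i\<in>{1..int N}. \<bar>real_of_int (third_diff (X 0 \<omega>) i)\<bar>))"
          by (intro Bochner_Integration.integrable_add integrable_mult_right Bochner_Integration.integrable_sum integrable_abs W) auto
        from nn_integral_eq_integral[OF this] show ?thesis by (simp add: sum_nonneg)
      qed
      finally show "(\<integral>\<^sup>+\<omega>. ennreal (lyapunov N (X 0 \<omega>)) \<partial>M) < \<infinity>" .
    qed
    then show ?thesis unfolding occupation_cmult using c by (auto simp: ennreal_mult_less_top)
  qed
  let ?f = "test_sum N p"
  define B where "B = (\<Sum>i\<in>{1..int N}. \<bar>fourth_diff p i\<bar>)"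
  define D where "D = B * (2 * real N ^ 4 * exp (- 3 * K))"
  have B: "\<bar>fourth_diff p i\<bar> \<le> B" if "i \<in> {1..int N}" for i
    unfolding B_def using that by (intro member_le_sum) auto
  have D: "0 \<le> D" unfolding D_def B_def by (intro mult_nonneg_nonneg sum_nonneg) auto
  have up: "upward K N ?f x \<le> D * activity K N x" if "x \<in> ?E" for x
    unfolding D_def by (rule upward_le_activity) (simp_all add: test_sum_right_left[OF p that N] B)
  have dn: "upward K N (\<lambda>h. - ?f h) x \<le> D * activity K N x" if "x \<in> ?E" for x
    unfolding D_def
    by (rule upward_le_activity) (simp_all only: minus_diff_minus abs_minus_cancel test_sum_right_left[OF p that N] B)
  have occ: "occupation t (\<lambda>x. ennreal (r x)) < \<infinity>" if "\<And>x. x \<in> ?E \<Longrightarrow> r x \<le> D * activity K N x" for r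
  proof -
    have "occupation t (\<lambda>x. ennreal (r x)) \<le> occupation t (\<lambda>x. ennreal D * ennreal (activity K N x))"
      using that D by (intro occupation_mono) (simp add: ennreal_mult[symmetric] activity_nonneg ennreal_leI)
    also have "\<dots> < \<infinity>" unfolding occupation_cmult using act by (simp add: ennreal_mult_less_top)
    finally show ?thesis .
  qed
  have act_int: "integrable M (\<lambda>\<omega>. activity K N (X u \<omega>))" if u: "0 < u" for u
    unfolding activity_def
  proof (rule Bochner_Integration.integrable_sum)
    fix i assume i: "i \<in> {1..int N}"
    let ?w = "\<lambda>\<omega>. real_of_int (third_diff (X u \<omega>) i)"
    have "integrable M (\<lambda>\<omega>. 1 + exp (3 * K) / 2 * \<bar>J K (?w \<omega>)\<bar>)"
      by (intro Bochner_Integration.integrable_add integrable_mult_right integrable_abs Jint u i) simp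
    then show "integrable M (\<lambda>\<omega>. cosh (K * ?w \<omega>))"
    proof (rule Bochner_Integration.integrable_bound)
      show "(\<lambda>\<omega>. cosh (K * ?w \<omega>)) \<in> borel_measurable M"
        by (rule X_borel_measurable) (use u in simp)
      \<comment> \<open>Integrability of \<open>J\<close> controls \<open>sinh\<close>, hence \<open>cosh\<close>.\<close>
      have "cosh y \<le> 1 + \<bar>sinh y\<bar>" for y :: real
      proof (rule power2_le_imp_le)
        show "(cosh y)\<^sup>2 \<le> (1 + \<bar>sinh y\<bar>)\<^sup>2" by (simp add: cosh_square_eq power2_sum)
      qed simp
      moreover have "exp (3 * K) / 2 * \<bar>J K x\<bar> = \<bar>sinh (K * x)\<bar>" for x
        by (simp add: J_def abs_mult exp_minus field_simps)
      ultimately show "AE \<omega> in M. norm (cosh (K * ?w \<omega>)) \<le> norm (1 + exp (3 * K) / 2 * \<bar>J K (?w \<omega>)\<bar>)"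
        by (intro AE_I2) (simp add: abs_of_nonneg)
    qed
  qed
  have int: "integrable M (\<lambda>\<omega>. r (X u \<omega>))"
    if "\<And>x. x \<in> ?E \<Longrightarrow> r x \<le> D * activity K N x" "\<And>x. 0 \<le> r x" "0 < u" for r u
  proof (rule Bochner_Integration.integrable_bound[of M "\<lambda>\<omega>. D * activity K N (X u \<omega>)"])
    show "AE \<omega> in M. norm (r (X u \<omega>)) \<le> norm (D * activity K N (X u \<omega>))"
      using that X_in_E[of u] D activity_nonneg by (intro AE_I2) auto
    show "(\<lambda>\<omega>. r (X u \<omega>)) \<in> borel_measurable M"
      by (rule X_borel_measurable) (use that in simp)
  qed (use that act_int in simp)
  have f_int: "integrable M (\<lambda>\<omega>. ?f (X u \<omega>))" if "0 \<le> u" for u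
    unfolding test_sum_def using that by (intro Bochner_Integration.integrable_sum integrable_mult_right W) auto
  have f_val: "(\<integral>\<omega>. ?f (X u \<omega>) \<partial>M) = (\<Sum>i\<in>{1..int N}. p i * (\<integral>\<omega>. real_of_int (third_diff (X u \<omega>) i) \<partial>M))"
    if "0 \<le> u" for u
    unfolding test_sum_def using that W by (subst Bochner_Integration.integral_sum) auto
  have "((\<lambda>u. (\<integral>\<omega>. upward K N ?f (X u \<omega>) - upward K N (\<lambda>h. - ?f h) (X u \<omega>) \<partial>M)) has_integral
    ((\<integral>\<omega>. ?f (X t \<omega>) \<partial>M) - (\<integral>\<omega>. ?f (X 0 \<omega>) \<partial>M))) {0..t}"
    by (rule dynkin_has_integral[OF t f_int f_int])
      (use t in \<open>auto intro!: upward_nonneg rise int occ[unfolded infinity_ennreal_def] up dn\<close>)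
  then show ?thesis
    unfolding f_val[OF t] f_val[OF order_refl]
  proof (rule has_integral_spike_finite[of "{0}", rotated 2])
    fix u assume "u \<in> {0..t} - {0}"
    then have u: "0 < u" by auto
    have "(\<integral>\<omega>. upward K N ?f (X u \<omega>) - upward K N (\<lambda>h. - ?f h) (X u \<omega>) \<partial>M)
      = (\<integral>\<omega>. - (\<Sum>i\<in>{1..int N}. real N ^ 4 * fourth_diff p i * J K (real_of_int (third_diff (X u \<omega>) i))) \<partial>M)"
      unfolding upward_diff using u by (intro Bochner_Integration.integral_cong refl generator_test_sum[OF p X_in_E N]) auto
    also have "\<dots> = - (\<Sum>i\<in>{1..int N}. real N ^ 4 * fourth_diff p i * (\<integral>\<omega>. J K (real_of_int (third_diff (X u \<omega>) i)) \<partial>M))"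
      using Jint[OF u] by (simp add: Bochner_Integration.integral_sum)
    finally show "- (\<Sum>i\<in>{1..int N}. real N ^ 4 * fourth_diff p i * (\<integral>\<omega>. J K (real_of_int (third_diff (X u \<omega>) i)) \<partial>M))
      = (\<integral>\<omega>. upward K N ?f (X u \<omega>) - upward K N (\<lambda>h. - ?f h) (X u \<omega>) \<partial>M)" by simp
  qed simp
qed

section \<open>Window averages on the torus\<close>

lemma torus_dist_le_iff:
  assumes "0 < \<epsilon>" "\<epsilon> < 1 / 2"
  shows "torus_dist y x \<le> \<epsilon> \<longleftrightarrow> (\<exists>m::int. \<bar>y - x - of_int m\<bar> \<le> \<epsilon>)"
proof
  assume "torus_dist y x \<le> \<epsilon>"
  then consider "frac (y - x) \<le> \<epsilon>" | "1 - frac (y - x) \<le> \<epsilon>"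
    unfolding torus_dist_def by linarith
  then show "\<exists>m::int. \<bar>y - x - of_int m\<bar> \<le> \<epsilon>"
  proof cases
    case 1
    then have "\<bar>y - x - of_int \<lfloor>y - x\<rfloor>\<bar> \<le> \<epsilon>" using frac_ge_0[of "y - x"] by (simp add: frac_def)
    then show ?thesis by blast
  next
    case 2
    then have "\<bar>y - x - of_int (\<lfloor>y - x\<rfloor> + 1)\<bar> \<le> \<epsilon>"
      using frac_lt_1[of "y - x"] unfolding frac_def of_int_add by linarith
    then show ?thesis by blast
  qed
next
  assume "\<exists>m::int. \<bar>y - x - of_int m\<bar> \<le> \<epsilon>"
  then obtain m :: int where m: "\<bar>y - x - of_int m\<bar> \<le> \<epsilon>" by blast
  show "torus_dist y x \<le> \<epsilon>"
  proof (cases "of_int m \<le> y - x")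
    case True
    then have "\<lfloor>y - x\<rfloor> = m" using m assms by (intro floor_unique) auto
    then show ?thesis using m True unfolding torus_dist_def frac_def by auto
  next
    case False
    then have "\<lfloor>y - x\<rfloor> = m - 1" using m assms by (intro floor_unique) auto
    then show ?thesis using m False unfolding torus_dist_def frac_def by auto
  qed
qed

lemma torus_dist_measurable [measurable]: "(\<lambda>x. torus_dist y x) \<in> borel_measurable borel"
  unfolding torus_dist_def frac_def by measurable

text \<open>
  On the unit interval the ball is cut out by the intervals around \<open>y\<close>, \<open>y - 1\<close> and \<open>y + 1\<close>, of which at
  most two meet the unit interval.
\<close>

lemma torus_ball_length:
  assumes y: "0 \<le> y" "y \<le> 1" and \<epsilon>: "0 < \<epsilon>" "\<epsilon> < 1 / 2"
  shows "measure lborel {x \<in> {0..1}. torus_dist y x \<le> \<epsilon>} = 2 * \<epsilon>"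
proof -
  have set: "{x \<in> {0..1}. torus_dist y x \<le> \<epsilon>} = {x. 0 \<le> x \<and> x \<le> 1 \<and> (\<bar>y - x\<bar> \<le> \<epsilon> \<or> \<bar>y - x - 1\<bar> \<le> \<epsilon> \<or> \<bar>y - x + 1\<bar> \<le> \<epsilon>)}"
    (is "?S = ?R")
  proof (intro equalityI subsetI)
    fix x assume "x \<in> ?S"
    then obtain m :: int where m: "\<bar>y - x - of_int m\<bar> \<le> \<epsilon>" and x: "0 \<le> x" "x \<le> 1"
      using torus_dist_le_iff[OF \<epsilon>] by auto
    have "- 2 < real_of_int m" "real_of_int m < 2" using m x y \<epsilon> by linarith+
    then have "m = 0 \<or> m = 1 \<or> m = - 1" by linarith
    then show "x \<in> ?R" using m x by auto
  next
    fix x assume x: "x \<in> ?R"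
    then have "\<bar>y - x - of_int 0\<bar> \<le> \<epsilon> \<or> \<bar>y - x - of_int 1\<bar> \<le> \<epsilon> \<or> \<bar>y - x - of_int (- 1)\<bar> \<le> \<epsilon>" by auto
    then have "\<exists>m::int. \<bar>y - x - of_int m\<bar> \<le> \<epsilon>" by blast
    then show "x \<in> ?S" using x torus_dist_le_iff[OF \<epsilon>, of y x] by simp
  qed
  have two: "measure lborel ({a..b} \<union> {c..d}) = (b - a) + (d - c)" if "a \<le> b" "b < c" "c \<le> d" for a b c d :: real
  proof -
    have "measure lborel ({a..b} \<union> {c..d}) = measure lborel {a..b} + measure lborel {c..d}"
      using that by (intro measure_Un_AE) (auto simp: emeasure_lborel_Icc_eq fmeasurable_def)
    then show ?thesis using that by simp
  qed
  consider "y \<le> \<epsilon>" | "1 - \<epsilon> \<le> y" | "\<epsilon> < y" "y < 1 - \<epsilon>" by linarith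
  then show ?thesis
  proof cases
    case 1
    then have "?R = {0..y + \<epsilon>} \<union> {y + 1 - \<epsilon>..1}" using y \<epsilon> by auto
    then show ?thesis unfolding set using two[of 0 "y + \<epsilon>" "y + 1 - \<epsilon>" 1] 1 y \<epsilon> by simp
  next
    case 2
    then have "?R = {0..y - 1 + \<epsilon>} \<union> {y - \<epsilon>..1}" using y \<epsilon> by auto
    then show ?thesis unfolding set using two[of 0 "y - 1 + \<epsilon>" "y - \<epsilon>" 1] 2 y \<epsilon> by simp
  next
    case 3
    then have "?R = {y - \<epsilon>..y + \<epsilon>}" using y \<epsilon> by auto
    then show ?thesis unfolding set using \<epsilon> by simp
  qed
qed

lemma card_int_interval_le:
  assumes "l \<le> u"
  shows "real (card {i::int. l \<le> of_int i \<and> of_int i \<le> u}) \<le> u - l + 1"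
proof -
  have "{i::int. l \<le> of_int i \<and> of_int i \<le> u} = {\<lceil>l\<rceil>..\<lfloor>u\<rfloor>}"
    by (auto simp: ceiling_le_iff le_floor_iff)
  then have "real (card {i::int. l \<le> of_int i \<and> of_int i \<le> u}) = real (nat (\<lfloor>u\<rfloor> - \<lceil>l\<rceil> + 1))" by simp
  also have "\<dots> \<le> u - l + 1" using assms by (cases "0 \<le> \<lfloor>u\<rfloor> - \<lceil>l\<rceil> + 1") (simp_all, linarith)
  finally show ?thesis .
qed

lemma finite_int_interval: "finite {i::int. l \<le> of_int i \<and> of_int i \<le> u}" for l u :: real
proof -
  have "{i::int. l \<le> of_int i \<and> of_int i \<le> u} = {\<lceil>l\<rceil>..\<lfloor>u\<rfloor>}"
    by (auto simp: ceiling_le_iff le_floor_iff)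
  then show ?thesis by simp
qed

lemma card_window_le:
  assumes N: "1 \<le> N" and x: "0 \<le> x" "x \<le> 1" and \<epsilon>: "0 < \<epsilon>" "\<epsilon> < 1 / 2"
  shows "real (card (window N x \<epsilon>)) \<le> 3 * (2 * real N * \<epsilon> + 1)"
proof -
  let ?I = "\<lambda>m::int. {i::int. real N * (x + of_int m - \<epsilon>) \<le> of_int i \<and> of_int i \<le> real N * (x + of_int m + \<epsilon>)}"
  have sub: "window N x \<epsilon> \<subseteq> (\<Union>m\<in>{-1, 0, 1}. ?I m)"
  proof
    fix i assume i: "i \<in> window N x \<epsilon>"
    then obtain m :: int where m: "\<bar>of_int i / real N - x - of_int m\<bar> \<le> \<epsilon>"
      using torus_dist_le_iff[OF \<epsilon>] unfolding window_def by auto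
    have "0 < of_int i / real N" "of_int i / real N \<le> 1" using i N by (auto simp: window_def divide_le_eq)
    then have "- 2 < real_of_int m" "real_of_int m < 2" using m x \<epsilon> by linarith+
    then have "m \<in> {-1, 0, 1}" by auto
    moreover have "i \<in> ?I m"
    proof -
      have "x + of_int m - \<epsilon> \<le> of_int i / real N" "of_int i / real N \<le> x + of_int m + \<epsilon>" using m by linarith+
      then show ?thesis using N by (simp add: pos_le_divide_eq pos_divide_le_eq mult.commute)
    qed
    ultimately show "i \<in> (\<Union>m\<in>{-1, 0, 1}. ?I m)" by blast
  qed
  have "card (window N x \<epsilon>) \<le> card (\<Union>m\<in>{-1, 0, 1}. ?I m)"
    using sub by (intro card_mono finite_UN_I finite_int_interval) simp_all
  also have "\<dots> \<le> (\<Sum>m\<in>{-1, 0, 1}. card (?I m))" by (rule card_UN_le) simp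
  finally have "real (card (window N x \<epsilon>)) \<le> (\<Sum>m\<in>{-1, 0, 1}. real (card (?I m)))"
    by (simp only: of_nat_sum[symmetric] of_nat_le_iff)
  also have "\<dots> \<le> (\<Sum>m\<in>{-1, 0, 1::int}. 2 * real N * \<epsilon> + 1)"
  proof (rule sum_mono)
    fix m :: int
    have "real (card (?I m)) \<le> real N * (x + of_int m + \<epsilon>) - real N * (x + of_int m - \<epsilon>) + 1"
      by (rule card_int_interval_le) (use \<epsilon> in \<open>auto intro!: mult_left_mono\<close>)
    then show "real (card (?I m)) \<le> 2 * real N * \<epsilon> + 1" by (simp add: algebra_simps)
  qed
  finally show ?thesis by simp
qed

lemma window_avg_indicator:
  "window_avg N x \<epsilon> a = 1 / (2 * real N * \<epsilon>) * (\<Sum>i\<in>{1..int N}. a i * indicator {x. torus_dist (real_of_int i / real N) x \<le> \<epsilon>} x)"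
proof -
  have "(\<Sum>i\<in>window N x \<epsilon>. a i) = (\<Sum>i\<in>{1..int N}. if torus_dist (real_of_int i / real N) x \<le> \<epsilon> then a i else 0)"
    unfolding window_def by (rule sum.inter_filter) simp
  also have "\<dots> = (\<Sum>i\<in>{1..int N}. a i * indicator {x. torus_dist (real_of_int i / real N) x \<le> \<epsilon>} x)"
    by (intro sum.cong) (auto simp: indicator_def)
  finally show ?thesis by (simp only: window_avg_def)
qed

lemma window_avg_measurable [measurable]: "(\<lambda>x. window_avg N x \<epsilon> a) \<in> borel_measurable borel"
  unfolding window_avg_indicator by measurable

lemma abs_window_avg_le:
  assumes a: "\<And>i. i \<in> {1..int N} \<Longrightarrow> \<bar>a i\<bar> \<le> C" and N: "1 \<le> N" and x: "0 \<le> x" "x \<le> 1" and \<epsilon>: "0 < \<epsilon>" "\<epsilon> < 1 / 2"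
  shows "\<bar>window_avg N x \<epsilon> a\<bar> \<le> 3 * C * (1 + 1 / (2 * real N * \<epsilon>))"
proof -
  have C: "0 \<le> C" using a[of 1] N by fastforce
  have "\<bar>\<Sum>i\<in>window N x \<epsilon>. a i\<bar> \<le> (\<Sum>i\<in>window N x \<epsilon>. \<bar>a i\<bar>)" by (rule sum_abs)
  also have "\<dots> \<le> real (card (window N x \<epsilon>)) * C"
    by (rule sum_bounded_above) (auto simp: window_def intro: a)
  also have "\<dots> \<le> 3 * (2 * real N * \<epsilon> + 1) * C" using C card_window_le[OF N x \<epsilon>] by (rule mult_right_mono[rotated])
  finally have "1 / (2 * real N * \<epsilon>) * \<bar>\<Sum>i\<in>window N x \<epsilon>. a i\<bar> \<le> 1 / (2 * real N * \<epsilon>) * (3 * (2 * real N * \<epsilon> + 1) * C)"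
    using \<epsilon> by (intro mult_left_mono) auto
  then show ?thesis using N \<epsilon> by (simp add: window_avg_def abs_mult field_simps)
qed

abbreviation unit_lborel :: "real measure" where
  "unit_lborel \<equiv> restrict_space lborel {0..1}"

lemma prob_space_unit_lborel: "prob_space unit_lborel"
  by (rule prob_spaceI) (simp add: emeasure_restrict_space)

lemma unit_measurable: "f \<in> borel_measurable borel \<Longrightarrow> f \<in> borel_measurable unit_lborel"
  by (rule measurable_restrict_space1) simp

lemma unit_integral: "continuous_on UNIV f \<Longrightarrow> (\<integral>x. f x \<partial>unit_lborel) = integral {0..1} f" for f :: "real \<Rightarrow> real"
proof -
  assume f: "continuous_on UNIV f"
  have "set_integrable lborel {0..1} f"
    by (rule borel_integrable_atLeastAtMost') (rule continuous_on_subset[OF f], simp)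
  then have "(LINT x:{0..1}|lborel. f x) = integral {0..1} f" by (rule set_borel_integral_eq_integral(2))
  then show ?thesis by (simp add: integral_restrict_space set_lebesgue_integral_def)
qed

lemma continuous_bounded_unit:
  fixes f :: "real \<Rightarrow> real"
  assumes "continuous_on UNIV f" shows "\<exists>B. \<forall>x\<in>{0..1}. \<bar>f x\<bar> \<le> B"
proof -
  have "bounded (f ` {0..1})"
    by (intro compact_imp_bounded compact_continuous_image continuous_on_subset[OF assms]) auto
  then show ?thesis unfolding bounded_iff by auto
qed

text \<open>
  After exchanging sum and integral, \<open>a i\<close> is weighted by the mean of \<open>\<psi>\<close> over the ball of radius
  \<open>\<epsilon>\<close> around \<open>i/N\<close>, and that mean differs from \<open>\<psi> (i/N)\<close> by at most \<open>\<omega>\<close>.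
\<close>

lemma riemann_sum_window_avg:
  fixes a :: "int \<Rightarrow> real" and \<psi> :: "real \<Rightarrow> real"
  assumes a: "\<And>i. i \<in> {1..int N} \<Longrightarrow> \<bar>a i\<bar> \<le> C" and N: "1 \<le> N" and \<epsilon>: "0 < \<epsilon>" "\<epsilon> < 1 / 2"
    and \<psi>: "continuous_on UNIV \<psi>" and osc: "\<And>x y. torus_dist y x \<le> \<epsilon> \<Longrightarrow> \<bar>\<psi> x - \<psi> y\<bar> \<le> \<omega>"
  shows "\<bar>1 / real N * (\<Sum>i\<in>{1..int N}. \<psi> (of_int i / real N) * a i)
    - (\<integral>x. \<psi> x * window_avg N x \<epsilon> a \<partial>unit_lborel)\<bar> \<le> C * \<omega>"
proof -
  interpret U: prob_space unit_lborel by (rule prob_space_unit_lborel)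
  let ?B = "\<lambda>i. {x. torus_dist (real_of_int i / real N) x \<le> \<epsilon>}"
  have [measurable]: "?B i \<in> sets borel" for i by measurable
  have \<psi>m: "\<psi> \<in> borel_measurable borel" using \<psi> by (rule borel_measurable_continuous_onI)
  note [measurable] = unit_measurable[OF \<psi>m]
  have indm [measurable]: "(indicator (?B i) :: real \<Rightarrow> real) \<in> borel_measurable unit_lborel" for i
    by (rule unit_measurable) measurable
  obtain \<Psi> where \<Psi>: "\<And>x. x \<in> {0..1} \<Longrightarrow> \<bar>\<psi> x\<bar> \<le> \<Psi>" using continuous_bounded_unit[OF \<psi>] by blast
  have int: "integrable unit_lborel (\<lambda>x. \<psi> x * indicator (?B i) x)" for i
  proof (rule U.integrable_const_bound[where B=\<Psi>])
    show "AE x in unit_lborel. norm (\<psi> x * indicator (?B i) x) \<le> \<Psi>"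
      using \<Psi> by (intro AE_I2) (force simp: indicator_def space_restrict_space)
  qed measurable
  have ind: "(\<integral>x. indicator (?B i) x \<partial>unit_lborel) = 2 * \<epsilon>" if i: "i \<in> {1..int N}" for i
  proof -
    have "(\<integral>x. indicator (?B i) x \<partial>unit_lborel) = measure unit_lborel ({0..1} \<inter> ?B i)"
      by (simp add: space_restrict_space Int_commute)
    also have "\<dots> = measure lborel ({0..1} \<inter> ?B i)"
      by (rule measure_restrict_space) auto
    also have "{0..1} \<inter> ?B i = {x \<in> {0..1}. torus_dist (real_of_int i / real N) x \<le> \<epsilon>}" by auto
    also have "measure lborel \<dots> = 2 * \<epsilon>"
      using i N by (intro torus_ball_length \<epsilon>) (auto simp: divide_le_eq)
    finally show ?thesis .
  qed
  have loc: "\<bar>(\<integral>x. \<psi> x * indicator (?B i) x \<partial>unit_lborel) - 2 * \<epsilon> * \<psi> (of_int i / real N)\<bar> \<le> 2 * \<epsilon> * \<omega>"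
    if i: "i \<in> {1..int N}" for i
  proof -
    let ?y = "of_int i / real N :: real"
    have indi: "integrable unit_lborel (\<lambda>x. c * indicator (?B i) x :: real)" for c
    proof (rule U.integrable_const_bound[where B="\<bar>c\<bar>"])
      show "AE x in unit_lborel. norm (c * indicator (?B i) x) \<le> \<bar>c\<bar>" by (auto simp: indicator_def)
    qed measurable
    have "\<bar>(\<integral>x. \<psi> x * indicator (?B i) x \<partial>unit_lborel) - 2 * \<epsilon> * \<psi> ?y\<bar>
       = \<bar>\<integral>x. \<psi> x * indicator (?B i) x - \<psi> ?y * indicator (?B i) x \<partial>unit_lborel\<bar>"
      using ind[OF i] by (subst Bochner_Integration.integral_diff[OF int indi]) (simp add: mult_ac)
    also have "\<dots> \<le> (\<integral>x. \<bar>\<psi> x * indicator (?B i) x - \<psi> ?y * indicator (?B i) x\<bar> \<partial>unit_lborel)"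
      by (rule integral_abs_bound)
    also have "\<dots> \<le> (\<integral>x. \<omega> * indicator (?B i) x \<partial>unit_lborel)"
    proof (rule integral_mono)
      show "integrable unit_lborel (\<lambda>x. \<bar>\<psi> x * indicator (?B i) x - \<psi> ?y * indicator (?B i) x\<bar>)"
        by (intro integrable_abs Bochner_Integration.integrable_diff int indi)
      show "\<bar>\<psi> x * indicator (?B i) x - \<psi> ?y * indicator (?B i) x\<bar> \<le> \<omega> * indicator (?B i) x" for x
        using osc[of ?y x] by (auto simp: indicator_def)
    qed (rule indi)
    also have "\<dots> = 2 * \<epsilon> * \<omega>" using ind[OF i] by simp
    finally show ?thesis .
  qed
  have "(\<integral>x. \<psi> x * window_avg N x \<epsilon> a \<partial>unit_lborel)
     = (\<integral>x. (\<Sum>i\<in>{1..int N}. a i / (2 * real N * \<epsilon>) * (\<psi> x * indicator (?B i) x)) \<partial>unit_lborel)"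
    unfolding window_avg_indicator sum_distrib_left by (intro Bochner_Integration.integral_cong refl sum.cong) (auto simp: field_simps)
  also have "\<dots> = (\<Sum>i\<in>{1..int N}. a i / (2 * real N * \<epsilon>) * (\<integral>x. \<psi> x * indicator (?B i) x \<partial>unit_lborel))"
    by (subst Bochner_Integration.integral_sum, intro integrable_mult_right int)
      (simp only: integral_mult_right_zero)
  finally have "\<bar>1 / real N * (\<Sum>i\<in>{1..int N}. \<psi> (of_int i / real N) * a i)
    - (\<integral>x. \<psi> x * window_avg N x \<epsilon> a \<partial>unit_lborel)\<bar>
    = \<bar>\<Sum>i\<in>{1..int N}. a i / (2 * real N * \<epsilon>) * (2 * \<epsilon> * \<psi> (of_int i / real N) - (\<integral>x. \<psi> x * indicator (?B i) x \<partial>unit_lborel))\<bar>"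
    using \<epsilon> by (simp add: sum_distrib_left right_diff_distrib sum_subtractf mult_ac)
  also have "\<dots> \<le> (\<Sum>i\<in>{1..int N}. C / (2 * real N * \<epsilon>) * (2 * \<epsilon> * \<omega>))"
  proof (rule order_trans[OF sum_abs sum_mono])
    fix i assume i: "i \<in> {1..int N}"
    have "\<bar>a i / (2 * real N * \<epsilon>)\<bar> \<le> C / (2 * real N * \<epsilon>)"
      using a[OF i] \<epsilon> by (simp add: abs_divide divide_right_mono)
    moreover have "0 \<le> C / (2 * real N * \<epsilon>)" using a[OF i] \<epsilon> by (intro divide_nonneg_nonneg) auto
    ultimately show "\<bar>a i / (2 * real N * \<epsilon>) * (2 * \<epsilon> * \<psi> (of_int i / real N) - (\<integral>x. \<psi> x * indicator (?B i) x \<partial>unit_lborel))\<bar>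
      \<le> C / (2 * real N * \<epsilon>) * (2 * \<epsilon> * \<omega>)"
      unfolding abs_mult using loc[OF i] by (intro mult_mono) (auto simp: abs_minus_commute)
  qed
  also have "\<dots> = C * \<omega>" using N \<epsilon> by (simp add: field_simps)
  finally show ?thesis .
qed

text \<open>
  The window averages converge pointwise in \<open>x\<close> only, for \<open>\<epsilon>\<close> small depending on \<open>x\<close>.  Their errors are
  integrated over \<open>x\<close> in two steps: Fatou's lemma for the upper limit as \<open>N\<close> tends to infinity with
  \<open>\<epsilon>\<close> fixed, then dominated convergence along a sequence of radii \<open>\<epsilon>\<close> tending to \<open>0\<close>.  The bound \<open>C\<close>
  makes the window averages bounded, uniformly in \<open>\<epsilon>\<close> once \<open>N \<ge> 1/\<epsilon>\<close>.
\<close>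

lemma mesoscopic_average:
  fixes a :: "nat \<Rightarrow> int \<Rightarrow> real" and v \<psi> :: "real \<Rightarrow> real"
  assumes a: "\<And>N i. 1 \<le> N \<Longrightarrow> i \<in> {1..int N} \<Longrightarrow> \<bar>a N i\<bar> \<le> C"
    and v: "continuous_on UNIV v"
    and conv: "\<And>x \<eta>. 0 < \<eta> \<Longrightarrow>
      \<forall>\<^sub>F \<epsilon> in at_right 0. \<forall>\<^sub>F N in sequentially. \<bar>window_avg N x \<epsilon> (a N) - v x\<bar> < \<eta>"
    and \<psi>: "continuous_on UNIV \<psi>" and osc: "\<And>\<eta>. 0 < \<eta> \<Longrightarrow> \<exists>\<delta>>0. \<forall>x y. torus_dist y x \<le> \<delta> \<longrightarrow> \<bar>\<psi> x - \<psi> y\<bar> \<le> \<eta>"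
  shows "(\<lambda>N. 1 / real N * (\<Sum>i\<in>{1..int N}. \<psi> (of_int i / real N) * a N i)) \<longlonglongrightarrow> integral {0..1} (\<lambda>x. \<psi> x * v x)"
proof -
  interpret U: prob_space unit_lborel by (rule prob_space_unit_lborel)
  note [measurable] = unit_measurable[OF borel_measurable_continuous_onI[OF \<psi>]] unit_measurable[OF borel_measurable_continuous_onI[OF v]]
    unit_measurable[OF window_avg_measurable]
  have unit_mass: "emeasure unit_lborel {0..1} = 1" by (simp add: emeasure_restrict_space)
  have C: "0 \<le> C" using a[of 1 1] by fastforce
  obtain V where V: "\<And>x. x \<in> {0..1} \<Longrightarrow> \<bar>v x\<bar> \<le> V" using continuous_bounded_unit[OF v] by blast
  obtain \<Psi> where \<Psi>: "\<And>x. x \<in> {0..1} \<Longrightarrow> \<bar>\<psi> x\<bar> \<le> \<Psi>" using continuous_bounded_unit[OF \<psi>] by blast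
  have V0: "0 \<le> V" "0 \<le> \<Psi>" using V[of 0] \<Psi>[of 0] by auto
  have Ispace: "x \<in> {0..1}" if "x \<in> space unit_lborel" for x using that by (simp add: space_restrict_space)
  define D where "D N \<epsilon> x = ennreal \<bar>window_avg N x \<epsilon> (a N) - v x\<bar>" for N \<epsilon> x
  have [measurable]: "D N \<epsilon> \<in> borel_measurable unit_lborel" for N \<epsilon> unfolding D_def by measurable
  \<comment> \<open>Radii below \<open>1/2\<close>, so that no window covers the whole torus.\<close>
  define \<epsilon>s where "\<epsilon>s k = 1 / real (k + 3)" for k
  have \<epsilon>s: "0 < \<epsilon>s k" "\<epsilon>s k < 1 / 2" for k by (auto simp: \<epsilon>s_def field_simps)
  have \<epsilon>s0: "\<epsilon>s \<longlonglongrightarrow> 0" unfolding \<epsilon>s_def by (rule LIMSEQ_ignore_initial_segment[OF lim_1_over_n])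
  have \<epsilon>sr: "filterlim \<epsilon>s (at_right 0) sequentially"
    using \<epsilon>s0 \<epsilon>s(1) less_imp_neq[OF \<epsilon>s(1)] by (auto simp: filterlim_at intro!: always_eventually)
  have bnd: "\<bar>window_avg N x (\<epsilon>s k) (a N)\<bar> \<le> 3 * C * (1 + 1 / (2 * real N * \<epsilon>s k))" if "x \<in> {0..1}" for N x k
  proof (cases "N = 0")
    case True
    then show ?thesis using C by (simp add: window_avg_def)
  next
    case False
    then show ?thesis using that a[of N] \<epsilon>s by (intro abs_window_avg_le) auto
  qed
  define G where "G k x = limsup (\<lambda>N. D N (\<epsilon>s k) x)" for k x
  have [measurable]: "G k \<in> borel_measurable unit_lborel" for k unfolding G_def by measurable
  have limsup_int: "limsup (\<lambda>N. \<integral>\<^sup>+x. D N (\<epsilon>s k) x \<partial>unit_lborel) \<le> (\<integral>\<^sup>+x. G k x \<partial>unit_lborel)" for k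
    unfolding G_def
  proof (rule nn_integral_limsup[where w="\<lambda>_. ennreal (3 * C * (1 + 1 / (2 * \<epsilon>s k)) + V)"])
    show "AE x in unit_lborel. D N (\<epsilon>s k) x \<le> ennreal (3 * C * (1 + 1 / (2 * \<epsilon>s k)) + V)" for N
    proof (intro AE_I2)
      fix x assume "x \<in> space unit_lborel"
      then have x: "x \<in> {0..1}" by (rule Ispace)
      have "3 * C * (1 + 1 / (2 * real N * \<epsilon>s k)) \<le> 3 * C * (1 + 1 / (2 * \<epsilon>s k))"
      proof (cases "N = 0")
        case False
        then have "1 / (2 * real N * \<epsilon>s k) \<le> 1 / (2 * \<epsilon>s k)" using \<epsilon>s(1)[of k] by (simp add: field_simps)
        then show ?thesis using C by (intro mult_left_mono) auto
      qed (use mult_left_mono[of 1 "1 + 1 / (2 * \<epsilon>s k)" C] C \<epsilon>s(1)[of k] in simp)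
      then have "\<bar>window_avg N x (\<epsilon>s k) (a N)\<bar> \<le> 3 * C * (1 + 1 / (2 * \<epsilon>s k))"
        using bnd[OF x, of N k] by linarith
      then show "D N (\<epsilon>s k) x \<le> ennreal (3 * C * (1 + 1 / (2 * \<epsilon>s k)) + V)"
        unfolding D_def using V[OF x] by (intro ennreal_leI) linarith
    qed
    show "(\<integral>\<^sup>+x. ennreal (3 * C * (1 + 1 / (2 * \<epsilon>s k)) + V) \<partial>unit_lborel) < \<infinity>"
      by (simp add: unit_mass ennreal_mult_less_top)
  qed measurable
  have G_bound: "G k x \<le> ennreal (6 * C + V)" if x: "x \<in> {0..1}" for k x
    unfolding G_def
  proof (rule Limsup_bounded)
    obtain N0 :: nat where N0: "1 / \<epsilon>s k \<le> real N0" using real_arch_simple by blast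
    show "\<forall>\<^sub>F N in sequentially. D N (\<epsilon>s k) x \<le> ennreal (6 * C + V)"
    proof (rule eventually_sequentiallyI[of "max 1 N0"])
      fix N assume N: "max 1 N0 \<le> N"
      then have "1 / \<epsilon>s k \<le> real N" using N0 by linarith
      then have "1 / (2 * real N * \<epsilon>s k) \<le> 1" using \<epsilon>s(1)[of k] N by (simp add: field_simps)
      then have "3 * C * (1 + 1 / (2 * real N * \<epsilon>s k)) \<le> 3 * C * 2" using C by (intro mult_left_mono) auto
      then show "D N (\<epsilon>s k) x \<le> ennreal (6 * C + V)"
        unfolding D_def using bnd[OF x, of N k] V[OF x] by (intro ennreal_leI) linarith
    qed
  qed
  have G_lim: "(\<lambda>k. G k x) \<longlonglongrightarrow> 0" for x
  proof (rule order_tendstoI)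
    fix e :: ennreal assume "0 < e"
    then obtain z where z: "0 < z" "z < e" using dense by blast
    then obtain \<eta> where \<eta>: "0 < ennreal \<eta>" "ennreal \<eta> < e" by (cases z) auto
    then have \<eta>0: "0 < \<eta>" by simp
    have "\<forall>\<^sub>F k in sequentially. \<forall>\<^sub>F N in sequentially. \<bar>window_avg N x (\<epsilon>s k) (a N) - v x\<bar> < \<eta>"
      using conv[OF \<eta>0, of x] \<epsilon>sr unfolding filterlim_iff by blast
    then show "\<forall>\<^sub>F k in sequentially. G k x < e"
    proof eventually_elim
      case (elim k)
      have "G k x \<le> ennreal \<eta>" unfolding G_def
      proof (rule Limsup_bounded)
        show "\<forall>\<^sub>F N in sequentially. D N (\<epsilon>s k) x \<le> ennreal \<eta>"
          using elim by eventually_elim (simp add: D_def ennreal_leI)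
      qed
      then show ?case using \<eta> by simp
    qed
  qed auto
  have "(\<lambda>k. \<integral>\<^sup>+x. G k x \<partial>unit_lborel) \<longlonglongrightarrow> (\<integral>\<^sup>+x. 0 \<partial>unit_lborel)"
  proof (rule nn_integral_dominated_convergence[where w="\<lambda>_. ennreal (6 * C + V)"])
    show "AE x in unit_lborel. G k x \<le> ennreal (6 * C + V)" for k
      using G_bound Ispace by (intro AE_I2) blast
    show "(\<integral>\<^sup>+x. ennreal (6 * C + V) \<partial>unit_lborel) < \<infinity>" by (simp add: unit_mass ennreal_mult_less_top)
    show "AE x in unit_lborel. (\<lambda>k. G k x) \<longlonglongrightarrow> 0" using G_lim by simp
  qed measurable
  then have G_int: "(\<lambda>k. \<integral>\<^sup>+x. G k x \<partial>unit_lborel) \<longlonglongrightarrow> 0" by simp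
  have intv: "(\<integral>x. \<psi> x * v x \<partial>unit_lborel) = integral {0..1} (\<lambda>x. \<psi> x * v x)"
    by (intro unit_integral continuous_on_mult \<psi> v)
  show ?thesis
  proof (rule LIMSEQ_I)
    fix r :: real assume r: "0 < r"
    define \<eta> where "\<eta> = r / (2 * (C + \<Psi> + 1))"
    have \<eta>: "0 < \<eta>" unfolding \<eta>_def using r C V0 by simp
    have small: "(C + \<Psi>) * \<eta> < r"
    proof -
      have "(C + \<Psi>) * \<eta> \<le> (C + \<Psi> + 1) * \<eta>" using \<eta> by (simp add: distrib_right)
      also have "\<dots> = r / 2" unfolding \<eta>_def using C V0 by (simp add: field_simps)
      finally show ?thesis using r by linarith
    qed
    from osc[OF \<eta>] obtain \<delta> where \<delta>: "0 < \<delta>" "\<And>x y. torus_dist y x \<le> \<delta> \<Longrightarrow> \<bar>\<psi> x - \<psi> y\<bar> \<le> \<eta>" by blast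
    have "\<forall>\<^sub>F k in sequentially. (\<integral>\<^sup>+x. G k x \<partial>unit_lborel) < ennreal \<eta> \<and> \<epsilon>s k < \<delta>"
    proof (rule eventually_conj)
      show "\<forall>\<^sub>F k in sequentially. (\<integral>\<^sup>+x. G k x \<partial>unit_lborel) < ennreal \<eta>"
        by (rule order_tendstoD(2)[OF G_int]) (use \<eta> in simp)
      show "\<forall>\<^sub>F k in sequentially. \<epsilon>s k < \<delta>" by (rule order_tendstoD(2)[OF \<epsilon>s0 \<delta>(1)])
    qed
    from eventually_happens'[OF sequentially_bot this]
    obtain k where k: "(\<integral>\<^sup>+x. G k x \<partial>unit_lborel) < ennreal \<eta>" "\<epsilon>s k < \<delta>" by blast
    have "limsup (\<lambda>N. \<integral>\<^sup>+x. D N (\<epsilon>s k) x \<partial>unit_lborel) < ennreal \<eta>"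
      using limsup_int[of k] k(1) by (rule le_less_trans)
    then have "\<forall>\<^sub>F N in sequentially. (\<integral>\<^sup>+x. D N (\<epsilon>s k) x \<partial>unit_lborel) < ennreal \<eta>"
      by (rule Limsup_lessD)
    then obtain N0 where N0: "\<And>N. N0 \<le> N \<Longrightarrow> (\<integral>\<^sup>+x. D N (\<epsilon>s k) x \<partial>unit_lborel) < ennreal \<eta>"
      unfolding eventually_sequentially by blast
    show "\<exists>no. \<forall>N\<ge>no. norm (1 / real N * (\<Sum>i\<in>{1..int N}. \<psi> (of_int i / real N) * a N i)
        - integral {0..1} (\<lambda>x. \<psi> x * v x)) < r"
    proof (intro exI allI impI)
      fix N assume "max 1 N0 \<le> N"
      then have N: "1 \<le> N" "N0 \<le> N" by auto
      let ?A = "\<lambda>x. window_avg N x (\<epsilon>s k) (a N)"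
      have first: "\<bar>1 / real N * (\<Sum>i\<in>{1..int N}. \<psi> (of_int i / real N) * a N i) - (\<integral>x. \<psi> x * ?A x \<partial>unit_lborel)\<bar> \<le> C * \<eta>"
      proof (rule riemann_sum_window_avg[OF a[OF N(1)] N(1) \<epsilon>s \<psi>])
        show "\<bar>\<psi> x - \<psi> y\<bar> \<le> \<eta>" if "torus_dist y x \<le> \<epsilon>s k" for x y
          using that k(2) by (intro \<delta>(2)) simp
      qed
      define R where "R = 3 * C * (1 + 1 / (2 * real N * \<epsilon>s k))"
      have R: "\<bar>?A x\<bar> \<le> R" if "x \<in> {0..1}" for x using bnd[OF that] unfolding R_def .
      have iA: "integrable unit_lborel (\<lambda>x. \<psi> x * ?A x)"
      proof (rule U.integrable_const_bound[where B="\<Psi> * R"])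
        show "AE x in unit_lborel. norm (\<psi> x * ?A x) \<le> \<Psi> * R"
          using \<Psi> R Ispace V0 by (intro AE_I2) (auto simp: abs_mult intro!: mult_mono)
      qed measurable
      have iv: "integrable unit_lborel (\<lambda>x. \<psi> x * v x)"
      proof (rule U.integrable_const_bound[where B="\<Psi> * V"])
        show "AE x in unit_lborel. norm (\<psi> x * v x) \<le> \<Psi> * V"
          using \<Psi> V Ispace V0 by (intro AE_I2) (auto simp: abs_mult intro!: mult_mono)
      qed measurable
      have iD: "integrable unit_lborel (\<lambda>x. \<bar>?A x - v x\<bar>)"
      proof (rule U.integrable_const_bound[where B="R + V"])
        show "AE x in unit_lborel. norm \<bar>?A x - v x\<bar> \<le> R + V"
          using R V Ispace by (intro AE_I2) (smt (verit) real_norm_def abs_abs)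
      qed measurable
      have "\<bar>(\<integral>x. \<psi> x * ?A x \<partial>unit_lborel) - (\<integral>x. \<psi> x * v x \<partial>unit_lborel)\<bar>
         = \<bar>\<integral>x. \<psi> x * ?A x - \<psi> x * v x \<partial>unit_lborel\<bar>"
        by (simp only: Bochner_Integration.integral_diff[OF iA iv])
      also have "\<dots> \<le> (\<integral>x. \<bar>\<psi> x * ?A x - \<psi> x * v x\<bar> \<partial>unit_lborel)" by (rule integral_abs_bound)
      also have "\<dots> \<le> (\<integral>x. \<Psi> * \<bar>?A x - v x\<bar> \<partial>unit_lborel)"
      proof (rule integral_mono)
        show "integrable unit_lborel (\<lambda>x. \<bar>\<psi> x * ?A x - \<psi> x * v x\<bar>)"
          by (intro integrable_abs Bochner_Integration.integrable_diff iA iv)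
        show "integrable unit_lborel (\<lambda>x. \<Psi> * \<bar>?A x - v x\<bar>)" using iD by simp
        fix x assume "x \<in> space unit_lborel"
        then show "\<bar>\<psi> x * ?A x - \<psi> x * v x\<bar> \<le> \<Psi> * \<bar>?A x - v x\<bar>"
          unfolding right_diff_distrib[symmetric] abs_mult by (intro mult_right_mono \<Psi> Ispace) auto
      qed
      also have "\<dots> = \<Psi> * (\<integral>x. \<bar>?A x - v x\<bar> \<partial>unit_lborel)" by simp
      also have "\<dots> \<le> \<Psi> * \<eta>"
      proof (rule mult_left_mono[OF _ V0(2)])
        have "ennreal (\<integral>x. \<bar>?A x - v x\<bar> \<partial>unit_lborel) = (\<integral>\<^sup>+x. D N (\<epsilon>s k) x \<partial>unit_lborel)"
          unfolding D_def by (rule nn_integral_eq_integral[symmetric, OF iD]) simp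
        also have "\<dots> < ennreal \<eta>" by (rule N0[OF N(2)])
        finally show "(\<integral>x. \<bar>?A x - v x\<bar> \<partial>unit_lborel) \<le> \<eta>" using \<eta> by (simp add: ennreal_less_iff)
      qed
      finally have "\<bar>(\<integral>x. \<psi> x * ?A x \<partial>unit_lborel) - integral {0..1} (\<lambda>x. \<psi> x * v x)\<bar> \<le> \<Psi> * \<eta>"
        unfolding intv .
      then show "norm (1 / real N * (\<Sum>i\<in>{1..int N}. \<psi> (of_int i / real N) * a N i)
        - integral {0..1} (\<lambda>x. \<psi> x * v x)) < r"
        using first small unfolding distrib_right real_norm_def by linarith
    qed
  qed
qed

section \<open>Test functions and expectations\<close>

lemma iterated_limit_less:
  fixes f :: "real \<Rightarrow> nat \<Rightarrow> 'b :: order_topology"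
  assumes "iterated_limit f l" "l < c"
  shows "\<forall>\<^sub>F \<epsilon> in at_right 0. \<forall>\<^sub>F N in sequentially. f \<epsilon> N < c"
proof -
  from assms(1) obtain g where g: "\<forall>\<^sub>F \<epsilon> in at_right 0. f \<epsilon> \<longlonglongrightarrow> g \<epsilon>" "(g \<longlongrightarrow> l) (at_right 0)"
    unfolding iterated_limit_def by blast
  from g(1) order_tendstoD(2)[OF g(2) assms(2)] show ?thesis
    by eventually_elim (rule order_tendstoD(2))
qed

lemma periodic_one_int:
  fixes f :: "real \<Rightarrow> real"
  assumes per: "\<And>x. f (x + 1) = f x"
  shows "f (x + of_int m) = f x"
proof (induction m rule: int_induct[of _ 0])
  case (step1 m)
  then show ?case using per[of "x + of_int m"] by (simp add: add.assoc)
next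
  case (step2 m)
  then show ?case using per[of "x + of_int (m - 1)"] by (simp add: add.assoc)
qed simp

lemma periodic_bounded:
  fixes f :: "real \<Rightarrow> real"
  assumes per: "\<And>x. f (x + 1) = f x" and cont: "continuous_on UNIV f"
  shows "\<exists>B. \<forall>x. \<bar>f x\<bar> \<le> B"
proof -
  obtain B where B: "\<And>x. x \<in> {0..1} \<Longrightarrow> \<bar>f x\<bar> \<le> B" using continuous_bounded_unit[OF cont] by blast
  have "\<bar>f x\<bar> \<le> B" for x
  proof -
    have "f x = f (frac x)" using periodic_one_int[of f "frac x" "\<lfloor>x\<rfloor>", OF per] by (simp add: frac_def)
    then show ?thesis using B[of "frac x"] frac_ge_0[of x] frac_lt_1[of x] by simp
  qed
  then show ?thesis by blast
qed

lemma periodic_uniformly_continuous: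
  fixes f :: "real \<Rightarrow> real"
  assumes per: "\<And>x. f (x + 1) = f x" and cont: "continuous_on UNIV f" and \<eta>: "0 < \<eta>"
  shows "\<exists>\<delta>>0. \<forall>x y. \<bar>x - y\<bar> \<le> \<delta> \<longrightarrow> \<bar>f x - f y\<bar> \<le> \<eta>"
proof -
  have "uniformly_continuous_on {-1..2} f"
    by (intro compact_uniformly_continuous continuous_on_subset[OF cont]) auto
  then obtain d where d: "0 < d" "\<And>x y. x \<in> {-1..2} \<Longrightarrow> y \<in> {-1..2} \<Longrightarrow> dist y x < d \<Longrightarrow> dist (f y) (f x) < \<eta>"
    using \<eta> unfolding uniformly_continuous_on_def by metis
  have "\<bar>f x - f y\<bar> \<le> \<eta>" if xy: "\<bar>x - y\<bar> \<le> min (d / 2) 1" for x y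
  proof -
    let ?m = "of_int \<lfloor>x\<rfloor> :: real"
    have "x - ?m \<in> {-1..2}" "y - ?m \<in> {-1..2}"
      using xy by (auto simp: abs_le_iff) linarith+
    moreover have "dist (x - ?m) (y - ?m) < d" using xy d(1) by (simp add: dist_real_def abs_le_iff)
    ultimately have "dist (f (x - ?m)) (f (y - ?m)) < \<eta>" using d(2)[of "y - ?m" "x - ?m"] by blast
    moreover have "f (z - ?m) = f z" for z
      using periodic_one_int[of f "z - ?m" "\<lfloor>x\<rfloor>", OF per] by simp
    ultimately show ?thesis by (simp add: dist_real_def)
  qed
  then show ?thesis using d(1) by (intro exI[of _ "min (d / 2) 1"]) auto
qed

lemma periodic_torus_continuous:
  fixes f :: "real \<Rightarrow> real"
  assumes per: "\<And>x. f (x + 1) = f x" and cont: "continuous_on UNIV f" and \<eta>: "0 < \<eta>"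
  shows "\<exists>\<delta>>0. \<forall>x y. torus_dist y x \<le> \<delta> \<longrightarrow> \<bar>f x - f y\<bar> \<le> \<eta>"
proof -
  obtain \<delta> where \<delta>: "0 < \<delta>" "\<And>x y. \<bar>x - y\<bar> \<le> \<delta> \<Longrightarrow> \<bar>f x - f y\<bar> \<le> \<eta>"
    using periodic_uniformly_continuous[OF per cont \<eta>] by blast
  have "\<bar>f x - f y\<bar> \<le> \<eta>" if "torus_dist y x \<le> min \<delta> (1 / 4)" for x y
  proof -
    have "\<exists>m::int. \<bar>y - x - of_int m\<bar> \<le> min \<delta> (1 / 4)"
      using that torus_dist_le_iff[of "min \<delta> (1 / 4)" y x] \<delta>(1) by auto
    then obtain m :: int where "\<bar>y - x - of_int m\<bar> \<le> min \<delta> (1 / 4)" by blast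
    then have "\<bar>(x + of_int m) - y\<bar> \<le> \<delta>" by linarith
    from \<delta>(2)[OF this] show ?thesis using periodic_one_int[of f x m, OF per] by simp
  qed
  then show ?thesis using \<delta>(1) by (intro exI[of _ "min \<delta> (1 / 4)"]) auto
qed

lemma deriv_periodic:
  fixes f :: "real \<Rightarrow> real"
  assumes per: "\<And>x. f (x + 1) = f x" shows "deriv f (x + 1) = deriv f x"
proof -
  have "(f has_field_derivative D) (at (x + 1)) \<longleftrightarrow> (f has_field_derivative D) (at x)" for D
    using DERIV_shift[of f D x 1] per by simp
  then show ?thesis unfolding deriv_def by simp
qed

lemma funpow_deriv_periodic:
  fixes f :: "real \<Rightarrow> real"
  assumes per: "\<And>x. f (x + 1) = f x" shows "(deriv ^^ k) f (x + 1) = (deriv ^^ k) f x"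
proof (induction k arbitrary: x)
  case (Suc k)
  then show ?case by (simp add: deriv_periodic)
qed (simp add: per)

text \<open>
  Taylor's formula at the four displaced points: all terms below the fourth order cancel, and the remainders
  carry the weights \<open>16/24\<close>, \<open>-4/24\<close>, \<open>-4/24\<close>, \<open>16/24\<close>, whose sum is \<open>1\<close> and whose absolute values add
  up to less than \<open>2\<close>.
\<close>

lemma fourth_difference_taylor:
  fixes \<psi> :: "real \<Rightarrow> real"
  assumes diff: "\<And>k x. k < 4 \<Longrightarrow> (deriv ^^ k) \<psi> differentiable (at x)" and e: "0 < e"
    and near: "\<And>s. \<bar>s - x\<bar> \<le> 2 * e \<Longrightarrow> \<bar>(deriv ^^ 4) \<psi> s - c\<bar> \<le> \<eta>"
  shows "\<bar>(\<psi> (x + 2 * e) - 4 * \<psi> (x + e) + 6 * \<psi> x - 4 * \<psi> (x - e) + \<psi> (x - 2 * e)) / e ^ 4 - c\<bar> \<le> 2 * \<eta>"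
proof -
  let ?d = "\<lambda>m. (deriv ^^ m) \<psi>"
  have tay: "\<exists>s. \<bar>s - x\<bar> \<le> 2 * e \<and> \<psi> (x + r * e) = \<psi> x + ?d 1 x * (r * e) + ?d 2 x / 2 * (r * e)^2 + ?d 3 x / 6 * (r * e)^3
      + ?d 4 s / 24 * (r * e)^4" if r: "r \<noteq> 0" "\<bar>r\<bar> \<le> 2" for r
  proof -
    have b: "\<bar>r * e\<bar> \<le> 2 * e" using r e by (simp add: abs_mult mult_right_mono)
    have "\<exists>s. (if x + r * e < x then x + r * e < s \<and> s < x else x < s \<and> s < x + r * e) \<and>
      \<psi> (x + r * e) = (\<Sum>m<4. ?d m x / fact m * (x + r * e - x) ^ m) + ?d 4 s / fact 4 * (x + r * e - x) ^ 4"
    proof (rule Taylor[of 4 ?d \<psi> "x - 2 * e" "x + 2 * e"])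
      show "\<forall>m t. m < 4 \<and> x - 2 * e \<le> t \<and> t \<le> x + 2 * e \<longrightarrow> (?d m has_real_derivative ?d (Suc m) t) (at t)"
        using diff by (auto simp: DERIV_deriv_iff_real_differentiable)
    qed (use b r e in \<open>auto simp: abs_le_iff\<close>)
    then obtain s where s: "if x + r * e < x then x + r * e < s \<and> s < x else x < s \<and> s < x + r * e"
      "\<psi> (x + r * e) = (\<Sum>m<4. ?d m x / fact m * (x + r * e - x) ^ m) + ?d 4 s / fact 4 * (x + r * e - x) ^ 4"
      by blast
    have "\<bar>s - x\<bar> \<le> 2 * e" using s(1) b by (auto simp: abs_le_iff split: if_splits)
    moreover have "(\<Sum>m<4. ?d m x / fact m * (x + r * e - x) ^ m)
       = \<psi> x + ?d 1 x * (r * e) + ?d 2 x / 2 * (r * e)^2 + ?d 3 x / 6 * (r * e)^3"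
      by (simp add: eval_nat_numeral fact_numeral)
    ultimately show ?thesis using s(2) by (intro exI[of _ s]) (simp add: fact_numeral)
  qed
  obtain s1 where s1: "\<bar>s1 - x\<bar> \<le> 2 * e" "\<psi> (x + 2 * e) = \<psi> x + ?d 1 x * (2 * e) + ?d 2 x / 2 * (2 * e)^2 + ?d 3 x / 6 * (2 * e)^3 + ?d 4 s1 / 24 * (2 * e)^4"
    using tay[of 2] by auto
  obtain s2 where s2: "\<bar>s2 - x\<bar> \<le> 2 * e" "\<psi> (x + 1 * e) = \<psi> x + ?d 1 x * (1 * e) + ?d 2 x / 2 * (1 * e)^2 + ?d 3 x / 6 * (1 * e)^3 + ?d 4 s2 / 24 * (1 * e)^4"
    using tay[of 1] by auto
  obtain s3 where s3: "\<bar>s3 - x\<bar> \<le> 2 * e" "\<psi> (x + (-1) * e) = \<psi> x + ?d 1 x * ((-1) * e) + ?d 2 x / 2 * ((-1) * e)^2 + ?d 3 x / 6 * ((-1) * e)^3 + ?d 4 s3 / 24 * ((-1) * e)^4"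
    using tay[of "-1"] by auto
  obtain s4 where s4: "\<bar>s4 - x\<bar> \<le> 2 * e" "\<psi> (x + (-2) * e) = \<psi> x + ?d 1 x * ((-2) * e) + ?d 2 x / 2 * ((-2) * e)^2 + ?d 3 x / 6 * ((-2) * e)^3 + ?d 4 s4 / 24 * ((-2) * e)^4"
    using tay[of "-2"] by auto
  let ?T = "\<psi> (x + 2 * e) - 4 * \<psi> (x + e) + 6 * \<psi> x - 4 * \<psi> (x - e) + \<psi> (x - 2 * e)"
  have "?T = \<psi> (x + 2 * e) - 4 * \<psi> (x + 1 * e) + 6 * \<psi> x - 4 * \<psi> (x + (-1) * e) + \<psi> (x + (-2) * e)" by simp
  also have "\<dots> = (16 * ?d 4 s1 - 4 * ?d 4 s2 - 4 * ?d 4 s3 + 16 * ?d 4 s4) / 24 * e ^ 4"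
    unfolding s1(2) s2(2) s3(2) s4(2) by (simp add: algebra_simps power_mult_distrib eval_nat_numeral)
  finally have "?T / e ^ 4 = (16 * ?d 4 s1 - 4 * ?d 4 s2 - 4 * ?d 4 s3 + 16 * ?d 4 s4) / 24" using e by simp
  then have diffc: "?T / e ^ 4 - c = (16 * (?d 4 s1 - c) - 4 * (?d 4 s2 - c) - 4 * (?d 4 s3 - c) + 16 * (?d 4 s4 - c)) / 24"
    by (simp add: field_simps)
  have weighted: "\<bar>(16 * a - 4 * b - 4 * b' + 16 * a') / 24\<bar> \<le> 2 * \<eta>"
    if "\<bar>a\<bar> \<le> \<eta>" "\<bar>b\<bar> \<le> \<eta>" "\<bar>b'\<bar> \<le> \<eta>" "\<bar>a'\<bar> \<le> \<eta>" for a b a' b' :: real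
    using that unfolding abs_le_iff by (simp add: field_simps)
  have "\<bar>(16 * (?d 4 s1 - c) - 4 * (?d 4 s2 - c) - 4 * (?d 4 s3 - c) + 16 * (?d 4 s4 - c)) / 24\<bar> \<le> 2 * \<eta>"
    by (rule weighted) (use near s1(1) s2(1) s3(1) s4(1) in blast)+
  then show ?thesis unfolding diffc .
qed

lemma expectation_window_avg:
  assumes "\<And>i. i \<in> {1..int N} \<Longrightarrow> integrable M (\<lambda>\<omega>. f \<omega> i)"
  shows "(\<integral>\<omega>. window_avg N x \<epsilon> (f \<omega>) \<partial>M) = window_avg N x \<epsilon> (\<lambda>i. \<integral>\<omega>. f \<omega> i \<partial>M)"
    "integrable M (\<lambda>\<omega>. window_avg N x \<epsilon> (f \<omega>))"
proof -
  have int: "integrable M (\<lambda>\<omega>. f \<omega> i)" if "i \<in> window N x \<epsilon>" for i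
    using that assms by (simp add: window_def)
  show "(\<integral>\<omega>. window_avg N x \<epsilon> (f \<omega>) \<partial>M) = window_avg N x \<epsilon> (\<lambda>i. \<integral>\<omega>. f \<omega> i \<partial>M)"
    unfolding window_avg_def integral_mult_right_zero using int by (subst Bochner_Integration.integral_sum) auto
  show "integrable M (\<lambda>\<omega>. window_avg N x \<epsilon> (f \<omega>))"
    unfolding window_avg_def by (intro integrable_mult_right Bochner_Integration.integrable_sum int)
qed

text \<open>
  With \<open>y = \<bar>X - c\<bar>\<close>, the elementary bound \<open>y \<le> \<eta>/2 + y\<^sup>2/(2 \<eta>)\<close> takes the place of the Cauchy-Schwarz
  inequality.
\<close>

lemma (in prob_space) expectation_small:
  fixes X :: "'a \<Rightarrow> real"
  assumes X: "integrable M X" and \<eta>: "0 < \<eta>"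
    and sq: "(\<integral>\<^sup>+\<omega>. ennreal (\<bar>X \<omega> - c\<bar>\<^sup>2) \<partial>M) < ennreal (\<eta>\<^sup>2)"
  shows "\<bar>expectation X - c\<bar> < \<eta>"
proof -
  let ?Z = "\<lambda>\<omega>. (X \<omega> - c)\<^sup>2"
  have meas [measurable]: "X \<in> borel_measurable M" using X by simp
  have iZ: "integrable M ?Z"
    by (rule integrableI_nonneg) (use sq in \<open>auto intro: less_trans\<close>)
  have "ennreal (expectation ?Z) < ennreal (\<eta>\<^sup>2)"
    using sq nn_integral_eq_integral[OF iZ] by simp
  then have Z: "expectation ?Z < \<eta>\<^sup>2" using \<eta> by (simp add: ennreal_less_iff)
  have iX: "integrable M (\<lambda>\<omega>. X \<omega> - c)" using X by simp
  have "expectation X - c = expectation (\<lambda>\<omega>. X \<omega> - c)" using X by (simp add: prob_space)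
  then have "\<bar>expectation X - c\<bar> \<le> expectation (\<lambda>\<omega>. \<bar>X \<omega> - c\<bar>)" by (simp add: integral_abs_bound)
  also have "\<dots> \<le> expectation (\<lambda>\<omega>. \<eta> / 2 + 1 / (2 * \<eta>) * ?Z \<omega>)"
  proof (rule integral_mono)
    show "integrable M (\<lambda>\<omega>. \<eta> / 2 + 1 / (2 * \<eta>) * ?Z \<omega>)"
      by (intro Bochner_Integration.integrable_add integrable_mult_right iZ) simp
    fix \<omega>
    have "0 \<le> (\<bar>X \<omega> - c\<bar> - \<eta>)\<^sup>2" by simp
    then have "2 * \<eta> * \<bar>X \<omega> - c\<bar> \<le> \<eta>\<^sup>2 + ?Z \<omega>" by (simp add: power2_diff mult_ac)
    then show "\<bar>X \<omega> - c\<bar> \<le> \<eta> / 2 + 1 / (2 * \<eta>) * ?Z \<omega>"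
      using \<eta> by (simp add: field_simps power2_eq_square)
  qed (use iX in simp)
  also have "\<dots> = \<eta> / 2 + 1 / (2 * \<eta>) * expectation ?Z"
    using iZ by (simp add: prob_space)
  also have "\<dots> < \<eta> / 2 + 1 / (2 * \<eta>) * \<eta>\<^sup>2" using Z \<eta> by (intro add_strict_left_mono mult_strict_left_mono) auto
  also have "\<dots> = \<eta>" using \<eta> by (simp add: power2_eq_square)
  finally show ?thesis .
qed

section \<open>The scaling limit\<close>

theorem claim4p5:
  fixes K :: real
    and M :: "nat \<Rightarrow> 'a measure"
    and h :: "nat \<Rightarrow> real \<Rightarrow> 'a \<Rightarrow> int \<Rightarrow> int"
    and W :: "nat \<Rightarrow> real \<Rightarrow> 'a \<Rightarrow> int \<Rightarrow> real"
    and w :: "real \<Rightarrow> real \<Rightarrow> real"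
    and Jhat :: "real \<Rightarrow> real"
  assumes K_pos: "0 < K"
    and process: "\<And>N. 1 \<le> N \<Longrightarrow> metropolis_height_process K N (M N) (h N)"
    and W_def: "\<And>N t \<omega> i. W N t \<omega> i = real_of_int (third_diff (h N t \<omega>) i)"
    and w_cont: "continuous_time_torus w"
    and mesoscopic: "\<And>t x. 0 \<le> t \<Longrightarrow>
      iterated_limit
        (\<lambda>\<epsilon> N. \<integral>\<^sup>+\<omega>. ennreal (\<bar>window_avg N x \<epsilon> (W N t \<omega>) - w t x\<bar>\<^sup>2) \<partial>M N) 0"
    and Jhat_cont: "continuous_on UNIV Jhat"
    and local_equilibrium: "\<And>t x. 0 < t \<Longrightarrow>
      iterated_limit
        (\<lambda>\<epsilon> N. \<bar>(\<integral>\<omega>. window_avg N x \<epsilon> (\<lambda>i. J K (W N t \<omega> i)) \<partial>M N)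
                - Jhat (\<integral>\<omega>. window_avg N x \<epsilon> (W N t \<omega>) \<partial>M N)\<bar>) 0"
    and W_bound: "\<And>t. 0 \<le> t \<Longrightarrow>
      (SUP N\<in>{1..}. SUP i\<in>{1..int N}. \<integral>\<^sup>+\<omega>. ennreal \<bar>W N t \<omega> i\<bar> \<partial>M N) < \<infinity>"
    and J_integrable: "\<And>N s i. 1 \<le> N \<Longrightarrow> 0 < s \<Longrightarrow> i \<in> {1..int N} \<Longrightarrow>
      integrable (M N) (\<lambda>\<omega>. J K (W N s \<omega> i))"
    and J_bound: "\<And>t. 0 \<le> t \<Longrightarrow>
      (SUP N\<in>{1..}. SUP s\<in>{0<..t}. SUP i\<in>{1..int N}.
         ennreal \<bar>\<integral>\<omega>. J K (W N s \<omega> i) \<partial>M N\<bar>) < \<infinity>"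
  shows "weak_solution Jhat (w 0) w"
  unfolding weak_solution_def
proof (intro allI impI)
  fix t :: real and \<psi> :: "real \<Rightarrow> real"
  assume t: "0 < t" and \<psi>: "C4_torus \<psi>"
  define \<psi>4 where "\<psi>4 = (deriv ^^ 4) \<psi>"
  define EW where "EW N s i = (\<integral>\<omega>. W N s \<omega> i \<partial>M N)" for N s i
  define EJ where "EJ N s i = (\<integral>\<omega>. J K (W N s \<omega> i) \<partial>M N)" for N s i
  have per: "\<psi> (x + 1) = \<psi> x" for x using \<psi> by (simp add: C4_torus_def)
  have diff: "k < 4 \<Longrightarrow> (deriv ^^ k) \<psi> differentiable (at x)" for k x using \<psi> by (simp add: C4_torus_def)
  have cont4: "continuous_on UNIV \<psi>4" using \<psi> by (simp add: C4_torus_def \<psi>4_def)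
  have per4: "\<psi>4 (x + 1) = \<psi>4 x" for x unfolding \<psi>4_def using per by (rule funpow_deriv_periodic)
  have cont: "continuous_on UNIV \<psi>"
    using diff[of 0] by (auto intro!: continuous_at_imp_continuous_on differentiable_imp_continuous_within)
  have wc: "continuous_on UNIV (w s)" if "0 \<le> s" for s
  proof -
    have "continuous_on ({0..} \<times> UNIV) (\<lambda>(t, x). w t x)" using w_cont by (simp add: continuous_time_torus_def)
    moreover have "continuous_on UNIV (\<lambda>x. (s, x))"
      by (rule continuous_on_Pair[OF continuous_on_const continuous_on_id])
    ultimately have "continuous_on UNIV (\<lambda>x. case (s, x) of (t, x) \<Rightarrow> w t x)"
      by (rule continuous_on_compose2) (use that in auto)
    then show ?thesis by simp
  qed
  have Jwc: "continuous_on UNIV (\<lambda>x. Jhat (w s x))" if "0 \<le> s" for s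
    using continuous_on_compose2[OF Jhat_cont wc[OF that]] by simp
  have prob: "prob_space (M N)" if "1 \<le> N" for N
    using process[OF that] by (simp add: metropolis_height_process_def markov_jump_process_def)
  have W_meas: "(\<lambda>\<omega>. W N s \<omega> i) \<in> borel_measurable (M N)" if "1 \<le> N" "0 \<le> s" for N s i
  proof -
    have "h N s \<in> measurable (M N) (count_space (height_profiles N))"
      using process[OF that(1)] that(2) by (simp add: metropolis_height_process_def markov_jump_process_def)
    then have "(\<lambda>\<omega>. real_of_int (third_diff (h N s \<omega>) i)) \<in> borel_measurable (M N)"
      by (rule measurable_compose) simp
    then show ?thesis by (simp add: W_def)
  qed
  have fin: "\<exists>C\<ge>0. S = ennreal C" if "S < \<infinity>" for S :: ennreal using that by (cases S) auto
  have W_fact: "\<exists>C. \<forall>N\<ge>1. \<forall>i\<in>{1..int N}. integrable (M N) (\<lambda>\<omega>. W N s \<omega> i) \<and> \<bar>EW N s i\<bar> \<le> C" if s: "0 \<le> s" for s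
  proof -
    obtain C where C: "(SUP N\<in>{1..}. SUP i\<in>{1..int N}. \<integral>\<^sup>+\<omega>. ennreal \<bar>W N s \<omega> i\<bar> \<partial>M N) = ennreal C" "0 \<le> C"
      using fin[OF W_bound[OF s]] by blast
    have "integrable (M N) (\<lambda>\<omega>. W N s \<omega> i) \<and> \<bar>EW N s i\<bar> \<le> C" if N: "1 \<le> N" and i: "i \<in> {1..int N}" for N i
    proof
      have le: "(\<integral>\<^sup>+\<omega>. ennreal \<bar>W N s \<omega> i\<bar> \<partial>M N) \<le> ennreal C"
        unfolding C(1)[symmetric] by (rule SUP_upper2[of N], use N in simp, rule SUP_upper2[of i]) (use i in auto)
      show int: "integrable (M N) (\<lambda>\<omega>. W N s \<omega> i)"
        by (rule integrableI_bounded) (use W_meas[OF N s] le in \<open>auto intro: le_less_trans\<close>)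
      have "ennreal \<bar>EW N s i\<bar> \<le> (\<integral>\<^sup>+\<omega>. ennreal \<bar>W N s \<omega> i\<bar> \<partial>M N)"
        using integral_norm_bound_ennreal[OF int] by (simp add: EW_def)
      then show "\<bar>EW N s i\<bar> \<le> C" using le C(2) by (meson ennreal_le_iff order_trans)
    qed
    then show ?thesis by blast
  qed
  then have W_int: "integrable (M N) (\<lambda>\<omega>. W N s \<omega> i)" if "1 \<le> N" "0 \<le> s" "i \<in> {1..int N}" for N s i
    using that by blast
  obtain CJ where CJ: "\<And>N s i. 1 \<le> N \<Longrightarrow> 0 < s \<Longrightarrow> s \<le> t \<Longrightarrow> i \<in> {1..int N} \<Longrightarrow> \<bar>EJ N s i\<bar> \<le> CJ"
  proof -
    let ?S = "(SUP N\<in>{1..}. SUP s\<in>{0<..t}. SUP i\<in>{1..int N}. ennreal \<bar>\<integral>\<omega>. J K (W N s \<omega> i) \<partial>M N\<bar>)"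
    obtain C where C: "?S = ennreal C" "0 \<le> C"
      using fin[OF J_bound[of t]] t by (meson less_imp_le)
    have "\<bar>EJ N s i\<bar> \<le> C" if "1 \<le> N" "0 < s" "s \<le> t" "i \<in> {1..int N}" for N s i
    proof -
      have "ennreal \<bar>EJ N s i\<bar> \<le> ennreal C"
        unfolding C(1)[symmetric] EJ_def
        by (rule SUP_upper2[of N], use that in simp, rule SUP_upper2[of s], use that in simp, rule SUP_upper2[of i])
          (use that in auto)
      then show ?thesis using C(2) by simp
    qed
    then show ?thesis using that by blast
  qed
  have CJ0: "0 \<le> CJ" using CJ[of 1 t 1] t by fastforce
  have convW: "\<forall>\<^sub>F \<epsilon> in at_right 0. \<forall>\<^sub>F N in sequentially. \<bar>window_avg N x \<epsilon> (EW N s) - w s x\<bar> < \<eta>"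
    if s: "0 \<le> s" and \<eta>: "0 < \<eta>" for s x \<eta>
  proof -
    have "0 < ennreal (\<eta>\<^sup>2)" using \<eta> by simp
    from iterated_limit_less[OF mesoscopic[OF s] this, of x]
    show ?thesis
    proof eventually_elim
      case (elim \<epsilon>)
      then show ?case using eventually_ge_at_top[of 1]
      proof eventually_elim
        case (elim N)
        interpret prob_space "M N" using elim(2) by (rule prob)
        have int: "\<And>i. i \<in> {1..int N} \<Longrightarrow> integrable (M N) (\<lambda>\<omega>. W N s \<omega> i)"
          using W_int[OF elim(2) s] .
        have "integrable (M N) (\<lambda>\<omega>. window_avg N x \<epsilon> (W N s \<omega>))"
          by (rule expectation_window_avg(2)) (rule int)
        moreover have "expectation (\<lambda>\<omega>. window_avg N x \<epsilon> (W N s \<omega>)) = window_avg N x \<epsilon> (EW N s)"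
          unfolding EW_def by (rule expectation_window_avg(1)) (rule int)
        ultimately show ?case using expectation_small[OF _ \<eta> elim(1)] by simp
      qed
    qed
  qed
  have convJ: "\<forall>\<^sub>F \<epsilon> in at_right 0. \<forall>\<^sub>F N in sequentially. \<bar>window_avg N x \<epsilon> (EJ N s) - Jhat (w s x)\<bar> < \<eta>"
    if s: "0 < s" and \<eta>: "0 < \<eta>" for s x \<eta>
  proof -
    have "isCont Jhat (w s x)" using Jhat_cont by (simp add: continuous_on_eq_continuous_at)
    then obtain \<delta> where \<delta>: "0 < \<delta>" "\<And>y. \<bar>y - w s x\<bar> < \<delta> \<Longrightarrow> \<bar>Jhat y - Jhat (w s x)\<bar> < \<eta> / 2"
      using \<eta> unfolding continuous_at_eps_delta dist_real_def by (metis half_gt_zero)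
    have "0 < \<eta> / 2" using \<eta> by simp
    from iterated_limit_less[OF local_equilibrium[OF s] this, of x] convW[OF less_imp_le[OF s] \<delta>(1), of x]
    show ?thesis
    proof eventually_elim
      case (elim \<epsilon>)
      from elim eventually_ge_at_top[of 1] show ?case
      proof eventually_elim
        case (elim N)
        have "(\<integral>\<omega>. window_avg N x \<epsilon> (W N s \<omega>) \<partial>M N) = window_avg N x \<epsilon> (EW N s)"
          unfolding EW_def by (rule expectation_window_avg(1)) (use W_int[OF elim(3)] s in simp)
        moreover have "(\<integral>\<omega>. window_avg N x \<epsilon> (\<lambda>i. J K (W N s \<omega> i)) \<partial>M N) = window_avg N x \<epsilon> (EJ N s)"
          unfolding EJ_def by (rule expectation_window_avg(1)) (use J_integrable[OF elim(3) s] in simp)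
        ultimately have "\<bar>window_avg N x \<epsilon> (EJ N s) - Jhat (window_avg N x \<epsilon> (EW N s))\<bar> < \<eta> / 2"
          using elim(1) by simp
        with \<delta>(2)[OF elim(2)] show ?case by linarith
      qed
    qed
  qed
  let ?I = "\<lambda>N s. 1 / real N * (\<Sum>i\<in>{1..int N}. \<psi> (of_int i / real N) * EW N s i)"
  let ?L = "\<lambda>N s. 1 / real N * (\<Sum>i\<in>{1..int N}. \<psi>4 (of_int i / real N) * EJ N s i)"
  have I_lim: "(\<lambda>N. ?I N s) \<longlonglongrightarrow> integral {0..1} (\<lambda>x. \<psi> x * w s x)" if s: "0 \<le> s" for s
  proof -
    obtain C where C: "\<And>N i. 1 \<le> N \<Longrightarrow> i \<in> {1..int N} \<Longrightarrow> \<bar>EW N s i\<bar> \<le> C" using W_fact[OF s] by blast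
    show ?thesis
      by (rule mesoscopic_average[where a="\<lambda>N. EW N s", OF C wc[OF s] convW[OF s] cont periodic_torus_continuous[OF per cont]])
  qed
  have L_lim: "(\<lambda>N. ?L N s) \<longlonglongrightarrow> integral {0..1} (\<lambda>x. \<psi>4 x * Jhat (w s x))" if s: "0 < s" "s \<le> t" for s
    by (rule mesoscopic_average[where a="\<lambda>N. EJ N s" and v="\<lambda>x. Jhat (w s x)", OF CJ Jwc convJ cont4 periodic_torus_continuous[OF per4 cont4]])
      (use s in auto)
  define p where "p N i = \<psi> (real_of_int i / real N)" for N :: nat and i :: int
  have p_per: "periodic N (p N)" if "1 \<le> N" for N
    using that per by (simp add: periodic_def p_def add_divide_distrib)
  have taylor: "\<bar>real N ^ 4 * fourth_diff (p N) i - c\<bar> \<le> 2 * \<eta>"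
    if N: "1 \<le> N" and near: "\<And>s. \<bar>s - of_int i / real N\<bar> \<le> 2 / real N \<Longrightarrow> \<bar>\<psi>4 s - c\<bar> \<le> \<eta>" for N i c \<eta>
  proof -
    have "\<bar>(\<psi> (of_int i / real N + 2 * (1 / real N)) - 4 * \<psi> (of_int i / real N + 1 / real N) + 6 * \<psi> (of_int i / real N)
      - 4 * \<psi> (of_int i / real N - 1 / real N) + \<psi> (of_int i / real N - 2 * (1 / real N))) / (1 / real N) ^ 4 - c\<bar> \<le> 2 * \<eta>"
      by (rule fourth_difference_taylor[OF diff]) (use N near in \<open>auto simp: \<psi>4_def\<close>)
    then show ?thesis
      by (simp add: fourth_diff_def p_def add_divide_distrib diff_divide_distrib power_divide mult.commute)
  qed
  let ?F = "\<lambda>N s. - (1 / real N * (\<Sum>i\<in>{1..int N}. real N ^ 4 * fourth_diff (p N) i * EJ N s i))"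
  have F_int: "(?F N has_integral (?I N t - ?I N 0)) {0..t}" if N: "1 \<le> N" for N
  proof -
    have "((\<lambda>s. - (\<Sum>i\<in>{1..int N}. real N ^ 4 * fourth_diff (p N) i * EJ N s i)) has_integral
       ((\<Sum>i\<in>{1..int N}. p N i * EW N t i) - (\<Sum>i\<in>{1..int N}. p N i * EW N 0 i))) {0..t}"
      unfolding EJ_def EW_def W_def
      by (rule metropolis_evolution[OF K_pos N process[OF N] _ _ p_per[OF N]])
        (use W_int[OF N] J_integrable[OF N] t in \<open>auto simp: W_def\<close>)
    from has_integral_mult_right[OF this, of "1 / real N"] show ?thesis
      by (simp add: p_def right_diff_distrib)
  qed
  obtain B where B: "\<And>x. \<bar>\<psi>4 x\<bar> \<le> B" using periodic_bounded[OF per4 cont4] by blast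
  have average_le: "\<bar>1 / real N * (\<Sum>i\<in>{1..int N}. b i * EJ N s i)\<bar> \<le> D * CJ"
    if N: "1 \<le> N" and s: "0 < s" "s \<le> t" and b: "\<And>i. \<bar>b i\<bar> \<le> D" for N s b D
  proof -
    have D: "0 \<le> D" using b[of 0] by simp
    have "\<bar>\<Sum>i\<in>{1..int N}. b i * EJ N s i\<bar> \<le> (\<Sum>i\<in>{1..int N}. \<bar>b i * EJ N s i\<bar>)" by (rule sum_abs)
    also have "\<dots> \<le> of_nat (card {1..int N}) * (D * CJ)"
      by (rule sum_bounded_above) (use CJ[OF N s] b D in \<open>auto simp: abs_mult intro!: mult_mono\<close>)
    finally show ?thesis using N by (simp add: abs_mult field_simps)
  qed
  have F_bound: "\<bar>?F N s\<bar> \<le> 2 * B * CJ" if N: "1 \<le> N" and s: "0 < s" "s \<le> t" for N s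
    unfolding abs_minus_cancel by (rule average_le[OF N s]) (use taylor[OF N, of _ 0 B] B in simp)
  have F_lim: "(\<lambda>N. ?F N s) \<longlonglongrightarrow> - integral {0..1} (\<lambda>x. \<psi>4 x * Jhat (w s x))" if s: "0 < s" "s \<le> t" for s
  proof -
    \<comment> \<open>The sum contains the discrete fourth difference minus the fourth derivative, which tends to \<open>0\<close>
      uniformly because \<open>\<psi>4\<close> is uniformly continuous.\<close>
    have "(\<lambda>N. ?F N s + ?L N s) \<longlonglongrightarrow> 0"
    proof (rule LIMSEQ_I)
      fix r :: real assume r: "0 < r"
      define \<eta> where "\<eta> = r / (4 * (CJ + 1))"
      have \<eta>: "0 < \<eta>" using r CJ0 by (simp add: \<eta>_def)
      have small: "2 * \<eta> * CJ < r"
      proof -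
        have "2 * \<eta> * CJ \<le> 2 * \<eta> * (CJ + 1)" using \<eta> by simp
        also have "\<dots> = r / 2" using CJ0 by (simp add: \<eta>_def field_simps)
        finally show ?thesis using r by linarith
      qed
      obtain \<delta> where \<delta>: "0 < \<delta>" "\<And>x y. \<bar>x - y\<bar> \<le> \<delta> \<Longrightarrow> \<bar>\<psi>4 x - \<psi>4 y\<bar> \<le> \<eta>"
        using periodic_uniformly_continuous[OF per4 cont4 \<eta>] by blast
      obtain N0 :: nat where N0: "2 / \<delta> \<le> real N0" using real_arch_simple by blast
      show "\<exists>no. \<forall>N\<ge>no. norm (?F N s + ?L N s - 0) < r"
      proof (intro exI allI impI)
        fix N assume "max 1 N0 \<le> N"
        then have N: "1 \<le> N" and NN: "2 / \<delta> \<le> real N" using N0 by linarith+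
        have near: "2 / real N \<le> \<delta>" using NN N \<delta>(1) by (simp add: field_simps)
        have "?F N s + ?L N s = - (1 / real N * (\<Sum>i\<in>{1..int N}. (real N ^ 4 * fourth_diff (p N) i - \<psi>4 (of_int i / real N)) * EJ N s i))"
          by (simp add: left_diff_distrib sum_subtractf right_diff_distrib)
        also have "\<bar>- (1 / real N * (\<Sum>i\<in>{1..int N}. (real N ^ 4 * fourth_diff (p N) i - \<psi>4 (of_int i / real N)) * EJ N s i))\<bar> \<le> 2 * \<eta> * CJ"
          unfolding abs_minus_cancel
          by (rule average_le[OF N s], rule taylor[OF N], rule \<delta>(2)) (use near in linarith)
        finally show "norm (?F N s + ?L N s - 0) < r" using small by simp
      qed
    qed
    from tendsto_diff[OF this L_lim[OF s]] show ?thesis by simp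
  qed
  \<comment> \<open>At time \<open>0\<close> the expectation of \<open>J\<close> need not exist, so the integrands are set to \<open>0\<close> there.\<close>
  define f where "f n s = (if s = 0 then 0 else ?F (Suc n) s)" for n s
  define g where "g s = (if s = 0 then 0 else - integral {0..1} (\<lambda>x. \<psi>4 x * Jhat (w s x)))" for s
  have f_int: "(f n has_integral (?I (Suc n) t - ?I (Suc n) 0)) {0..t}" for n
    by (rule has_integral_spike_finite[of "{0}", OF _ _ F_int[of "Suc n"]]) (simp_all add: f_def)
  have "(\<lambda>n. integral {0..t} (f n)) \<longlonglongrightarrow> integral {0..t} g"
  proof (rule dominated_convergence(2)[where h="\<lambda>_. 2 * B * CJ"])
    show "f n integrable_on {0..t}" for n using f_int by blast
    show "norm (f n s) \<le> 2 * B * CJ" if "s \<in> {0..t}" for n s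
    proof (cases "s = 0")
      case True
      then show ?thesis using B[of 0] CJ0 by (simp add: f_def)
    next
      case False
      then show ?thesis using F_bound[of "Suc n" s] that by (simp add: f_def)
    qed
    show "(\<lambda>n. f n s) \<longlonglongrightarrow> g s" if "s \<in> {0..t}" for s
      using LIMSEQ_Suc[OF F_lim[of s]] that by (cases "s = 0") (auto simp: f_def g_def)
  qed (rule integrable_const_ivl)
  moreover have "integral {0..t} (f n) = ?I (Suc n) t - ?I (Suc n) 0" for n
    using f_int by (rule integral_unique)
  moreover have "(\<lambda>n. ?I (Suc n) t - ?I (Suc n) 0) \<longlonglongrightarrow>
      integral {0..1} (\<lambda>x. \<psi> x * w t x) - integral {0..1} (\<lambda>x. \<psi> x * w 0 x)"
    using tendsto_diff[OF LIMSEQ_Suc[OF I_lim[of t]] LIMSEQ_Suc[OF I_lim[of 0]]] t by simp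
  ultimately have "integral {0..t} g = integral {0..1} (\<lambda>x. \<psi> x * w t x) - integral {0..1} (\<lambda>x. \<psi> x * w 0 x)"
    using LIMSEQ_unique by simp
  moreover have "integral {0..t} g = - integral {0..t} (\<lambda>s. integral {0..1} (\<lambda>x. \<psi>4 x * Jhat (w s x)))"
  proof -
    have "integral {0..t} g = integral {0..t} (\<lambda>s. - integral {0..1} (\<lambda>x. \<psi>4 x * Jhat (w s x)))"
      by (rule integral_spike[of "{0}"]) (auto simp: g_def)
    then show ?thesis by simp
  qed
  moreover have "integral {0..1} (\<lambda>x. \<psi> x * (w t x - w 0 x))
      = integral {0..1} (\<lambda>x. \<psi> x * w t x) - integral {0..1} (\<lambda>x. \<psi> x * w 0 x)"
  proof -
    have "(\<lambda>x. \<psi> x * w s x) integrable_on {0..1}" if "0 \<le> s" for s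
      by (intro integrable_continuous_real continuous_on_mult continuous_on_subset[OF cont] continuous_on_subset[OF wc[OF that]]) auto
    from Henstock_Kurzweil_Integration.integral_diff[OF this this, of t 0] show ?thesis
      using t by (simp add: right_diff_distrib)
  qed
  ultimately show "integral {0..1} (\<lambda>x. \<psi> x * (w t x - w 0 x)) =
    - integral {0..t} (\<lambda>s. integral {0..1} (\<lambda>x. (deriv ^^ 4) \<psi> x * Jhat (w s x)))"
    by (simp add: \<psi>4_def)
qed

end
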